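(* For every constant $\delta>0$ and every $k$ there is an algorithm that, given any $n$-player $k$-strategy anonymous game, runs in time polynomial in $n$ (where the polynomial may depend on $\delta$ and $k$, i.e. in time $\mathrm{poly}_{\delta,k}(n)$) and computes a $(1/n^{1-\delta})$-approximate Nash equilibrium of the game.
   Context: Anonymous game: a tuple $(n,k,\{u^i_a\}_{i\in[n],a\in[k]})$ with players $[n]=\{1,\dots,n\}$ and a common strategy set $[k]=\{1,\dots,k\}$. When player $i$ plays strategy $a$, her payoff is $u^i_a(x)$, where $u^i_a:\Pi^k_{n-1}\to[0,1]$ and $\Pi^k_{n-1}=\{(x_1,\dots,x_k): x_j\in\mathbb{Z}_{\ge 0},\ \sum_{j=1}^k x_j=n-1\}$; here $x_j$ is the number of the other $n-1$ players who play strategy $j$. The input to an algorithm is the list of all values $u^i_a(x)$. A mixed strategy is a probability distribution on $[k]$; a mixed strategy profile is $s=(s_1,\dots,s_n)$ with each $s_i$ a mixed strategy, and $s_{-i}$ denotes the strategies of the players other than $i$. Writing $x\sim s_{-i}$ for the random partition in $\Pi^k_{n-1}$ obtained by independently drawing each player $j\ne i$'s strategy from $s_j$, the profile $s$ is an $\epsilon$-approximate Nash equilibrium iff for all $i\in[n]$ and all $a'\in[k]$, $$\mathbb{E}_{x\sim s_{-i}}[u^i_{a'}(x)]\le \mathbb{E}_{x\sim s_{-i},\,a\sim s_i}[u^i_a(x)]+\epsilon .$$ Standing assumption: given a mixed strategy profile, players' expected payoffs can be computed exactly (they can be computed to precision $\epsilon$ in time $\mathrm{poly}(n^k\log(1/\epsilon))$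 by dynamic programming). *)

theory Defs
  imports "HOL-Probability.Probability" "HOL-Probability.Product_PMF"
    "HOL-Computational_Algebra.Polynomial"
begin

section \<open>Anonymous games\<close>

text \<open>
  Players are \<open>0, \<dots>, n - 1\<close> and strategies are \<open>0, \<dots>, k - 1\<close>.  A payoff family
  \<open>u\<close> gives \<open>u i a x\<close>, the payoff of player \<open>i\<close> for strategy \<open>a\<close> when \<open>x ! b\<close> of
  the other players play strategy \<open>b\<close>.
\<close>

type_synonym payoffs = "nat \<Rightarrow> nat \<Rightarrow> nat list \<Rightarrow> real"

definition partitions :: "nat \<Rightarrow> nat \<Rightarrow> nat list set" where
  "partitions k m = {x. length x = k \<and> sum_list x = m}"

definition anonymous_game :: "nat \<Rightarrow> nat \<Rightarrow> payoffs \<Rightarrow> bool" where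
  "anonymous_game n k u \<longleftrightarrow>
     (\<forall>i<n. \<forall>a<k. \<forall>x\<in>partitions k (n - 1). u i a x \<in> {0..1})"

definition mixed_profile :: "nat \<Rightarrow> nat \<Rightarrow> (nat \<Rightarrow> nat pmf) \<Rightarrow> bool" where
  "mixed_profile n k s \<longleftrightarrow> (\<forall>i<n. set_pmf (s i) \<subseteq> {..<k})"

definition others :: "nat \<Rightarrow> nat \<Rightarrow> nat set" where
  "others n i = {..<n} - {i}"

definition partition_of :: "nat \<Rightarrow> nat set \<Rightarrow> (nat \<Rightarrow> nat) \<Rightarrow> nat list" where
  "partition_of k J f = map (\<lambda>b. card {j \<in> J. f j = b}) [0..<k]"

text \<open>The law of \<open>x \<sim> s\<^sub>-\<^sub>i\<close>: draw the strategies of the other players independently and count.\<close>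

definition others_pmf :: "nat \<Rightarrow> nat \<Rightarrow> (nat \<Rightarrow> nat pmf) \<Rightarrow> nat \<Rightarrow> nat list pmf" where
  "others_pmf n k s i =
     map_pmf (partition_of k (others n i)) (Pi_pmf (others n i) 0 s)"

definition approx_nash ::
  "nat \<Rightarrow> nat \<Rightarrow> payoffs \<Rightarrow> real \<Rightarrow> (nat \<Rightarrow> nat pmf) \<Rightarrow> bool" where
  "approx_nash n k u \<epsilon> s \<longleftrightarrow>
     mixed_profile n k s \<and>
     (\<forall>i<n. \<forall>a'<k.
        measure_pmf.expectation (others_pmf n k s i) (\<lambda>x. u i a' x)
        \<le> measure_pmf.expectation (pair_pmf (others_pmf n k s i) (s i)) (\<lambda>(x, a). u i a x) + \<epsilon>)"


section \<open>Real RAM programs\<close>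

text \<open>
  The payoffs are real numbers and the running time is measured in the number of players
  alone, so the machine model is the real RAM: exact arithmetic and comparison of real
  numbers take unit time, and there is no rounding of a real number to an integer.  Programs
  are structured, and address named arrays of natural numbers (used for counters and
  addresses) and of real numbers; a scalar variable is cell 0 of an array.  Constants in a
  program are rational, so that real constants cannot carry extra information.  Natural
  numbers have no unit-time multiplication, so their bit length grows at most linearly with time.
\<close>

type_synonym vname = string

datatype nexp =
    NConst nat
  | NGet vname nexp
  | NAdd nexp nexp
  | NSub nexp nexp

datatype rexp =
    RConst rat
  | RGet vname nexp
  | ROfNat nexp
  | RAdd rexp rexp
  | RSub rexp rexp
  | RMul rexp rexp
  | RDiv rexp rexp

datatype bexp =
    NLess nexp nexp
  | RLess rexp rexp
  | BNot bexp
  | BAnd bexp bexp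

datatype com =
    Skip
  | NSet vname nexp nexp
  | RSet vname nexp rexp
  | Seq com com
  | If bexp com com
  | While bexp com

record state =
  nats :: "vname \<Rightarrow> nat \<Rightarrow> nat"
  reals :: "vname \<Rightarrow> nat \<Rightarrow> real"

text \<open>Subtraction in \<open>NSub\<close> is truncated at 0, and division by 0 in \<open>RDiv\<close> yields 0.\<close>

primrec nval :: "nexp \<Rightarrow> state \<Rightarrow> nat" where
  "nval (NConst c) \<sigma> = c"
| "nval (NGet v e) \<sigma> = nats \<sigma> v (nval e \<sigma>)"
| "nval (NAdd e e') \<sigma> = nval e \<sigma> + nval e' \<sigma>"
| "nval (NSub e e') \<sigma> = nval e \<sigma> - nval e' \<sigma>"

primrec rval :: "rexp \<Rightarrow> state \<Rightarrow> real" where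
  "rval (RConst c) \<sigma> = of_rat c"
| "rval (RGet v e) \<sigma> = reals \<sigma> v (nval e \<sigma>)"
| "rval (ROfNat e) \<sigma> = real (nval e \<sigma>)"
| "rval (RAdd e e') \<sigma> = rval e \<sigma> + rval e' \<sigma>"
| "rval (RSub e e') \<sigma> = rval e \<sigma> - rval e' \<sigma>"
| "rval (RMul e e') \<sigma> = rval e \<sigma> * rval e' \<sigma>"
| "rval (RDiv e e') \<sigma> = rval e \<sigma> / rval e' \<sigma>"

primrec bval :: "bexp \<Rightarrow> state \<Rightarrow> bool" where
  "bval (NLess e e') \<sigma> \<longleftrightarrow> nval e \<sigma> < nval e' \<sigma>"
| "bval (RLess e e') \<sigma> \<longleftrightarrow> rval e \<sigma> < rval e' \<sigma>"
| "bval (BNot b) \<sigma> \<longleftrightarrow> \<not> bval b \<sigma>"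
| "bval (BAnd b b') \<sigma> \<longleftrightarrow> bval b \<sigma> \<and> bval b' \<sigma>"

text \<open>Evaluating an expression takes one step for each of its nodes.\<close>

primrec ncost :: "nexp \<Rightarrow> nat" where
  "ncost (NConst c) = 1"
| "ncost (NGet v e) = 1 + ncost e"
| "ncost (NAdd e e') = 1 + ncost e + ncost e'"
| "ncost (NSub e e') = 1 + ncost e + ncost e'"

primrec rcost :: "rexp \<Rightarrow> nat" where
  "rcost (RConst c) = 1"
| "rcost (RGet v e) = 1 + ncost e"
| "rcost (ROfNat e) = 1 + ncost e"
| "rcost (RAdd e e') = 1 + rcost e + rcost e'"
| "rcost (RSub e e') = 1 + rcost e + rcost e'"
| "rcost (RMul e e') = 1 + rcost e + rcost e'"
| "rcost (RDiv e e') = 1 + rcost e + rcost e'"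

primrec bcost :: "bexp \<Rightarrow> nat" where
  "bcost (NLess e e') = 1 + ncost e + ncost e'"
| "bcost (RLess e e') = 1 + rcost e + rcost e'"
| "bcost (BNot b) = 1 + bcost b"
| "bcost (BAnd b b') = 1 + bcost b + bcost b'"

definition nset :: "vname \<Rightarrow> nat \<Rightarrow> nat \<Rightarrow> state \<Rightarrow> state" where
  "nset v j c \<sigma> = \<sigma>\<lparr>nats := (nats \<sigma>)(v := (nats \<sigma> v)(j := c))\<rparr>"

definition rset :: "vname \<Rightarrow> nat \<Rightarrow> real \<Rightarrow> state \<Rightarrow> state" where
  "rset v j c \<sigma> = \<sigma>\<lparr>reals := (reals \<sigma>)(v := (reals \<sigma> v)(j := c))\<rparr>"

text \<open>\<open>exec c \<sigma> t \<tau>\<close>: started in \<open>\<sigma>\<close>, program \<open>c\<close> halts after \<open>t\<close> steps in state \<open>\<tau>\<close>.\<close>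

inductive exec :: "com \<Rightarrow> state \<Rightarrow> nat \<Rightarrow> state \<Rightarrow> bool" where
  Skip: "exec Skip \<sigma> 1 \<sigma>"
| NSet: "exec (NSet v e e') \<sigma> (1 + ncost e + ncost e') (nset v (nval e \<sigma>) (nval e' \<sigma>) \<sigma>)"
| RSet: "exec (RSet v e e') \<sigma> (1 + ncost e + rcost e') (rset v (nval e \<sigma>) (rval e' \<sigma>) \<sigma>)"
| Seq: "exec c \<sigma> t \<rho> \<Longrightarrow> exec c' \<rho> t' \<tau> \<Longrightarrow> exec (Seq c c') \<sigma> (1 + t + t') \<tau>"
| IfTrue: "bval b \<sigma> \<Longrightarrow> exec c \<sigma> t \<tau> \<Longrightarrow> exec (If b c c') \<sigma> (1 + bcost b + t) \<tau>"
| IfFalse: "\<not> bval b \<sigma> \<Longrightarrow> exec c' \<sigma> t \<tau> \<Longrightarrow> exec (If b c c') \<sigma> (1 + bcost b + t) \<tau>"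
| WhileFalse: "\<not> bval b \<sigma> \<Longrightarrow> exec (While b c) \<sigma> (1 + bcost b) \<sigma>"
| WhileTrue: "bval b \<sigma> \<Longrightarrow> exec c \<sigma> t \<rho> \<Longrightarrow> exec (While b c) \<rho> t' \<tau> \<Longrightarrow>
    exec (While b c) \<sigma> (1 + bcost b + t + t') \<tau>"

inductive_cases exec_cases:
  "exec Skip \<sigma> t \<tau>" "exec (NSet v e e') \<sigma> t \<tau>" "exec (RSet v e e'') \<sigma> t \<tau>"
  "exec (Seq c c') \<sigma> t \<tau>" "exec (If b c c') \<sigma> t \<tau>" "exec (While b c) \<sigma> t \<tau>"

lemma exec_deterministic:
  "exec c \<sigma> t \<tau> \<Longrightarrow> exec c \<sigma> t' \<tau>' \<Longrightarrow> t' = t \<and> \<tau>' = \<tau>"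
proof (induction arbitrary: t' \<tau>' rule: exec.induct)
  case (Seq c \<sigma> t \<rho> c' t2 \<tau>)
  from Seq.prems show ?case by (rule exec_cases) (auto dest!: Seq.IH)
next
  case (IfTrue b \<sigma> c t \<tau> c')
  from IfTrue.prems show ?case by (rule exec_cases) (use IfTrue.hyps in \<open>auto dest: IfTrue.IH\<close>)
next
  case (IfFalse b \<sigma> c' t \<tau> c)
  from IfFalse.prems show ?case by (rule exec_cases) (use IfFalse.hyps in \<open>auto dest: IfFalse.IH\<close>)
next
  case (WhileFalse b \<sigma> c)
  from WhileFalse.prems show ?case by (rule exec_cases) (use WhileFalse.hyps in auto)
next
  case (WhileTrue b \<sigma> c t \<rho> t2 \<tau>)
  from WhileTrue.prems show ?case
    by (rule exec_cases) (use WhileTrue.hyps in \<open>auto dest!: WhileTrue.IH\<close>)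
qed (erule exec_cases, simp)+


section \<open>Input and output\<close>

fun partition_list :: "nat \<Rightarrow> nat \<Rightarrow> nat list list" where
  "partition_list 0 m = (if m = 0 then [[]] else [])"
| "partition_list (Suc k) m =
     concat (map (\<lambda>j. map ((#) j) (partition_list k (m - j))) [0..<Suc m])"

lemma set_partition_list: "set (partition_list k m) = partitions k m"
proof (induction k arbitrary: m)
  case 0
  show ?case by (auto simp: partitions_def)
next
  case (Suc k)
  show ?case
  proof (intro set_eqI iffI)
    fix x assume "x \<in> set (partition_list (Suc k) m)"
    then show "x \<in> partitions (Suc k) m" by (auto simp: Suc partitions_def)
  next
    fix x assume "x \<in> partitions (Suc k) m"
    then obtain j y where "x = j # y" "length y = k" "j + sum_list y = m"
      by (cases x) (auto simp: partitions_def)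
    then show "x \<in> set (partition_list (Suc k) m)"
      by (auto simp del: upt_Suc simp: Suc partitions_def intro!: bexI[of _ j])
  qed
qed

lemma distinct_partition_list: "distinct (partition_list k m)"
proof (induction k arbitrary: m)
  case (Suc k)
  have "distinct (concat (map (\<lambda>j. map ((#) j) (partition_list k (m - j))) js))"
    if "distinct js" for js
    using that by (induction js) (auto simp: distinct_map Suc)
  from this[of "[0..<Suc m]"] show ?case by simp
qed simp

definition payoff_list :: "nat \<Rightarrow> nat \<Rightarrow> payoffs \<Rightarrow> real list" where
  "payoff_list n k u = [u i a x. i \<leftarrow> [0..<n], a \<leftarrow> [0..<k], x \<leftarrow> partition_list k (n - 1)]"

text \<open>
  Initially \<open>n\<close> is in cell 0 of \<open>''n''\<close>, the list of payoffs is in the array \<open>''u''\<close>, and all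
  other cells are 0.  On halting, the array \<open>''s''\<close> holds the \<open>n \<times> k\<close> probabilities of the
  profile, player by player.
\<close>

definition input_state :: "nat \<Rightarrow> nat \<Rightarrow> payoffs \<Rightarrow> state" where
  "input_state n k u =
     \<lparr>nats = (\<lambda>v j. if v = ''n'' \<and> j = 0 then n else 0),
      reals = (\<lambda>v j. if v = ''u'' \<and> j < length (payoff_list n k u)
                     then payoff_list n k u ! j else 0)\<rparr>"

definition outputs_profile :: "nat \<Rightarrow> nat \<Rightarrow> state \<Rightarrow> (nat \<Rightarrow> nat pmf) \<Rightarrow> bool" where
  "outputs_profile n k \<tau> s \<longleftrightarrow>
     (\<forall>i<n. \<forall>a<k. reals \<tau> ''s'' (i * k + a) = pmf (s i) a)"

end

theory Submission
  imports Defs "HOL-Real_Asymp.Real_Asymp"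
begin

text \<open>
  The strategies are restricted to a grid and mixed with uniform noise \<open>\<theta>\<close> slightly below
  \<open>1/n\<^sup>1\<^sup>-\<^sup>\<delta>\<close>; by Kuhn's lemma such profiles still contain a \<open>(\<theta> + O(1/n))\<close>-approximate equilibrium.
  At a root of unity, the Fourier transform of the law of the partition is a product of
  factors \<open>1 + d\<close>, one per player.  If one player has a factor that differs from 1 by more than a
  small constant power of \<open>1/n\<close>, the noise keeps all factors away from the unit circle and
  the product is negligible; otherwise Newton's identities show that it is determined up to a small error by
  the first \<open>K\<close> power sums of the \<open>d\<close>, for a constant \<open>K\<close>.  Each grid strategy gets a polynomially bounded
  integer weight such that the total weight of a profile determines these power sums.

  The law of the other players is thus nearly a function of their total weight.  For each total
  weight \<open>T\<close>, dynamic programming averages the laws of all lists of \<open>n - 1\<close> strategies of weight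
  \<open>T - w c\<close>; player \<open>i\<close> accepts \<open>c\<close> if it is nearly a best response to that average, and a second dynamic
  program looks for a profile of accepted strategies of total weight \<open>T\<close>.
\<close>

section \<open>Running time bounds\<close>

text \<open>The noise \<theta> serves two opposed ends. Let \<open>r\<close> be the distance from 1
  at which a factor counts as far. In the far case the product is negligible only if
  \<open>n * \<theta> * r^2\<close> grows like a power of n; otherwise truncating the logarithms at
  degree \<open>K\<close> leaves an error of order \<open>n * r^(K+1)\<close>, small for constant
  \<open>K\<close> only if \<open>r\<close> is a negative power of n. With \<theta> = x / (n + 1), x
  about n^(1/q) and r = x^(-1/4) both hold, and 1/q < \<delta> pays for it. This works for large n;
  for the finitely many smaller n the noise is 0 and \<open>K\<close> is so large that the power
  sums determine the product exactly, which is the place of Newton's identities.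

  Replacing laws by averages costs 2/16 of 1/(n + 1) twice: once so that the grid equilibrium passes
  the test, once so that whatever passes is an approximate equilibrium.

  The machine has no rounding and no multiplication of natural numbers. So each table is described
  by an arithmetic term with bounded sums, and integer division, minimisation and array access
  become searches over polynomial ranges.\<close>

definition run :: "com \<Rightarrow> state \<Rightarrow> nat \<Rightarrow> state \<Rightarrow> bool" where
  "run c \<sigma> T \<tau> \<longleftrightarrow> (\<exists>t\<le>T. exec c \<sigma> t \<tau>)"

definition hoare :: "(state \<Rightarrow> bool) \<Rightarrow> com \<Rightarrow> nat \<Rightarrow> (state \<Rightarrow> bool) \<Rightarrow> bool" where
  "hoare P c T Q \<longleftrightarrow> (\<forall>\<sigma>. P \<sigma> \<longrightarrow> (\<exists>\<tau>. run c \<sigma> T \<tau> \<and> Q \<tau>))"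

lemma hoare_conseq:
  assumes "hoare P c T Q" "\<And>\<sigma>. P' \<sigma> \<Longrightarrow> P \<sigma>" "\<And>\<sigma>. Q \<sigma> \<Longrightarrow> Q' \<sigma>" "T \<le> T'"
  shows "hoare P' c T' Q'"
  using assms unfolding hoare_def run_def by (meson order_trans)

lemma hoare_nset:
  assumes "\<And>\<sigma>. P \<sigma> \<Longrightarrow> Q (nset v (nval e \<sigma>) (nval e' \<sigma>) \<sigma>)" "1 + ncost e + ncost e' \<le> T"
  shows "hoare P (NSet v e e') T Q"
  using assms unfolding hoare_def run_def by (metis exec.NSet)

lemma hoare_rset:
  assumes "\<And>\<sigma>. P \<sigma> \<Longrightarrow> Q (rset v (nval e \<sigma>) (rval e' \<sigma>) \<sigma>)" "1 + ncost e + rcost e' \<le> T"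
  shows "hoare P (RSet v e e') T Q"
  using assms unfolding hoare_def run_def by (metis exec.RSet)

lemma hoare_seq:
  assumes "hoare P c T R" "hoare R c' T' Q" "1 + T + T' \<le> U"
  shows "hoare P (Seq c c') U Q"
  unfolding hoare_def
proof (intro allI impI)
  fix \<sigma> assume "P \<sigma>"
  then obtain \<rho> t where 1: "t \<le> T" "exec c \<sigma> t \<rho>" "R \<rho>"
    using assms(1) unfolding hoare_def run_def by blast
  then obtain \<tau> t' where 2: "t' \<le> T'" "exec c' \<rho> t' \<tau>" "Q \<tau>"
    using assms(2) unfolding hoare_def run_def by blast
  have "exec (Seq c c') \<sigma> (1 + t + t') \<tau>" by (rule exec.Seq[OF 1(2) 2(2)])
  then show "\<exists>\<tau>. run (Seq c c') \<sigma> U \<tau> \<and> Q \<tau>"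
    using 1(1) 2(1,3) assms(3) unfolding run_def
    by (intro exI[of _ \<tau>] conjI exI[of _ "1 + t + t'"]) auto
qed

lemma hoare_if:
  assumes "hoare (\<lambda>\<sigma>. P \<sigma> \<and> bval b \<sigma>) c T Q" "hoare (\<lambda>\<sigma>. P \<sigma> \<and> \<not> bval b \<sigma>) c' T Q"
    and "1 + bcost b + T \<le> U"
  shows "hoare P (If b c c') U Q"
  unfolding hoare_def
proof (intro allI impI)
  fix \<sigma> assume "P \<sigma>"
  obtain \<tau> t where 1: "t \<le> T" "exec (if bval b \<sigma> then c else c') \<sigma> t \<tau>" "Q \<tau>"
    using assms(1,2) \<open>P \<sigma>\<close> unfolding hoare_def run_def by (cases "bval b \<sigma>") auto
  have "exec (If b c c') \<sigma> (1 + bcost b + t) \<tau>"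
    using exec.IfTrue[of b \<sigma> c t \<tau> c'] exec.IfFalse[of b \<sigma> c' t \<tau> c] 1(2) by (cases "bval b \<sigma>") auto
  then show "\<exists>\<tau>. run (If b c c') \<sigma> U \<tau> \<and> Q \<tau>"
    using 1 assms(3) unfolding run_def
    by (intro exI[of _ \<tau>] conjI exI[of _ "1 + bcost b + t"]) auto
qed

text \<open>All compiled loops are counting loops, so the invariant carries the number
  \<open>i\<close> of completed passes, \<open>cond\<close> forces exactly \<open>m\<close> of them,
  and termination needs no separate variant.\<close>

lemma hoare_count:
  assumes step: "\<And>i. i < m \<Longrightarrow> hoare (J i) c T (J (Suc i))"
    and cond: "\<And>i \<sigma>. i \<le> m \<Longrightarrow> J i \<sigma> \<Longrightarrow> bval b \<sigma> \<longleftrightarrow> i < m"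
    and U: "m * (1 + bcost b + T) + 1 + bcost b \<le> U"
  shows "hoare (J 0) (While b c) U (J m)"
proof -
  have "\<exists>\<tau>. run (While b c) \<sigma> (j * (1 + bcost b + T) + 1 + bcost b) \<tau> \<and> J m \<tau>"
    if "j \<le> m" "J (m - j) \<sigma>" for j \<sigma>
    using that
  proof (induction j arbitrary: \<sigma>)
    case 0
    then have "\<not> bval b \<sigma>" using cond[of m] by simp
    then have "exec (While b c) \<sigma> (1 + bcost b) \<sigma>" by (rule exec.WhileFalse)
    then show ?case using 0 unfolding run_def by (intro exI[of _ \<sigma>]) auto
  next
    case (Suc j)
    let ?i = "m - Suc j"
    have i: "?i < m" "Suc ?i = m - j" using Suc.prems by auto
    have b: "bval b \<sigma>" using cond[of ?i \<sigma>] Suc.prems i by simp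
    obtain \<rho> t where 1: "t \<le> T" "exec c \<sigma> t \<rho>" "J (m - j) \<rho>"
      using step[OF i(1)] Suc.prems(2) unfolding hoare_def run_def i(2) by blast
    obtain \<tau> t' where 2: "t' \<le> j * (1 + bcost b + T) + 1 + bcost b" "exec (While b c) \<rho> t' \<tau>"
      "J m \<tau>"
      using Suc.IH[OF _ 1(3)] Suc.prems(1) unfolding run_def by auto
    have "exec (While b c) \<sigma> (1 + bcost b + t + t') \<tau>"
      by (rule exec.WhileTrue[OF b 1(2) 2(2)])
    then show ?case using 1(1) 2(1,3) unfolding run_def
      by (intro exI[of _ \<tau>] conjI exI[of _ "1 + bcost b + t + t'"]) auto
  qed
  from this[of m] have "\<exists>\<tau>. run (While b c) \<sigma> U \<tau> \<and> J m \<tau>" if "J 0 \<sigma>" for \<sigma>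
    using that U unfolding run_def by (metis diff_self_eq_0 order_refl order_trans)
  then show ?thesis unfolding hoare_def by blast
qed

lemma state_simps [simp]:
  "nats (nset v j c \<sigma>) w = (if w = v then (nats \<sigma> v)(j := c) else nats \<sigma> w)"
  "reals (nset v j c \<sigma>) = reals \<sigma>"
  "nats (rset v j d \<sigma>) = nats \<sigma>"
  "reals (rset v j d \<sigma>) w = (if w = v then (reals \<sigma> v)(j := d) else reals \<sigma> w)"
  by (auto simp: nset_def rset_def)


section \<open>A term language and its compiler\<close>

text \<open>
  Variables are de Bruijn indices for counters of enclosing sums; \<open>Sm e t\<close> sums over the
  counters below \<open>(n + 1) ^ e\<close>.  The array \<open>''y''\<close> is reserved for the evaluation stack,
  hence reading it is given the value 0.
\<close>

datatype tm =
    Cn rat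
  | Vr nat
  | Nn
  | Rd vname nat
  | Ad tm tm
  | Sb tm tm
  | Ml tm tm
  | Dv tm tm
  | Lt tm tm
  | Sm nat tm

primrec ev :: "tm \<Rightarrow> (nat \<Rightarrow> nat) \<Rightarrow> (vname \<Rightarrow> nat \<Rightarrow> real) \<Rightarrow> nat \<Rightarrow> real" where
  "ev (Cn c) \<rho> A n = of_rat c"
| "ev (Vr i) \<rho> A n = real (\<rho> i)"
| "ev Nn \<rho> A n = real n"
| "ev (Rd a i) \<rho> A n = (if a = ''y'' then 0 else A a (\<rho> i))"
| "ev (Ad t t') \<rho> A n = ev t \<rho> A n + ev t' \<rho> A n"
| "ev (Sb t t') \<rho> A n = ev t \<rho> A n - ev t' \<rho> A n"
| "ev (Ml t t') \<rho> A n = ev t \<rho> A n * ev t' \<rho> A n"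
| "ev (Dv t t') \<rho> A n = ev t \<rho> A n / ev t' \<rho> A n"
| "ev (Lt t t') \<rho> A n = (if ev t \<rho> A n < ev t' \<rho> A n then 1 else 0)"
| "ev (Sm e t) \<rho> A n = (\<Sum>i<(n + 1) ^ e. ev t (case_nat i \<rho>) A n)"

section \<open>Compilation of terms to stack code\<close>

abbreviation yr :: "nat \<Rightarrow> rexp" where "yr r \<equiv> RGet ''y'' (NConst r)"

text \<open>The counter of nesting level \<open>l\<close> lives in cell \<open>l\<close> of
  \<open>''x''\<close>, so de Bruijn index \<open>i\<close> at depth \<open>d\<close> is cell
  \<open>d - 1 - i\<close>. An index beyond the depth gives 0, in accordance with
  \<open>ctx\<close>.\<close>

definition var :: "nat \<Rightarrow> nat \<Rightarrow> nexp" where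
  "var d i = (if i < d then NGet ''x'' (NConst (d - 1 - i)) else NConst 0)"

text \<open>Natural numbers can only be added and subtracted, so the power is built in cell
  \<open>d\<close> of \<open>''b''\<close> by repeated addition; \<open>''p''\<close> holds the
  previous power and the number of additions made.\<close>

primrec pw :: "nat \<Rightarrow> nat \<Rightarrow> com" where
  "pw d 0 = NSet ''b'' (NConst d) (NConst 1)"
| "pw d (Suc e) = Seq (pw d e) (Seq (NSet ''p'' (NConst 0) (NGet ''b'' (NConst d)))
     (Seq (NSet ''p'' (NConst 1) (NConst 0)) (Seq (NSet ''b'' (NConst d) (NConst 0))
       (While (NLess (NGet ''p'' (NConst 1)) (NAdd (NGet ''n'' (NConst 0)) (NConst 1)))
         (Seq (NSet ''b'' (NConst d) (NAdd (NGet ''b'' (NConst d)) (NGet ''p'' (NConst 0))))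
           (NSet ''p'' (NConst 1) (NAdd (NGet ''p'' (NConst 1)) (NConst 1))))))))"

text \<open>Cell \<open>d\<close> of \<open>''b''\<close> belongs to the loop at depth
  \<open>d\<close>, so a nested loop leaves the bounds of the enclosing ones intact.\<close>

definition for_loop :: "nat \<Rightarrow> nat \<Rightarrow> com \<Rightarrow> com" where
  "for_loop d e c = Seq (pw d e) (Seq (NSet ''x'' (NConst d) (NConst 0))
     (While (NLess (NGet ''x'' (NConst d)) (NGet ''b'' (NConst d)))
       (Seq c (NSet ''x'' (NConst d) (NAdd (NGet ''x'' (NConst d)) (NConst 1))))))"

definition bin :: "(rexp \<Rightarrow> rexp \<Rightarrow> rexp) \<Rightarrow> nat \<Rightarrow> com \<Rightarrow> com \<Rightarrow> com" where
  "bin f r c c' = Seq c (Seq c' (RSet ''y'' (NConst r) (f (yr r) (yr (Suc r)))))"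

text \<open>The value is left in cell \<open>r\<close> of \<open>''y''\<close> and no lower cell is
  written, so a pending left operand survives. \<open>d\<close> is the number of counters in
  scope.\<close>

primrec cmpl :: "tm \<Rightarrow> nat \<Rightarrow> nat \<Rightarrow> com" where
  "cmpl (Cn c) d r = RSet ''y'' (NConst r) (RConst c)"
| "cmpl (Vr i) d r = RSet ''y'' (NConst r) (ROfNat (var d i))"
| "cmpl Nn d r = RSet ''y'' (NConst r) (ROfNat (NGet ''n'' (NConst 0)))"
| "cmpl (Rd a i) d r =
     RSet ''y'' (NConst r) (if a = ''y'' then RConst 0 else RGet a (var d i))"
| "cmpl (Ad t t') d r = bin RAdd r (cmpl t d r) (cmpl t' d (Suc r))"
| "cmpl (Sb t t') d r = bin RSub r (cmpl t d r) (cmpl t' d (Suc r))"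
| "cmpl (Ml t t') d r = bin RMul r (cmpl t d r) (cmpl t' d (Suc r))"
| "cmpl (Dv t t') d r = bin RDiv r (cmpl t d r) (cmpl t' d (Suc r))"
| "cmpl (Lt t t') d r = Seq (cmpl t d r) (Seq (cmpl t' d (Suc r))
     (If (RLess (yr r) (yr (Suc r))) (RSet ''y'' (NConst r) (RConst 1))
       (RSet ''y'' (NConst r) (RConst 0))))"
| "cmpl (Sm e t) d r = Seq (RSet ''y'' (NConst r) (RConst 0))
     (for_loop d e (Seq (cmpl t (Suc d) (Suc r)) (RSet ''y'' (NConst r) (RAdd (yr r) (yr (Suc r))))))"

fun pwcost :: "nat \<Rightarrow> nat \<Rightarrow> nat" where
  "pwcost n 0 = 3"
| "pwcost n (Suc e) = pwcost n e + 25 * (n + 1) + 30"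

definition forcost :: "nat \<Rightarrow> nat \<Rightarrow> nat \<Rightarrow> nat" where
  "forcost n e T = pwcost n e + (n + 1) ^ e * (T + 20) + 20"

primrec cost :: "nat \<Rightarrow> tm \<Rightarrow> nat" where
  "cost n (Cn c) = 10"
| "cost n (Vr i) = 10"
| "cost n Nn = 10"
| "cost n (Rd a i) = 10"
| "cost n (Ad t t') = cost n t + cost n t' + 20"
| "cost n (Sb t t') = cost n t + cost n t' + 20"
| "cost n (Ml t t') = cost n t + cost n t' + 20"
| "cost n (Dv t t') = cost n t + cost n t' + 20"
| "cost n (Lt t t') = cost n t + cost n t' + 20"
| "cost n (Sm e t) = forcost n e (cost n t + 20) + 10"

section \<open>Correctness and cost of the compiled code\<close>

definition frame :: "nat \<Rightarrow> nat \<Rightarrow> state \<Rightarrow> state \<Rightarrow> bool" where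
  "frame d r \<sigma> \<tau> \<longleftrightarrow> nats \<tau> ''n'' = nats \<sigma> ''n'' \<and>
     (\<forall>j<d. nats \<tau> ''x'' j = nats \<sigma> ''x'' j \<and> nats \<tau> ''b'' j = nats \<sigma> ''b'' j) \<and>
     (\<forall>a. a \<noteq> ''y'' \<longrightarrow> reals \<tau> a = reals \<sigma> a) \<and> (\<forall>j<r. reals \<tau> ''y'' j = reals \<sigma> ''y'' j)"

lemma frame_refl: "frame d r \<sigma> \<sigma>"
  by (simp add: frame_def)

lemma frame_trans: "frame d r \<sigma> \<rho> \<Longrightarrow> frame d' r' \<rho> \<tau> \<Longrightarrow> d \<le> d' \<Longrightarrow> r \<le> r' \<Longrightarrow> frame d r \<sigma> \<tau>"
  by (auto simp: frame_def)

lemma hoare_pw: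
  assumes [simp]: "nats \<sigma>0 ''n'' 0 = n"
  shows "hoare (\<lambda>\<sigma>. \<sigma> = \<sigma>0) (pw d e) (pwcost n e)
     (\<lambda>\<tau>. nats \<tau> ''b'' d = (n + 1) ^ e \<and> reals \<tau> = reals \<sigma>0 \<and> (\<forall>j. j \<noteq> d \<longrightarrow> nats \<tau> ''b'' j = nats \<sigma>0 ''b'' j) \<and>
        (\<forall>v. v \<noteq> ''b'' \<longrightarrow> v \<noteq> ''p'' \<longrightarrow> nats \<tau> v = nats \<sigma>0 v))"
proof (induction e)
  case 0
  show ?case by (simp, rule hoare_nset) auto
next
  case (Suc e)
  define J where "J m i \<tau> \<longleftrightarrow> (reals \<tau> = reals \<sigma>0 \<and> (\<forall>j. j \<noteq> d \<longrightarrow> nats \<tau> ''b'' j = nats \<sigma>0 ''b'' j) \<and>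
        (\<forall>v. v \<noteq> ''b'' \<longrightarrow> v \<noteq> ''p'' \<longrightarrow> nats \<tau> v = nats \<sigma>0 v)) \<and>
     nats \<tau> ''p'' 0 = (n + 1) ^ e \<and> nats \<tau> ''p'' 1 = i \<and> nats \<tau> ''b'' d = m" for m i and \<tau> :: state
  \<comment> \<open>The initial value 0 is written as a product so that it unifies with the
    invariant \<open>J (i * (n + 1) ^ e) i\<close> at \<open>i = 0\<close>.\<close>
  have loop: "hoare (J (0 * (n + 1) ^ e) 0) (While (NLess (NGet ''p'' (NConst 1)) (NAdd (NGet ''n'' (NConst 0)) (NConst 1)))
         (Seq (NSet ''b'' (NConst d) (NAdd (NGet ''b'' (NConst d)) (NGet ''p'' (NConst 0))))
           (NSet ''p'' (NConst 1) (NAdd (NGet ''p'' (NConst 1)) (NConst 1)))))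
     ((n + 1) * 23 + 8) (J ((n + 1) * (n + 1) ^ e) (n + 1))"
  proof (rule hoare_count[where T = 15])
    fix i
    show "hoare (J (i * (n + 1) ^ e) i) (Seq (NSet ''b'' (NConst d) (NAdd (NGet ''b'' (NConst d)) (NGet ''p'' (NConst 0))))
           (NSet ''p'' (NConst 1) (NAdd (NGet ''p'' (NConst 1)) (NConst 1)))) 15 (J (Suc i * (n + 1) ^ e) (Suc i))"
      by (rule hoare_seq[where R = "J (Suc i * (n + 1) ^ e) i" and T = 7 and T' = 7]; (rule hoare_nset)?)
        (simp_all add: J_def)
  qed (simp_all add: J_def)
  show ?case unfolding pw.simps pwcost.simps
  proof (rule hoare_seq[OF Suc.IH, where T' = "25 * (n + 1) + 29"])
    let ?P = "\<lambda>\<tau>. nats \<tau> ''b'' d = (n + 1) ^ e \<and> reals \<tau> = reals \<sigma>0 \<and> (\<forall>j. j \<noteq> d \<longrightarrow> nats \<tau> ''b'' j = nats \<sigma>0 ''b'' j) \<and>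
        (\<forall>v. v \<noteq> ''b'' \<longrightarrow> v \<noteq> ''p'' \<longrightarrow> nats \<tau> v = nats \<sigma>0 v)"
    \<comment> \<open>The counter still holds a stale value here, hence the index read off the
      state.\<close>
    have 1: "hoare ?P (NSet ''p'' (NConst 0) (NGet ''b'' (NConst d))) 4
       (\<lambda>\<tau>. J ((n + 1) ^ e) (nats \<tau> ''p'' 1) \<tau>)"
      by (rule hoare_nset) (simp_all add: J_def)
    have 2: "hoare (\<lambda>\<tau>. J ((n + 1) ^ e) (nats \<tau> ''p'' 1) \<tau>) (NSet ''p'' (NConst 1) (NConst 0)) 3
       (J ((n + 1) ^ e) 0)"
      by (rule hoare_nset) (simp_all add: J_def)
    have 3: "hoare (J ((n + 1) ^ e) 0) (NSet ''b'' (NConst d) (NConst 0)) 3 (J (0 * (n + 1) ^ e) 0)"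
      by (rule hoare_nset) (simp_all add: J_def)
    show "hoare ?P (Seq (NSet ''p'' (NConst 0) (NGet ''b'' (NConst d)))
     (Seq (NSet ''p'' (NConst 1) (NConst 0)) (Seq (NSet ''b'' (NConst d) (NConst 0))
       (While (NLess (NGet ''p'' (NConst 1)) (NAdd (NGet ''n'' (NConst 0)) (NConst 1)))
         (Seq (NSet ''b'' (NConst d) (NAdd (NGet ''b'' (NConst d)) (NGet ''p'' (NConst 0))))
           (NSet ''p'' (NConst 1) (NAdd (NGet ''p'' (NConst 1)) (NConst 1)))))))) (25 * (n + 1) + 29)
     (\<lambda>\<tau>. nats \<tau> ''b'' d = (n + 1) ^ Suc e \<and> reals \<tau> = reals \<sigma>0 \<and> (\<forall>j. j \<noteq> d \<longrightarrow> nats \<tau> ''b'' j = nats \<sigma>0 ''b'' j) \<and>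
        (\<forall>v. v \<noteq> ''b'' \<longrightarrow> v \<noteq> ''p'' \<longrightarrow> nats \<tau> v = nats \<sigma>0 v))"
      by (rule hoare_conseq[OF hoare_seq[OF 1 hoare_seq[OF 2 hoare_seq[OF 3 loop order_refl] order_refl] order_refl]])
        (simp_all add: J_def)
  qed simp
qed

text \<open>The body proves \<open>J (Suc i)\<close> for the state after the increment, because
  \<open>for_loop\<close> itself advances the counter; \<open>start\<close> receives the state in
  which the bound is computed and the counter cleared.\<close>

lemma hoare_for:
  assumes step: "\<And>i. i < (n + 1) ^ e \<Longrightarrow>
      hoare (\<lambda>\<sigma>. J i \<sigma> \<and> nats \<sigma> ''x'' d = i) c T
        (\<lambda>\<tau>. J (Suc i) (nset ''x'' d (Suc i) \<tau>) \<and> nats \<tau> ''x'' d = i \<and> nats \<tau> ''b'' d = (n + 1) ^ e)"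
    and start: "\<And>\<sigma> \<tau>. P \<sigma> \<Longrightarrow> frame d r \<sigma> \<tau> \<Longrightarrow> reals \<tau> = reals \<sigma> \<Longrightarrow> nats \<tau> ''x'' d = 0 \<Longrightarrow>
       nats \<tau> ''b'' d = (n + 1) ^ e \<Longrightarrow> J 0 \<tau>"
    and P: "\<And>\<sigma>. P \<sigma> \<Longrightarrow> nats \<sigma> ''n'' 0 = n"
    and b: "\<And>i \<sigma>. J i \<sigma> \<Longrightarrow> nats \<sigma> ''b'' d = (n + 1) ^ e"
  shows "hoare P (for_loop d e c) (forcost n e T) (J ((n + 1) ^ e))"
proof -
  let ?J = "\<lambda>i \<sigma>. J i \<sigma> \<and> nats \<sigma> ''x'' d = i"
  have loop: "hoare (?J 0) (While (NLess (NGet ''x'' (NConst d)) (NGet ''b'' (NConst d)))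
       (Seq c (NSet ''x'' (NConst d) (NAdd (NGet ''x'' (NConst d)) (NConst 1)))))
     ((n + 1) ^ e * (T + 20) + 10) (?J ((n + 1) ^ e))"
    apply (rule hoare_count[where T = "T + 8"])
      apply (rule hoare_seq[OF step, where T' = 7])
        apply assumption
       apply (rule hoare_nset)
        apply auto
    using b by (auto simp: distrib_left intro!: add_mono mult_le_mono)
  show ?thesis
    unfolding hoare_def
  proof (intro allI impI)
    fix \<sigma> assume \<sigma>: "P \<sigma>"
    have "hoare (\<lambda>\<rho>. \<rho> = \<sigma>) (for_loop d e c) (forcost n e T) (J ((n + 1) ^ e))"
      unfolding for_loop_def forcost_def
      apply (rule hoare_seq[OF hoare_pw[OF P[OF \<sigma>]], where T' = "(n + 1) ^ e * (T + 20) + 15"])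
       apply (rule hoare_seq[where T = 3 and R = "?J 0"])
         apply (rule hoare_nset)
          apply (rule conjI)
           apply (rule start[OF \<sigma>])
              apply (auto simp: frame_def)[4]
          apply (auto)[2]
        apply (rule hoare_conseq[OF loop])
          apply auto
      done
    then show "\<exists>\<tau>. run (for_loop d e c) \<sigma> (forcost n e T) \<tau> \<and> J ((n + 1) ^ e) \<tau>"
      unfolding hoare_def by blast
  qed
qed

text \<open>\<open>A\<close> is the memory that terms can see. \<open>''y''\<close> is exempt
  because the code overwrites it, which is why \<open>ev\<close> gives reads of it the value
  0.\<close>

definition ctx :: "nat \<Rightarrow> nat \<Rightarrow> (vname \<Rightarrow> nat \<Rightarrow> real) \<Rightarrow> (nat \<Rightarrow> nat) \<Rightarrow> state \<Rightarrow> bool" where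
  "ctx d n A \<rho> \<sigma> \<longleftrightarrow> nats \<sigma> ''n'' 0 = n \<and> (\<forall>a. a \<noteq> ''y'' \<longrightarrow> reals \<sigma> a = A a) \<and>
     (\<forall>j<d. nats \<sigma> ''x'' j = \<rho> (d - 1 - j)) \<and> (\<forall>j\<ge>d. \<rho> j = 0)"

lemma ctx_frame: "ctx d n A \<rho> \<sigma> \<Longrightarrow> frame d r \<sigma> \<tau> \<Longrightarrow> ctx d n A \<rho> \<tau>"
  by (auto simp: ctx_def frame_def)

lemma ctx_Suc:
  assumes "ctx d n A \<rho> \<sigma>" "nats \<sigma> ''x'' d = i"
  shows "ctx (Suc d) n A (case_nat i \<rho>) \<sigma>"
  unfolding ctx_def
proof (intro conjI allI impI)
  fix j assume "j < Suc d"
  then show "nats \<sigma> ''x'' j = case_nat i \<rho> (Suc d - 1 - j)"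
    using assms by (cases "j = d") (auto simp: ctx_def Suc_diff_Suc[symmetric])
qed (use assms in \<open>auto simp: ctx_def split: nat.split\<close>)

lemma nval_var: "ctx d n A \<rho> \<sigma> \<Longrightarrow> nval (var d i) \<sigma> = \<rho> i"
  by (auto simp: ctx_def var_def)

lemma ncost_var: "ncost (var d i) \<le> 2"
  by (simp add: var_def)

definition computes :: "nat \<Rightarrow> com \<Rightarrow> nat \<Rightarrow> nat \<Rightarrow> tm \<Rightarrow> nat \<Rightarrow> bool" where
  "computes n c d r t T \<longleftrightarrow> (\<forall>A \<rho> \<sigma>0. hoare (\<lambda>\<sigma>. frame d r \<sigma>0 \<sigma> \<and> ctx d n A \<rho> \<sigma>) c T
     (\<lambda>\<tau>. frame d r \<sigma>0 \<tau> \<and> ctx d n A \<rho> \<tau> \<and> reals \<tau> ''y'' r = ev t \<rho> A n))"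

lemma frame_rset: "frame d r \<sigma>0 \<sigma> \<Longrightarrow> r \<le> j \<Longrightarrow> frame d r \<sigma>0 (rset ''y'' j v \<sigma>)"
  by (auto simp: frame_def)

lemma ctx_rset: "ctx d n A \<rho> \<sigma> \<Longrightarrow> ctx d n A \<rho> (rset ''y'' j v \<sigma>)"
  by (auto simp: ctx_def)

lemma hoare_two:
  assumes "computes n c d r t T" "computes n c' d (Suc r) t' T'"
  assumes "hoare (\<lambda>\<tau>. frame d r \<sigma>0 \<tau> \<and> ctx d n A \<rho> \<tau> \<and> reals \<tau> ''y'' r = ev t \<rho> A n \<and>
      reals \<tau> ''y'' (Suc r) = ev t' \<rho> A n) c'' T'' Q" "T + T' + T'' + 2 \<le> U"
  shows "hoare (\<lambda>\<sigma>. frame d r \<sigma>0 \<sigma> \<and> ctx d n A \<rho> \<sigma>) (Seq c (Seq c' c'')) U Q"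
proof (rule hoare_seq)
  show "hoare (\<lambda>\<sigma>. frame d r \<sigma>0 \<sigma> \<and> ctx d n A \<rho> \<sigma>) c T
     (\<lambda>\<tau>. frame d r \<sigma>0 \<tau> \<and> ctx d n A \<rho> \<tau> \<and> reals \<tau> ''y'' r = ev t \<rho> A n)"
    using assms(1) by (simp add: computes_def)
  have "hoare (\<lambda>\<tau>. frame d r \<sigma>0 \<tau> \<and> ctx d n A \<rho> \<tau> \<and> reals \<tau> ''y'' r = ev t \<rho> A n) c' T'
    (\<lambda>\<tau>. frame d r \<sigma>0 \<tau> \<and> ctx d n A \<rho> \<tau> \<and> reals \<tau> ''y'' r = ev t \<rho> A n \<and>
      reals \<tau> ''y'' (Suc r) = ev t' \<rho> A n)"
    unfolding hoare_def
  proof (intro allI impI)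
    fix \<sigma> assume \<sigma>: "frame d r \<sigma>0 \<sigma> \<and> ctx d n A \<rho> \<sigma> \<and> reals \<sigma> ''y'' r = ev t \<rho> A n"
    then obtain \<tau> where "run c' \<sigma> T' \<tau>" and \<tau>: "frame d (Suc r) \<sigma> \<tau>" "ctx d n A \<rho> \<tau>"
      "reals \<tau> ''y'' (Suc r) = ev t' \<rho> A n"
      using assms(2) frame_refl[of d "Suc r" \<sigma>] unfolding computes_def hoare_def by meson
    moreover have "frame d r \<sigma>0 \<tau>" using \<sigma> \<tau> by (auto intro: frame_trans)
    moreover have "reals \<tau> ''y'' r = ev t \<rho> A n" using \<sigma> \<tau> by (auto simp: frame_def)
    ultimately show "\<exists>\<tau>. run c' \<sigma> T' \<tau> \<and> frame d r \<sigma>0 \<tau> \<and> ctx d n A \<rho> \<tau> \<and>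
        reals \<tau> ''y'' r = ev t \<rho> A n \<and> reals \<tau> ''y'' (Suc r) = ev t' \<rho> A n"
      by blast
  qed
  then show "hoare (\<lambda>\<tau>. frame d r \<sigma>0 \<tau> \<and> ctx d n A \<rho> \<tau> \<and> reals \<tau> ''y'' r = ev t \<rho> A n) (Seq c' c'')
     (1 + T' + T'') Q"
    by (rule hoare_seq[OF _ assms(3)]) simp
qed (use assms(4) in simp)

lemma computes_bin:
  assumes "computes n c d r t T" "computes n c' d (Suc r) t' T'"
    and "\<And>\<sigma>. rval (f (yr r) (yr (Suc r))) \<sigma> = g (reals \<sigma> ''y'' r) (reals \<sigma> ''y'' (Suc r))"
    and "rcost (f (yr r) (yr (Suc r))) \<le> 5"
    and "\<And>\<rho> A. ev u \<rho> A n = g (ev t \<rho> A n) (ev t' \<rho> A n)"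
  shows "computes n (bin f r c c') d r u (T + T' + 20)"
  unfolding computes_def bin_def
  apply (intro allI, rule hoare_two[OF assms(1,2), where T'' = 10])
   apply (rule hoare_rset)
  using assms(3-5) by (auto simp: frame_rset ctx_rset)

lemma computes_cmpl: "computes n (cmpl t d r) d r t (cost n t)"
proof (induction t arbitrary: d r)
  case (Cn c)
  show ?case unfolding computes_def by (auto intro!: hoare_rset simp: frame_rset ctx_rset)
next
  case (Vr i)
  show ?case unfolding computes_def cmpl.simps
    by (intro allI hoare_rset) (use ncost_var[of d i] in \<open>auto simp: frame_rset ctx_rset nval_var\<close>)
next
  case Nn
  show ?case unfolding computes_def
    by (auto intro!: hoare_rset simp: frame_rset ctx_rset) (auto simp: ctx_def)
next
  case (Rd a i)
  show ?case unfolding computes_def cmpl.simps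
    using ncost_var[of d i]
    by (intro allI hoare_rset) (auto simp: frame_rset ctx_rset nval_var, auto simp: ctx_def)
next
  case (Lt t t')
  show ?case unfolding computes_def cmpl.simps
    apply (intro allI, rule hoare_two[OF Lt.IH, where T'' = 15])
     apply (rule hoare_if[where T = 3])
       apply (auto intro!: hoare_rset simp: frame_rset ctx_rset)
    done
next
  case (Sm e t)
  show ?case unfolding computes_def cmpl.simps cost.simps
  proof (intro allI)
    fix A \<rho> \<sigma>0
    let ?P = "\<lambda>\<tau>. frame d r \<sigma>0 \<tau> \<and> ctx d n A \<rho> \<tau> \<and> reals \<tau> ''y'' r = 0"
    have A: "hoare (\<lambda>\<sigma>. frame d r \<sigma>0 \<sigma> \<and> ctx d n A \<rho> \<sigma>) (RSet ''y'' (NConst r) (RConst 0)) 3 ?P"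
      by (auto intro!: hoare_rset simp: frame_rset ctx_rset)
    let ?J = "\<lambda>i \<sigma>. frame d r \<sigma>0 \<sigma> \<and> ctx d n A \<rho> \<sigma> \<and> nats \<sigma> ''b'' d = (n + 1) ^ e \<and>
       reals \<sigma> ''y'' r = (\<Sum>j<i. ev t (case_nat j \<rho>) A n)"
    have "hoare ?P
       (for_loop d e (Seq (cmpl t (Suc d) (Suc r)) (RSet ''y'' (NConst r) (RAdd (yr r) (yr (Suc r))))))
       (forcost n e (cost n t + 20)) (?J ((n + 1) ^ e))"
    proof (rule hoare_for[where r = r and J = ?J])
      fix i assume "i < (n + 1) ^ e"
      show "hoare (\<lambda>\<sigma>. ?J i \<sigma> \<and> nats \<sigma> ''x'' d = i)
         (Seq (cmpl t (Suc d) (Suc r)) (RSet ''y'' (NConst r) (RAdd (yr r) (yr (Suc r))))) (cost n t + 20)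
         (\<lambda>\<tau>. ?J (Suc i) (nset ''x'' d (Suc i) \<tau>) \<and> nats \<tau> ''x'' d = i \<and> nats \<tau> ''b'' d = (n + 1) ^ e)"
      proof (rule hoare_seq[where T' = 15])
        show "hoare (\<lambda>\<sigma>. ?J i \<sigma> \<and> nats \<sigma> ''x'' d = i) (cmpl t (Suc d) (Suc r)) (cost n t)
          (\<lambda>\<sigma>. ?J i \<sigma> \<and> nats \<sigma> ''x'' d = i \<and> reals \<sigma> ''y'' (Suc r) = ev t (case_nat i \<rho>) A n)"
          unfolding hoare_def
        proof (intro allI impI)
          fix \<sigma> assume \<sigma>: "?J i \<sigma> \<and> nats \<sigma> ''x'' d = i"
          then have "ctx (Suc d) n A (case_nat i \<rho>) \<sigma>" by (auto intro: ctx_Suc)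
          then obtain \<tau> where \<tau>: "run (cmpl t (Suc d) (Suc r)) \<sigma> (cost n t) \<tau>"
            "frame (Suc d) (Suc r) \<sigma> \<tau>" "reals \<tau> ''y'' (Suc r) = ev t (case_nat i \<rho>) A n"
            using Sm.IH[of "Suc d" "Suc r"] frame_refl unfolding computes_def hoare_def by meson
          have f: "frame d r \<sigma> \<tau>" using \<tau>(2) by (rule frame_trans[OF frame_refl]) auto
          with \<sigma> have "frame d r \<sigma>0 \<tau>" "ctx d n A \<rho> \<tau>" by (auto intro: frame_trans ctx_frame)
          with \<sigma> \<tau> show "\<exists>\<tau>. run (cmpl t (Suc d) (Suc r)) \<sigma> (cost n t) \<tau> \<and> (?J i \<tau> \<and>
             nats \<tau> ''x'' d = i \<and> reals \<tau> ''y'' (Suc r) = ev t (case_nat i \<rho>) A n)"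
            by (intro exI[of _ \<tau>]) (auto simp: frame_def)
        qed
      qed (auto intro!: hoare_rset simp: frame_def ctx_def)
    next
      fix \<sigma> \<tau> assume a: "?P \<sigma>" "frame d r \<sigma> \<tau>" "reals \<tau> = reals \<sigma>" "nats \<tau> ''b'' d = (n + 1) ^ e"
      then show "?J 0 \<tau>"
        using frame_trans[of d r \<sigma>0 \<sigma> d r \<tau>] ctx_frame[of d n A \<rho> \<sigma> r \<tau>] by auto
    qed (auto simp: ctx_def)
    then have B: "hoare ?P
       (for_loop d e (Seq (cmpl t (Suc d) (Suc r)) (RSet ''y'' (NConst r) (RAdd (yr r) (yr (Suc r))))))
       (forcost n e (cost n t + 20)) (\<lambda>\<tau>. frame d r \<sigma>0 \<tau> \<and> ctx d n A \<rho> \<tau> \<and> reals \<tau> ''y'' r = ev (Sm e t) \<rho> A n)"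
      by (rule hoare_conseq) auto
    show "hoare (\<lambda>\<sigma>. frame d r \<sigma>0 \<sigma> \<and> ctx d n A \<rho> \<sigma>) (Seq (RSet ''y'' (NConst r) (RConst 0))
       (for_loop d e (Seq (cmpl t (Suc d) (Suc r)) (RSet ''y'' (NConst r) (RAdd (yr r) (yr (Suc r)))))))
       (forcost n e (cost n t + 20) + 10) (\<lambda>\<tau>. frame d r \<sigma>0 \<tau> \<and> ctx d n A \<rho> \<tau> \<and> reals \<tau> ''y'' r = ev (Sm e t) \<rho> A n)"
      by (rule hoare_seq[OF A B]) simp
  qed
next
  case (Ad t t')
  show ?case using computes_bin[OF Ad.IH, where f = RAdd and g = "(+)"] by simp
next
  case (Sb t t')
  show ?case using computes_bin[OF Sb.IH, where f = RSub and g = "(-)"] by simp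
next
  case (Ml t t')
  show ?case using computes_bin[OF Ml.IH, where f = RMul and g = "(*)"] by simp
next
  case (Dv t t')
  show ?case using computes_bin[OF Dv.IH, where f = RDiv and g = "(/)"] by simp
qed


section \<open>Polynomial bounds\<close>

text \<open>Base \<open>n + 1\<close> keeps powers monotone in the exponent even at
  \<open>n = 0\<close>, so that bounds of this form are closed under sums and products.\<close>

definition polyb :: "(nat \<Rightarrow> nat) \<Rightarrow> bool" where
  "polyb f \<longleftrightarrow> (\<exists>c g. \<forall>n. f n \<le> c * (n + 1) ^ g)"

lemma polyb_const: "polyb (\<lambda>n. c)"
  unfolding polyb_def by (intro exI[of _ c] exI[of _ 0]) simp

lemma polyb_power: "polyb (\<lambda>n. (n + 1) ^ e)"
  unfolding polyb_def by (intro exI[of _ 1] exI[of _ e]) simp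

lemma polyb_add:
  assumes "polyb f" "polyb g"
  shows "polyb (\<lambda>n. f n + g n)"
proof -
  from assms obtain c a d b where 1: "\<And>n. f n \<le> c * (n + 1) ^ a" "\<And>n. g n \<le> d * (n + 1) ^ b"
    unfolding polyb_def by blast
  have "f n + g n \<le> (c + d) * (n + 1) ^ (a + b)" for n
  proof -
    have "c * (n + 1) ^ a \<le> c * (n + 1) ^ (a + b)" "d * (n + 1) ^ b \<le> d * (n + 1) ^ (a + b)"
      by (intro mult_left_mono power_increasing; simp)+
    with 1[of n] show ?thesis unfolding distrib_right by linarith
  qed
  then show ?thesis unfolding polyb_def by blast
qed

lemma polyb_mult:
  assumes "polyb f" "polyb g"
  shows "polyb (\<lambda>n. f n * g n)"
proof -
  from assms obtain c a d b where 1: "\<And>n. f n \<le> c * (n + 1) ^ a" "\<And>n. g n \<le> d * (n + 1) ^ b"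
    unfolding polyb_def by blast
  have "f n * g n \<le> (c * d) * (n + 1) ^ (a + b)" for n
    using mult_mono[OF 1[of n]] by (simp add: power_add mult_ac)
  then show ?thesis unfolding polyb_def by blast
qed

lemma polyb_pwcost: "polyb (\<lambda>n. pwcost n e)"
proof (induction e)
  case (Suc e)
  show ?case unfolding pwcost.simps
    by (intro polyb_add Suc polyb_mult polyb_const polyb_power[of 1, simplified power_one_right])
qed (simp add: polyb_const)

lemma polyb_forcost: "polyb T \<Longrightarrow> polyb (\<lambda>n. forcost n e (T n))"
  unfolding forcost_def by (intro polyb_add polyb_mult polyb_const polyb_power polyb_pwcost)

lemma polyb_cost: "polyb (\<lambda>n. cost n t)"
  by (induction t) (simp_all, (intro polyb_add polyb_forcost polyb_const | assumption)+)


section \<open>Definability by terms\<close>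

type_synonym arrays = "vname \<Rightarrow> nat \<Rightarrow> real"

text \<open>One fixed term must compute \<open>f\<close> for all \<open>n\<close> and all inputs
  \<open>u\<close>; this uniformity makes it a program. \<open>f\<close> speaks of the abstract
  input \<open>u\<close>, the term sees only the arrays \<open>A\<close>, and \<open>P\<close>
  records what \<open>A\<close> holds.\<close>

definition cmp ::
  "(nat \<Rightarrow> 'u \<Rightarrow> arrays \<Rightarrow> (nat \<Rightarrow> nat) \<Rightarrow> bool) \<Rightarrow> (nat \<Rightarrow> 'u \<Rightarrow> (nat \<Rightarrow> nat) \<Rightarrow> real) \<Rightarrow> bool" where
  "cmp P f \<longleftrightarrow> (\<exists>t. \<forall>n u A \<rho>. P n u A \<rho> \<longrightarrow> ev t \<rho> A n = f n u \<rho>)"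

definition cmpb ::
  "(nat \<Rightarrow> 'u \<Rightarrow> arrays \<Rightarrow> (nat \<Rightarrow> nat) \<Rightarrow> bool) \<Rightarrow> (nat \<Rightarrow> 'u \<Rightarrow> (nat \<Rightarrow> nat) \<Rightarrow> bool) \<Rightarrow> bool" where
  "cmpb P b \<longleftrightarrow> cmp P (\<lambda>n u \<rho>. if b n u \<rho> then 1 else 0)"

lemma cmp_cong:
  "cmp P g \<Longrightarrow> (\<And>n u A \<rho>. P n u A \<rho> \<Longrightarrow> f n u \<rho> = g n u \<rho>) \<Longrightarrow> cmp P f"
  unfolding cmp_def by metis

lemma cmp_const: "c \<in> \<rat> \<Longrightarrow> cmp P (\<lambda>n u \<rho>. c)"
  unfolding cmp_def by (elim Rats_cases) (metis ev.simps(1))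

lemma cmp_n: "cmp P (\<lambda>n u \<rho>. real n)"
  unfolding cmp_def by (auto intro!: exI[of _ Nn])

lemma cmp_var: "cmp P (\<lambda>n u \<rho>. real (\<rho> i))"
  unfolding cmp_def by (auto intro!: exI[of _ "Vr i"])

lemma cmp_bin:
  assumes "cmp P f" "cmp P g" "\<And>t t'. \<exists>t''. \<forall>\<rho> A n. ev t'' \<rho> A n = h (ev t \<rho> A n) (ev t' \<rho> A n)"
  shows "cmp P (\<lambda>n u \<rho>. h (f n u \<rho>) (g n u \<rho>))"
  using assms unfolding cmp_def by metis

lemma cmp_add: "cmp P f \<Longrightarrow> cmp P g \<Longrightarrow> cmp P (\<lambda>n u \<rho>. f n u \<rho> + g n u \<rho>)"
  by (rule cmp_bin) (auto intro: exI[of _ "Ad _ _"])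

lemma cmp_diff: "cmp P f \<Longrightarrow> cmp P g \<Longrightarrow> cmp P (\<lambda>n u \<rho>. f n u \<rho> - g n u \<rho>)"
  by (rule cmp_bin) (auto intro: exI[of _ "Sb _ _"])

lemma cmp_mult: "cmp P f \<Longrightarrow> cmp P g \<Longrightarrow> cmp P (\<lambda>n u \<rho>. f n u \<rho> * g n u \<rho>)"
  by (rule cmp_bin) (auto intro: exI[of _ "Ml _ _"])

lemma cmp_divide: "cmp P f \<Longrightarrow> cmp P g \<Longrightarrow> cmp P (\<lambda>n u \<rho>. f n u \<rho> / g n u \<rho>)"
  by (rule cmp_bin) (auto intro: exI[of _ "Dv _ _"])

lemma cmpb_less: "cmp P f \<Longrightarrow> cmp P g \<Longrightarrow> cmpb P (\<lambda>n u \<rho>. f n u \<rho> < g n u \<rho>)"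
  unfolding cmpb_def by (rule cmp_bin) (auto intro: exI[of _ "Lt _ _"])

lemma cmp_sum:
  assumes "cmp (\<lambda>n u A \<rho>. \<rho> 0 < (n + 1) ^ e \<and> P n u A (\<lambda>j. \<rho> (Suc j)))
     (\<lambda>n u \<rho>. f n u (\<rho> 0) (\<lambda>j. \<rho> (Suc j)))"
  shows "cmp P (\<lambda>n u \<rho>. \<Sum>i<(n + 1) ^ e. f n u i \<rho>)"
proof -
  from assms obtain t where t: "\<And>n u A \<rho>. \<rho> 0 < (n + 1) ^ e \<Longrightarrow> P n u A (\<lambda>j. \<rho> (Suc j)) \<Longrightarrow>
     ev t \<rho> A n = f n u (\<rho> 0) (\<lambda>j. \<rho> (Suc j))"
    unfolding cmp_def by blast
  have "ev (Sm e t) \<rho> A n = (\<Sum>i<(n + 1) ^ e. f n u i \<rho>)" if "P n u A \<rho>" for n u A \<rho>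
    unfolding ev.simps using that by (intro sum.cong refl, subst t[where u = u]) auto
  then show ?thesis unfolding cmp_def by blast
qed

lemma cmp_fsum: "(\<And>b. b < (m::nat) \<Longrightarrow> cmp P (f b)) \<Longrightarrow> cmp P (\<lambda>n u \<rho>. \<Sum>b<m. f b n u \<rho>)"
proof (induction m)
  case (Suc m)
  then have "cmp P (\<lambda>n u \<rho>. (\<Sum>b<m. f b n u \<rho>) + f m n u \<rho>)" by (intro cmp_add) auto
  then show ?case by simp
qed (simp add: cmp_const)

lemma cmp_fprod: "(\<And>b. b < (m::nat) \<Longrightarrow> cmp P (f b)) \<Longrightarrow> cmp P (\<lambda>n u \<rho>. \<Prod>b<m. f b n u \<rho>)"
proof (induction m)
  case (Suc m)
  then have "cmp P (\<lambda>n u \<rho>. (\<Prod>b<m. f b n u \<rho>) * f m n u \<rho>)" by (intro cmp_mult) auto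
  then show ?case by simp
qed (simp add: cmp_const)

lemma cmp_power: "cmp P f \<Longrightarrow> cmp P (\<lambda>n u \<rho>. f n u \<rho> ^ e)"
proof (induction e)
  case (Suc e)
  then have "cmp P (\<lambda>n u \<rho>. f n u \<rho> * f n u \<rho> ^ e)" by (intro cmp_mult)
  then show ?case by simp
qed (simp add: cmp_const)

text \<open>The term language has no conditional; \<open>tb * tf + (1 - tb) * tg\<close> selects a
  branch. Arithmetic is total, so the discarded branch may take any value, and each branch has to be
  right only where it is selected.\<close>

lemma cmp_if:
  assumes "cmpb P b" "cmp (\<lambda>n u A \<rho>. b n u \<rho> \<and> P n u A \<rho>) f" "cmp (\<lambda>n u A \<rho>. \<not> b n u \<rho> \<and> P n u A \<rho>) g"
  shows "cmp P (\<lambda>n u \<rho>. if b n u \<rho> then f n u \<rho> else g n u \<rho>)"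
proof -
  from assms obtain tb tf tg where
    t: "\<And>n u A \<rho>. P n u A \<rho> \<Longrightarrow> ev tb \<rho> A n = (if b n u \<rho> then 1 else 0)"
      "\<And>n u A \<rho>. b n u \<rho> \<and> P n u A \<rho> \<Longrightarrow> ev tf \<rho> A n = f n u \<rho>"
      "\<And>n u A \<rho>. \<not> b n u \<rho> \<and> P n u A \<rho> \<Longrightarrow> ev tg \<rho> A n = g n u \<rho>"
    unfolding cmp_def cmpb_def by blast
  have "ev (Ad (Ml tb tf) (Ml (Sb (Cn 1) tb) tg)) \<rho> A n = (if b n u \<rho> then f n u \<rho> else g n u \<rho>)"
    if "P n u A \<rho>" for n u A \<rho>
    using that t(1)[of n u A \<rho>] t(2)[of n u \<rho> A] t(3)[of n u \<rho> A] by auto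
  then show ?thesis unfolding cmp_def by blast
qed

lemma cmp_const': "cmp P (\<lambda>n u \<rho>. 0)" "cmp P (\<lambda>n u \<rho>. 1)" "cmp P (\<lambda>n u \<rho>. numeral w)"
    "cmp P (\<lambda>n u \<rho>. real c)"
  by (auto intro: cmp_const)

lemma cmpb_not: "cmpb P b \<Longrightarrow> cmpb P (\<lambda>n u \<rho>. \<not> b n u \<rho>)"
  unfolding cmpb_def
  by (rule cmp_cong[where g = "\<lambda>n u \<rho>. 1 - (if b n u \<rho> then 1 else 0)"]) (auto intro!: cmp_diff[of P "\<lambda>_ _ _. 1"] cmp_const)

text \<open>Being a conditional, the conjunction lets the second conjunct be computed under the
  assumption of the first, as range checks require.\<close>

lemma cmpb_conj:
  assumes "cmpb P b" "cmpb (\<lambda>n u A \<rho>. b n u \<rho> \<and> P n u A \<rho>) c"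
  shows "cmpb P (\<lambda>n u \<rho>. b n u \<rho> \<and> c n u \<rho>)"
  using cmp_if[OF assms(1) assms(2)[unfolded cmpb_def] cmp_const'(1)]
  unfolding cmpb_def by (rule cmp_cong) auto

lemma cmpb_le: "cmp P f \<Longrightarrow> cmp P g \<Longrightarrow> cmpb P (\<lambda>n u \<rho>. f n u \<rho> \<le> g n u \<rho>)"
  using cmpb_not[OF cmpb_less, of P g f] by (simp add: not_less)

lemma cmpb_ball: "(\<And>b. b < (m::nat) \<Longrightarrow> cmpb P (f b)) \<Longrightarrow> cmpb P (\<lambda>n u \<rho>. \<forall>b<m. f b n u \<rho>)"
proof -
  assume *: "\<And>b. b < m \<Longrightarrow> cmpb P (f b)"
  have "cmp P (\<lambda>n u \<rho>. \<Prod>b<m. if f b n u \<rho> then 1 else 0)"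
    using * by (intro cmp_fprod) (simp add: cmpb_def)
  then show ?thesis unfolding cmpb_def
    by (rule cmp_cong) auto
qed

lemma cmp_real_add: "cmp P (\<lambda>n u \<rho>. real (f n u \<rho>)) \<Longrightarrow> cmp P (\<lambda>n u \<rho>. real (g n u \<rho>)) \<Longrightarrow>
    cmp P (\<lambda>n u \<rho>. real (f n u \<rho> + g n u \<rho>))"
  using cmp_add by fastforce

lemma cmp_real_mult: "cmp P (\<lambda>n u \<rho>. real (f n u \<rho>)) \<Longrightarrow> cmp P (\<lambda>n u \<rho>. real (g n u \<rho>)) \<Longrightarrow>
    cmp P (\<lambda>n u \<rho>. real (f n u \<rho> * g n u \<rho>))"
  using cmp_mult by fastforce

lemma cmp_real_Suc: "cmp P (\<lambda>n u \<rho>. real (f n u \<rho>)) \<Longrightarrow> cmp P (\<lambda>n u \<rho>. real (Suc (f n u \<rho>)))"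
  using cmp_real_add[OF _ cmp_const'(4)[of P 1]] by fastforce

lemma cmp_real_power: "cmp P (\<lambda>n u \<rho>. real (f n u \<rho>)) \<Longrightarrow> cmp P (\<lambda>n u \<rho>. real (f n u \<rho> ^ e))"
  using cmp_power[of P "\<lambda>n u \<rho>. real (f n u \<rho>)" e] by simp

lemma cmp_real_fsum: "(\<And>b. b < (m::nat) \<Longrightarrow> cmp P (\<lambda>n u \<rho>. real (f b n u \<rho>))) \<Longrightarrow>
    cmp P (\<lambda>n u \<rho>. real (\<Sum>b<m. f b n u \<rho>))"
  using cmp_fsum[of m P "\<lambda>b n u \<rho>. real (f b n u \<rho>)"] by simp

lemma cmp_real_fprod: "(\<And>b. b < (m::nat) \<Longrightarrow> cmp P (\<lambda>n u \<rho>. real (f b n u \<rho>))) \<Longrightarrow>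
    cmp P (\<lambda>n u \<rho>. real (\<Prod>b<m. f b n u \<rho>))"
  using cmp_fprod[of m P "\<lambda>b n u \<rho>. real (f b n u \<rho>)"] by simp

lemma cmpb_nat_less: "cmp P (\<lambda>n u \<rho>. real (f n u \<rho>)) \<Longrightarrow> cmp P (\<lambda>n u \<rho>. real (g n u \<rho>)) \<Longrightarrow>
    cmpb P (\<lambda>n u \<rho>. f n u \<rho> < g n u \<rho>)"
  using cmpb_less[of P "\<lambda>n u \<rho>. real (f n u \<rho>)" "\<lambda>n u \<rho>. real (g n u \<rho>)"] by simp

lemma cmpb_nat_le: "cmp P (\<lambda>n u \<rho>. real (f n u \<rho>)) \<Longrightarrow> cmp P (\<lambda>n u \<rho>. real (g n u \<rho>)) \<Longrightarrow>
    cmpb P (\<lambda>n u \<rho>. f n u \<rho> \<le> g n u \<rho>)"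
  using cmpb_le[of P "\<lambda>n u \<rho>. real (f n u \<rho>)" "\<lambda>n u \<rho>. real (g n u \<rho>)"] by simp

lemma cmpb_nat_eq:
  assumes "cmp P (\<lambda>n u \<rho>. real (f n u \<rho>))" "cmp P (\<lambda>n u \<rho>. real (g n u \<rho>))"
  shows "cmpb P (\<lambda>n u \<rho>. f n u \<rho> = (g n u \<rho> :: nat))"
proof -
  have "cmp P (\<lambda>n u \<rho>. (if f n u \<rho> \<le> g n u \<rho> then 1 else 0) * (if g n u \<rho> \<le> f n u \<rho> then 1 else 0))"
    using cmpb_nat_le[OF assms] cmpb_nat_le[OF assms(2,1)] by (intro cmp_mult) (auto simp: cmpb_def)
  then show ?thesis unfolding cmpb_def by (rule cmp_cong) auto
qed

section \<open>Weakening of terms and array access\<close>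

primrec shift :: "nat \<Rightarrow> tm \<Rightarrow> tm" where
  "shift k (Cn c) = Cn c"
| "shift k (Vr i) = Vr (if i < k then i else Suc i)"
| "shift k Nn = Nn"
| "shift k (Rd a i) = Rd a (if i < k then i else Suc i)"
| "shift k (Ad t t') = Ad (shift k t) (shift k t')"
| "shift k (Sb t t') = Sb (shift k t) (shift k t')"
| "shift k (Ml t t') = Ml (shift k t) (shift k t')"
| "shift k (Dv t t') = Dv (shift k t) (shift k t')"
| "shift k (Lt t t') = Lt (shift k t) (shift k t')"
| "shift k (Sm e t) = Sm e (shift (Suc k) t)"

lemma ev_shift: "ev (shift k t) \<rho> A n = ev t (\<lambda>j. if j < k then \<rho> j else \<rho> (Suc j)) A n"
proof (induction t arbitrary: k \<rho>)
  case (Sm e t)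
  have *: "(\<lambda>j. if j < Suc k then case_nat i \<rho> j else case_nat i \<rho> (Suc j)) =
      case_nat i (\<lambda>j. if j < k then \<rho> j else \<rho> (Suc j))" for i
    by (auto simp: fun_eq_iff split: nat.split)
  show ?case by (simp only: shift.simps ev.simps Sm.IH *)
qed auto

text \<open>An array is read by searching for the counter that equals the address.\<close>

lemma cmp_read:
  assumes f: "cmp P (\<lambda>n u \<rho>. real (f n u \<rho>))" and a: "a \<noteq> ''y''"
    and g: "\<And>n u A \<rho>. P n u A \<rho> \<Longrightarrow> f n u \<rho> < (n + 1) ^ e \<and> A a (f n u \<rho>) = g n u \<rho>"
  shows "cmp P g"
proof -
  from f obtain t where t: "\<And>n u A \<rho>. P n u A \<rho> \<Longrightarrow> ev t \<rho> A n = real (f n u \<rho>)"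
    unfolding cmp_def by blast
  let ?t = "shift 0 t"
  have "ev (Sm e (Ml (Ml (Sb (Cn 1) (Lt (Vr 0) ?t)) (Sb (Cn 1) (Lt ?t (Vr 0)))) (Rd a 0))) \<rho> A n = g n u \<rho>"
    if "P n u A \<rho>" for n u A \<rho>
  proof -
    have "ev (Sm e (Ml (Ml (Sb (Cn 1) (Lt (Vr 0) ?t)) (Sb (Cn 1) (Lt ?t (Vr 0)))) (Rd a 0))) \<rho> A n =
       (\<Sum>i<(n + 1) ^ e. if i = f n u \<rho> then A a i else 0)"
      unfolding ev.simps using a t[OF that] by (intro sum.cong refl) (auto simp: ev_shift)
    also have "\<dots> = g n u \<rho>" using g[OF that] by (subst sum.delta) auto
    finally show ?thesis .
  qed
  then show ?thesis unfolding cmp_def by blast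
qed

section \<open>Programs that fill tables\<close>

definition table :: "vname \<Rightarrow> nat \<Rightarrow> tm \<Rightarrow> com" where
  "table a e t = for_loop 0 e (Seq (cmpl t 1 0) (RSet a (NGet ''x'' (NConst 0)) (yr 0)))"

text \<open>Entry \<open>v\<close> may be computed from the entries below \<open>v\<close> of the
  same array; this turns dynamic programming into one term evaluated for increasing
  \<open>v\<close>.\<close>

lemma hoare_table:
  assumes a: "a \<noteq> ''y''"
    and G: "\<And>v A. v < (n + 1) ^ e \<Longrightarrow> (\<And>b. b \<noteq> a \<Longrightarrow> b \<noteq> ''y'' \<Longrightarrow> A b = R b) \<Longrightarrow>
       (\<And>v'. v' < v \<Longrightarrow> A a v' = G v') \<Longrightarrow> ev t (case_nat v (\<lambda>_. 0)) A n = G v"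
  shows "hoare (\<lambda>\<sigma>. nats \<sigma> ''n'' 0 = n \<and> reals \<sigma> = R) (table a e t) (forcost n e (cost n t + 20))
    (\<lambda>\<tau>. nats \<tau> ''n'' 0 = n \<and> (\<forall>b. b \<noteq> a \<longrightarrow> b \<noteq> ''y'' \<longrightarrow> reals \<tau> b = R b) \<and>
       (\<forall>v<(n + 1) ^ e. reals \<tau> a v = G v))"
proof -
  define J where "J i \<sigma> \<longleftrightarrow> nats \<sigma> ''n'' 0 = n \<and> nats \<sigma> ''b'' 0 = (n + 1) ^ e \<and>
     (\<forall>b. b \<noteq> a \<longrightarrow> b \<noteq> ''y'' \<longrightarrow> reals \<sigma> b = R b) \<and> (\<forall>v<i. reals \<sigma> a v = G v)" for i and \<sigma> :: state
  have "hoare (\<lambda>\<sigma>. nats \<sigma> ''n'' 0 = n \<and> reals \<sigma> = R) (table a e t) (forcost n e (cost n t + 20))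
     (J ((n + 1) ^ e))"
    unfolding table_def
  proof (rule hoare_for[where r = 0])
    fix i assume i: "i < (n + 1) ^ e"
    show "hoare (\<lambda>\<sigma>. J i \<sigma> \<and> nats \<sigma> ''x'' 0 = i)
         (Seq (cmpl t 1 0) (RSet a (NGet ''x'' (NConst 0)) (yr 0))) (cost n t + 20)
         (\<lambda>\<tau>. J (Suc i) (nset ''x'' 0 (Suc i) \<tau>) \<and> nats \<tau> ''x'' 0 = i \<and> nats \<tau> ''b'' 0 = (n + 1) ^ e)"
    proof (rule hoare_seq[where T' = 15 and
        R = "\<lambda>\<sigma>. J i \<sigma> \<and> nats \<sigma> ''x'' 0 = i \<and> reals \<sigma> ''y'' 0 = G i"])
      show "hoare (\<lambda>\<sigma>. J i \<sigma> \<and> nats \<sigma> ''x'' 0 = i) (cmpl t 1 0) (cost n t)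
         (\<lambda>\<sigma>. J i \<sigma> \<and> nats \<sigma> ''x'' 0 = i \<and> reals \<sigma> ''y'' 0 = G i)"
        unfolding hoare_def
      proof (intro allI impI)
        fix \<sigma> assume \<sigma>: "J i \<sigma> \<and> nats \<sigma> ''x'' 0 = i"
        let ?\<rho> = "case_nat i (\<lambda>_. 0)"
        have "ctx 1 n (reals \<sigma>) ?\<rho> \<sigma>"
          using \<sigma> by (auto simp: ctx_def J_def split: nat.split)
        then obtain \<tau> where \<tau>: "run (cmpl t 1 0) \<sigma> (cost n t) \<tau>" "frame 1 0 \<sigma> \<tau>"
          "reals \<tau> ''y'' 0 = ev t ?\<rho> (reals \<sigma>) n"
          using computes_cmpl[of n t 1 0] frame_refl unfolding computes_def hoare_def by meson
        have "ev t ?\<rho> (reals \<sigma>) n = G i"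
          using \<sigma> by (intro G[OF i]) (auto simp: J_def)
        then show "\<exists>\<tau>. run (cmpl t 1 0) \<sigma> (cost n t) \<tau> \<and> J i \<tau> \<and> nats \<tau> ''x'' 0 = i \<and>
            reals \<tau> ''y'' 0 = G i"
          using \<sigma> \<tau> a by (intro exI[of _ \<tau>]) (simp add: frame_def J_def)
      qed
      show "hoare (\<lambda>\<sigma>. J i \<sigma> \<and> nats \<sigma> ''x'' 0 = i \<and> reals \<sigma> ''y'' 0 = G i)
         (RSet a (NGet ''x'' (NConst 0)) (yr 0)) 15
         (\<lambda>\<tau>. J (Suc i) (nset ''x'' 0 (Suc i) \<tau>) \<and> nats \<tau> ''x'' 0 = i \<and> nats \<tau> ''b'' 0 = (n + 1) ^ e)"
        by (rule hoare_rset) (use a in \<open>auto simp: J_def less_Suc_eq\<close>)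
    qed simp
  qed (auto simp: J_def frame_def)
  then show ?thesis by (rule hoare_conseq) (auto simp: J_def)
qed

text \<open>\<open>I\<close> is what some polynomial-time program establishes about the arrays.
  Programs are composed by strengthening \<open>I\<close>, without naming the code.\<close>

definition prog :: "nat \<Rightarrow> (nat \<Rightarrow> payoffs \<Rightarrow> arrays \<Rightarrow> bool) \<Rightarrow> bool" where
  "prog k I \<longleftrightarrow> (\<exists>c T. polyb T \<and> (\<forall>n u. 1 \<le> n \<longrightarrow> anonymous_game n k u \<longrightarrow>
     hoare (\<lambda>\<sigma>. \<sigma> = input_state n k u) c (T n) (\<lambda>\<tau>. nats \<tau> ''n'' 0 = n \<and> I n u (reals \<tau>))))"

lemma prog_init: "prog k (\<lambda>n u A. \<forall>j<length (payoff_list n k u). A ''u'' j = payoff_list n k u ! j)"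
  unfolding prog_def
proof (intro exI[of _ Skip] exI[of _ "\<lambda>_. 1"] conjI allI impI polyb_const)
  fix n u
  show "hoare (\<lambda>\<sigma>. \<sigma> = input_state n k u) Skip 1 (\<lambda>\<tau>. nats \<tau> ''n'' 0 = n \<and>
    (\<forall>j<length (payoff_list n k u). reals \<tau> ''u'' j = payoff_list n k u ! j))"
    unfolding hoare_def run_def using exec.Skip[of "input_state n k u"]
    by (intro allI impI exI[of _ "input_state n k u"]) (auto simp: input_state_def)
qed

text \<open>A three-index table in mixed radix. The side lengths are powers of \<open>n + 1\<close>,
  so that addresses and ranges are definable by terms.\<close>

definition stored ::
  "vname \<Rightarrow> nat \<Rightarrow> nat \<Rightarrow> nat \<Rightarrow> (nat \<Rightarrow> nat \<Rightarrow> nat \<Rightarrow> real) \<Rightarrow> nat \<Rightarrow> arrays \<Rightarrow> bool" where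
  "stored a e1 e2 e3 g n A \<longleftrightarrow> (\<forall>i<(n + 1) ^ e1. \<forall>j<(n + 1) ^ e2. \<forall>l<(n + 1) ^ e3.
     A a ((i * (n + 1) ^ e2 + j) * (n + 1) ^ e3 + l) = g i j l)"

lemma mixed_radix_less: "i < a \<Longrightarrow> j < b \<Longrightarrow> i * b + j < a * (b :: nat)"
proof -
  assume "i < a" "j < b"
  then have "i * b + j < Suc i * b" by simp
  also have "\<dots> \<le> a * b" using \<open>i < a\<close> by (intro mult_le_mono1) simp
  finally show ?thesis .
qed

lemma mixed_radix_eq_iff:
  assumes "j < (b :: nat)"
  shows "v = i * b + j \<longleftrightarrow> i = v div b \<and> j = v mod b"
  using assms by (auto simp: div_mult2_eq)

text \<open>Splits an address into its three indices without integer division: exactly one index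
  triple meets the address, and the sum keeps its entry.\<close>

lemma sum_mixed_radix:
  fixes g :: "nat \<Rightarrow> nat \<Rightarrow> nat \<Rightarrow> real"
  assumes v: "v < a * b * c"
  shows "(\<Sum>i<a. \<Sum>j<b. \<Sum>l<c. if v = (i * b + j) * c + l then g i j l else 0) =
     g (v div c div b) (v div c mod b) (v mod c)"
proof -
  have pos: "c > 0" "b > 0" using v by (cases c; cases b; simp)+
  have lt: "v mod c < c" "v div c mod b < b" "v div c div b < a"
    using pos v by (auto simp: less_mult_imp_div_less)
  have "(\<Sum>l<c. if v = (i * b + j) * c + l then g i j l else 0) =
     (if i * b + j = v div c then g i j (v mod c) else 0)" for i j
  proof -
    have "(\<Sum>l<c. if v = (i * b + j) * c + l then g i j l else 0) =
      (\<Sum>l<c. if l = v mod c then (if i * b + j = v div c then g i j l else 0) else 0)"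
      by (intro sum.cong refl) (subst mixed_radix_eq_iff, auto)
    then show ?thesis using lt by simp
  qed
  moreover have "(\<Sum>j<b. if i * b + j = v div c then g i j (v mod c) else 0) =
     (if i = v div c div b then g i (v div c mod b) (v mod c) else 0)" for i
  proof -
    have "(\<Sum>j<b. if i * b + j = v div c then g i j (v mod c) else 0) =
      (\<Sum>j<b. if j = v div c mod b then (if i = v div c div b then g i j (v mod c) else 0) else 0)"
      using mixed_radix_eq_iff[of _ b "v div c"] by (intro sum.cong refl) (auto simp: eq_commute)
    then show ?thesis using lt by simp
  qed
  ultimately show ?thesis using lt by simp
qed

text \<open>An entry may depend on all entries with a smaller first index. Their addresses are
  smaller, so filling the flat array upwards from address 0 has already stored them.\<close>

lemma prog_table:
  assumes I: "prog k I" and a: "a \<noteq> ''y''"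
    and stable: "\<And>n u A A'. I n u A \<Longrightarrow> (\<And>b. b \<noteq> a \<Longrightarrow> b \<noteq> ''y'' \<Longrightarrow> A' b = A b) \<Longrightarrow> I n u A'"
    and g: "cmp (\<lambda>n u A \<rho>. \<rho> 0 < (n + 1) ^ e3 \<and> \<rho> 1 < (n + 1) ^ e2 \<and> \<rho> 2 < (n + 1) ^ e1 \<and>
       1 \<le> n \<and> anonymous_game n k u \<and> I n u A \<and>
       (\<forall>i<\<rho> 2. \<forall>j<(n + 1) ^ e2. \<forall>l<(n + 1) ^ e3.
         A a ((i * (n + 1) ^ e2 + j) * (n + 1) ^ e3 + l) = g n u i j l))
      (\<lambda>n u \<rho>. g n u (\<rho> 2) (\<rho> 1) (\<rho> 0))"
  shows "prog k (\<lambda>n u A. I n u A \<and> stored a e1 e2 e3 (g n u) n A)"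
proof -
  let ?idx = "\<lambda>n i j l. (i * (n + 1) ^ e2 + j) * (n + 1) ^ e3 + l"
  let ?e = "e1 + e2 + e3"
  define G where "G n u v = g n u (v div (n + 1) ^ e3 div (n + 1) ^ e2)
     (v div (n + 1) ^ e3 mod (n + 1) ^ e2) (v mod (n + 1) ^ e3)" for n u v
  have G_idx: "G n u (?idx n i j l) = g n u i j l"
    if "j < (n + 1) ^ e2" "l < (n + 1) ^ e3" for n u i j l
    using that by (simp add: G_def)
  define P where "P n u A \<rho> \<longleftrightarrow> \<rho> 0 < (n + 1) ^ ?e \<and> 1 \<le> n \<and> anonymous_game n k u \<and> I n u A \<and>
     (\<forall>v<\<rho> 0. A a v = G n u v)" for n u A and \<rho> :: "nat \<Rightarrow> nat"
  have "cmp P (\<lambda>n u \<rho>. \<Sum>i<(n + 1) ^ e1. \<Sum>j<(n + 1) ^ e2. \<Sum>l<(n + 1) ^ e3.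
     if \<rho> 0 = ?idx n i j l then g n u i j l else 0)"
  proof (intro cmp_sum cmp_if cmpb_nat_eq cmp_real_add cmp_real_mult cmp_real_power cmp_real_Suc
      cmp_var cmp_n cmp_const'(1,4))
    let ?Q = "\<lambda>n u A \<rho>. \<rho> 3 = ?idx n (\<rho> 2) (\<rho> 1) (\<rho> 0) \<and> \<rho> 0 < (n + 1) ^ e3 \<and> \<rho> 1 < (n + 1) ^ e2 \<and>
       \<rho> 2 < (n + 1) ^ e1 \<and> P n u A (\<lambda>j. \<rho> (Suc (Suc (Suc j))))"
    obtain t where t: "\<And>n u A \<rho>. \<rho> 0 < (n + 1) ^ e3 \<and> \<rho> 1 < (n + 1) ^ e2 \<and> \<rho> 2 < (n + 1) ^ e1 \<and>
       1 \<le> n \<and> anonymous_game n k u \<and> I n u A \<and>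
       (\<forall>i<\<rho> 2. \<forall>j<(n + 1) ^ e2. \<forall>l<(n + 1) ^ e3. A a (?idx n i j l) = g n u i j l) \<Longrightarrow>
       ev t \<rho> A n = g n u (\<rho> 2) (\<rho> 1) (\<rho> 0)"
      using g unfolding cmp_def by blast
    have "ev t \<rho> A n = g n u (\<rho> 2) (\<rho> 1) (\<rho> 0)" if Q: "?Q n u A \<rho>" for n u A \<rho>
    proof -
      have "A a (?idx n i j l) = g n u i j l"
        if ijl: "i < \<rho> 2" "j < (n + 1) ^ e2" "l < (n + 1) ^ e3" for i j l
      proof -
      have "i * (n + 1) ^ e2 + j < \<rho> 2 * (n + 1) ^ e2 + \<rho> 1"
        using mixed_radix_less[OF ijl(1,2)] by linarith
      from mixed_radix_less[OF this ijl(3)] have "?idx n i j l < ?idx n (\<rho> 2) (\<rho> 1) (\<rho> 0)"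
        by linarith
      then have "A a (?idx n i j l) = G n u (?idx n i j l)"
        using Q by (auto simp: P_def numeral_3_eq_3)
      then show ?thesis using G_idx[OF ijl(2,3)] by simp
      qed
      then show ?thesis using Q by (intro t) (simp add: P_def)
    qed
    then show "cmp (\<lambda>n u A \<rho>. \<rho> (Suc (Suc (Suc 0))) = ?idx n (\<rho> (Suc (Suc 0))) (\<rho> (Suc 0)) (\<rho> 0) \<and>
        \<rho> 0 < (n + 1) ^ e3 \<and> \<rho> (Suc 0) < (n + 1) ^ e2 \<and> \<rho> (Suc (Suc 0)) < (n + 1) ^ e1 \<and>
        P n u A (\<lambda>j. \<rho> (Suc (Suc (Suc j))))) (\<lambda>n u \<rho>. g n u (\<rho> (Suc (Suc 0))) (\<rho> (Suc 0)) (\<rho> 0))"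
      unfolding cmp_def numeral_2_eq_2 numeral_3_eq_3 One_nat_def by (intro exI[of _ t]) blast
  qed
  then have "cmp P (\<lambda>n u \<rho>. G n u (\<rho> 0))"
    by (rule cmp_cong) (subst sum_mixed_radix, auto simp: P_def G_def power_add)
  then obtain t where t: "\<And>n u A \<rho>. P n u A \<rho> \<Longrightarrow> ev t \<rho> A n = G n u (\<rho> 0)"
    unfolding cmp_def by blast
  obtain c T where c: "polyb T" "\<And>n u. 1 \<le> n \<Longrightarrow> anonymous_game n k u \<Longrightarrow>
     hoare (\<lambda>\<sigma>. \<sigma> = input_state n k u) c (T n) (\<lambda>\<tau>. nats \<tau> ''n'' 0 = n \<and> I n u (reals \<tau>))"
    using I unfolding prog_def by blast
  let ?T = "\<lambda>n. 1 + T n + forcost n ?e (cost n t + 20)"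
  have "polyb ?T"
    by (intro polyb_add polyb_const c(1) polyb_forcost polyb_cost)
  moreover have "hoare (\<lambda>\<sigma>. \<sigma> = input_state n k u) (Seq c (table a ?e t)) (?T n)
     (\<lambda>\<tau>. nats \<tau> ''n'' 0 = n \<and> I n u (reals \<tau>) \<and> stored a e1 e2 e3 (g n u) n (reals \<tau>))"
    if n: "1 \<le> n" "anonymous_game n k u" for n u
  proof (rule hoare_seq[OF c(2)[OF n] _ order_refl])
    show "hoare (\<lambda>\<tau>. nats \<tau> ''n'' 0 = n \<and> I n u (reals \<tau>)) (table a ?e t) (forcost n ?e (cost n t + 20))
      (\<lambda>\<tau>. nats \<tau> ''n'' 0 = n \<and> I n u (reals \<tau>) \<and> stored a e1 e2 e3 (g n u) n (reals \<tau>))"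
      unfolding hoare_def
    proof (intro allI impI)
      fix \<sigma> :: state assume \<sigma>: "nats \<sigma> ''n'' 0 = n \<and> I n u (reals \<sigma>)"
      have "hoare (\<lambda>\<rho>. nats \<rho> ''n'' 0 = n \<and> reals \<rho> = reals \<sigma>) (table a ?e t) (forcost n ?e (cost n t + 20))
        (\<lambda>\<tau>. nats \<tau> ''n'' 0 = n \<and> (\<forall>b. b \<noteq> a \<longrightarrow> b \<noteq> ''y'' \<longrightarrow> reals \<tau> b = reals \<sigma> b) \<and>
           (\<forall>v<(n + 1) ^ ?e. reals \<tau> a v = G n u v))"
      proof (rule hoare_table[OF a])
        fix v A assume A: "v < (n + 1) ^ ?e" "\<And>b. b \<noteq> a \<Longrightarrow> b \<noteq> ''y'' \<Longrightarrow> A b = reals \<sigma> b"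
          "\<And>v'. v' < v \<Longrightarrow> A a v' = G n u v'"
        have "I n u A" using \<sigma> A(2) by (auto intro: stable)
        then have "P n u A (case_nat v (\<lambda>_. 0))" using A n by (auto simp: P_def)
        from t[OF this] show "ev t (case_nat v (\<lambda>_. 0)) A n = G n u v" by simp
      qed
      then obtain \<tau> where \<tau>: "run (table a ?e t) \<sigma> (forcost n ?e (cost n t + 20)) \<tau>" "nats \<tau> ''n'' 0 = n"
        "\<And>b. b \<noteq> a \<Longrightarrow> b \<noteq> ''y'' \<Longrightarrow> reals \<tau> b = reals \<sigma> b" "\<And>v. v < (n + 1) ^ ?e \<Longrightarrow> reals \<tau> a v = G n u v"
        using \<sigma> unfolding hoare_def by blast
      have "I n u (reals \<tau>)" using stable[of n u "reals \<sigma>" "reals \<tau>"] \<tau>(3) \<sigma> by blast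
      moreover have "stored a e1 e2 e3 (g n u) n (reals \<tau>)"
        unfolding stored_def
      proof (intro allI impI)
        fix i j l assume ijl: "i < (n + 1) ^ e1" "j < (n + 1) ^ e2" "l < (n + 1) ^ e3"
        have "?idx n i j l < (n + 1) ^ ?e"
          using mixed_radix_less[OF mixed_radix_less[OF ijl(1,2)] ijl(3)] by (simp add: power_add)
        then show "reals \<tau> a (?idx n i j l) = g n u i j l" using \<tau>(4) G_idx ijl by auto
      qed
      ultimately show "\<exists>\<tau>. run (table a ?e t) \<sigma> (forcost n ?e (cost n t + 20)) \<tau> \<and> nats \<tau> ''n'' 0 = n \<and>
          I n u (reals \<tau>) \<and> stored a e1 e2 e3 (g n u) n (reals \<tau>)"
        using \<tau>(1,2) by blast
    qed
  qed
  ultimately show ?thesis unfolding prog_def by blast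
qed

lemma cmp_stored:
  assumes a: "a \<noteq> ''y''"
    and f: "cmp P (\<lambda>n u \<rho>. real (f1 n u \<rho>))" "cmp P (\<lambda>n u \<rho>. real (f2 n u \<rho>))" "cmp P (\<lambda>n u \<rho>. real (f3 n u \<rho>))"
    and s: "\<And>n u A \<rho>. P n u A \<rho> \<Longrightarrow> f1 n u \<rho> < (n + 1) ^ e1 \<and> f2 n u \<rho> < (n + 1) ^ e2 \<and> f3 n u \<rho> < (n + 1) ^ e3 \<and>
       A a ((f1 n u \<rho> * (n + 1) ^ e2 + f2 n u \<rho>) * (n + 1) ^ e3 + f3 n u \<rho>) = g n u (f1 n u \<rho>) (f2 n u \<rho>) (f3 n u \<rho>)"
  shows "cmp P (\<lambda>n u \<rho>. g n u (f1 n u \<rho>) (f2 n u \<rho>) (f3 n u \<rho>))"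
proof (rule cmp_read[OF _ a, where e = "e1 + e2 + e3"])
  show "cmp P (\<lambda>n u \<rho>. real ((f1 n u \<rho> * (n + 1) ^ e2 + f2 n u \<rho>) * (n + 1) ^ e3 + f3 n u \<rho>))"
    by (intro cmp_real_add cmp_real_mult cmp_real_power cmp_n cmp_const'(4) f)
  fix n u A \<rho> assume P: "P n u A \<rho>"
  have "(f1 n u \<rho> * (n + 1) ^ e2 + f2 n u \<rho>) * (n + 1) ^ e3 + f3 n u \<rho> < (n + 1) ^ (e1 + e2 + e3)"
    using mixed_radix_less[OF mixed_radix_less[of "f1 n u \<rho>" "(n + 1) ^ e1" "f2 n u \<rho>" "(n + 1) ^ e2"],
        of "f3 n u \<rho>" "(n + 1) ^ e3"] s[OF P] by (simp add: power_add)
  with s[OF P] show "(f1 n u \<rho> * (n + 1) ^ e2 + f2 n u \<rho>) * (n + 1) ^ e3 + f3 n u \<rho> < (n + 1) ^ (e1 + e2 + e3) \<and>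
     A a ((f1 n u \<rho> * (n + 1) ^ e2 + f2 n u \<rho>) * (n + 1) ^ e3 + f3 n u \<rho>) = g n u (f1 n u \<rho>) (f2 n u \<rho>) (f3 n u \<rho>)"
    by blast
qed

lemma prog_poly:
  assumes "prog k I"
  shows "\<exists>c (p :: nat poly). \<forall>n u. 1 \<le> n \<longrightarrow> anonymous_game n k u \<longrightarrow>
     (\<exists>t \<tau>. exec c (input_state n k u) t \<tau> \<and> t \<le> poly p n \<and> I n u (reals \<tau>))"
proof -
  from assms obtain c T where c: "polyb T" "\<And>n u. 1 \<le> n \<Longrightarrow> anonymous_game n k u \<Longrightarrow>
     hoare (\<lambda>\<sigma>. \<sigma> = input_state n k u) c (T n) (\<lambda>\<tau>. nats \<tau> ''n'' 0 = n \<and> I n u (reals \<tau>))"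
    unfolding prog_def by blast
  from c(1) obtain a g where T: "\<And>n. T n \<le> a * (n + 1) ^ g" unfolding polyb_def by blast
  define p :: "nat poly" where "p = smult a ([:1, 1:] ^ g)"
  have "poly p n = a * (n + 1) ^ g" for n by (simp add: p_def poly_power)
  with c(2) T show ?thesis unfolding hoare_def run_def by (metis order_trans)
qed

section \<open>The law of a sum of independent choices\<close>

text \<open>The probability that the codes \<open>e b\<close> of independent choices add up to
  \<open>y\<close>. Coding a partition by one number makes the random partition a sum of independent
  integers, so that a one-dimensional Fourier transform applies.\<close>

fun law :: "nat \<Rightarrow> (nat \<Rightarrow> nat) \<Rightarrow> (nat \<Rightarrow> real) list \<Rightarrow> nat \<Rightarrow> real" where
  "law k e [] y = (if y = 0 then 1 else 0)"
| "law k e (s # ss) y = (\<Sum>b<k. if e b \<le> y then s b * law k e ss (y - e b) else 0)"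

definition stoch :: "nat \<Rightarrow> (nat \<Rightarrow> real) \<Rightarrow> bool" where
  "stoch k s \<longleftrightarrow> (\<forall>b<k. 0 \<le> s b) \<and> (\<Sum>b<k. s b) = 1"

lemma law_nonneg: "(\<And>s b. s \<in> set ss \<Longrightarrow> b < k \<Longrightarrow> 0 \<le> s b) \<Longrightarrow> 0 \<le> law k e ss y"
proof (induction ss arbitrary: y)
  case (Cons s ss)
  then show ?case by (auto intro!: sum_nonneg)
qed simp

lemma law_support:
  assumes "\<And>b. b < k \<Longrightarrow> e b \<le> E" "law k e ss y \<noteq> 0"
  shows "y \<le> length ss * E"
  using assms(2)
proof (induction ss arbitrary: y)
  case (Cons s ss)
  then obtain b where b: "b < k" "e b \<le> y" "law k e ss (y - e b) \<noteq> 0"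
    by (auto elim!: sum.not_neutral_contains_not_neutral split: if_splits)
  from Cons.IH[OF this(3)] assms(1)[OF b(1)] b(2) show ?case by simp
qed (simp split: if_splits)

text \<open>Conditioning on the first choice. \<open>h\<close> takes values in a real vector space
  so that the lemma serves real expectations and complex transforms alike; \<open>D\<close> exceeds
  every attainable sum, so the shift by \<open>e b\<close> loses nothing at the upper end.\<close>

lemma law_sum_Cons:
  fixes h :: "nat \<Rightarrow> 'a :: real_vector"
  assumes e: "\<And>b. b < k \<Longrightarrow> e b \<le> E" and D: "Suc (length ss) * E < D"
  shows "(\<Sum>y<D. law k e (s # ss) y *\<^sub>R h y) = (\<Sum>b<k. s b *\<^sub>R (\<Sum>y<D. law k e ss y *\<^sub>R h (y + e b)))"
proof -
  have "(\<Sum>y<D. law k e (s # ss) y *\<^sub>R h y) =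
     (\<Sum>y<D. \<Sum>b<k. s b *\<^sub>R ((if e b \<le> y then law k e ss (y - e b) else 0) *\<^sub>R h y))"
    by (intro sum.cong refl) (simp only: law.simps scaleR_sum_left, intro sum.cong refl, simp)
  also have "\<dots> = (\<Sum>b<k. s b *\<^sub>R (\<Sum>y<D. (if e b \<le> y then law k e ss (y - e b) else 0) *\<^sub>R h y))"
    by (subst sum.swap) (simp add: scaleR_sum_right)
  also have "\<dots> = (\<Sum>b<k. s b *\<^sub>R (\<Sum>y<D. law k e ss y *\<^sub>R h (y + e b)))"
  proof (rule sum.cong[OF refl])
    fix b assume "b \<in> {..<k}"
    then have b: "e b \<le> E" using e by simp
    have "(\<Sum>y<D. (if e b \<le> y then law k e ss (y - e b) else 0) *\<^sub>R h y) =
       (\<Sum>y\<in>{e b..<D}. law k e ss (y - e b) *\<^sub>R h y)"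
      by (intro sum.mono_neutral_cong_right) auto
    also have "\<dots> = (\<Sum>y<D - e b. law k e ss y *\<^sub>R h (y + e b))"
      by (rule sum.reindex_bij_witness[of _ "\<lambda>y. y + e b" "\<lambda>y. y - e b"]) auto
    also have "\<dots> = (\<Sum>y<D. law k e ss y *\<^sub>R h (y + e b))"
    proof (rule sum.mono_neutral_left)
      show "\<forall>y\<in>{..<D} - {..<D - e b}. law k e ss y *\<^sub>R h (y + e b) = 0"
      proof
        fix y assume "y \<in> {..<D} - {..<D - e b}"
        then have "\<not> y \<le> length ss * E" using D b by auto
        then show "law k e ss y *\<^sub>R h (y + e b) = 0" using law_support[where k = k and e = e and E = E and ss = ss, OF e] by auto
      qed
    qed auto
    finally show "s b *\<^sub>R (\<Sum>y<D. (if e b \<le> y then law k e ss (y - e b) else 0) *\<^sub>R h y) =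
       s b *\<^sub>R (\<Sum>y<D. law k e ss y *\<^sub>R h (y + e b))" by simp
  qed
  finally show ?thesis .
qed

lemma law_total:
  assumes e: "\<And>b. b < k \<Longrightarrow> e b \<le> E" and D: "length ss * E < D"
    and s: "\<And>s. s \<in> set ss \<Longrightarrow> (\<Sum>b<k. s b) = 1"
  shows "(\<Sum>y<D. law k e ss y) = 1"
  using D s
proof (induction ss)
  case (Cons s ss)
  then have "(\<Sum>y<D. law k e ss y) = 1" by simp
  with law_sum_Cons[where ss = ss and D = D and s = s and h = "\<lambda>_. 1 :: real", OF e] Cons.prems show ?case by simp
qed (simp add: if_distrib cong: if_cong)

lemma law_fourier:
  fixes z :: complex
  assumes e: "\<And>b. b < k \<Longrightarrow> e b \<le> E" and D: "length ss * E < D"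
  shows "(\<Sum>y<D. law k e ss y *\<^sub>R z ^ y) = (\<Prod>s\<leftarrow>ss. \<Sum>b<k. s b *\<^sub>R z ^ e b)"
  using D
proof (induction ss)
  case (Cons s ss)
  have "(\<Sum>y<D. law k e (s # ss) y *\<^sub>R z ^ y) = (\<Sum>b<k. s b *\<^sub>R ((\<Sum>y<D. law k e ss y *\<^sub>R z ^ y) * z ^ e b))"
    using Cons.prems by (subst law_sum_Cons[OF e]) (auto simp: power_add sum_distrib_right)
  also have "\<dots> = (\<Sum>b<k. s b *\<^sub>R z ^ e b) * (\<Sum>y<D. law k e ss y *\<^sub>R z ^ y)"
    by (simp add: sum_distrib_right mult_ac)
  finally show ?case using Cons by simp
next
  case Nil
  then show ?case by (simp add: if_distrib[of "\<lambda>x. x *\<^sub>R _"] cong: if_cong)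
qed

section \<open>Fourier inversion over the D-th roots of unity\<close>

lemma sum_roots_of_unity_power:
  assumes D: "D > 0"
  shows "(\<Sum>z | z ^ D = 1. z ^ m) = (if D dvd m then of_nat D else (0 :: complex))"
proof (cases "D dvd m")
  case True
  then have "(\<Sum>z | z ^ D = 1. z ^ m) = (\<Sum>z :: complex | z ^ D = 1. (1 :: complex))"
    by (intro sum.cong refl) (auto simp: dvd_def power_mult)
  also have "\<dots> = of_nat D" using card_roots_unity_eq[OF D] by simp
  finally show ?thesis using True by simp
next
  case False
  let ?f = "\<lambda>j. cis (2 * pi * real j / real D)"
  note bij = Complex.bij_betw_roots_unity[OF D]
  have w: "?f 1 ^ D = 1" using D by (simp add: Complex.DeMoivre)
  have "?f 1 ^ m = (?f 1 ^ D) ^ (m div D) * ?f 1 ^ (m mod D)"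
    unfolding power_mult[symmetric] power_add[symmetric] mult_div_mod_eq ..
  then have "?f 1 ^ m = ?f 1 ^ (m mod D)" using w by simp
  also have "\<dots> = ?f (m mod D)" by (simp add: Complex.DeMoivre mult_ac)
  also have "\<dots> \<noteq> ?f 0"
  proof
    assume *: "?f (m mod D) = ?f 0"
    have "m mod D = 0"
      by (rule inj_onD[OF bij_betw_imp_inj_on[OF bij] *]) (use D in auto)
    with False show False by (simp add: dvd_eq_mod_eq_0)
  qed
  finally have ne: "?f 1 ^ m \<noteq> 1" by simp
  have "(\<Sum>z | z ^ D = 1. z ^ m) = (\<Sum>z | z ^ D = 1. (?f 1 * z) ^ m)"
    by (rule sum.reindex_bij_witness[of _ "\<lambda>z. ?f 1 * z" "\<lambda>z. z / ?f 1"])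
      (use w in \<open>auto simp: power_mult_distrib power_divide\<close>)
  also have "\<dots> = ?f 1 ^ m * (\<Sum>z | z ^ D = 1. z ^ m)"
    by (simp add: power_mult_distrib sum_distrib_left)
  finally show ?thesis using ne False by simp
qed

text \<open>Fourier inversion: \<open>a y\<close> is the average over the \<open>D\<close>-th roots
  of unity of the transform times \<open>z^(-y)\<close>, written as \<open>z ^ (D - y)\<close>, and
  an average is bounded by the largest modulus.\<close>

lemma coeff_bound_from_roots_of_unity:
  fixes a :: "nat \<Rightarrow> real"
  assumes bound: "\<And>z :: complex. z ^ D = 1 \<Longrightarrow> cmod (\<Sum>y<D. a y *\<^sub>R z ^ y) \<le> \<epsilon>" and y: "y < D"
  shows "\<bar>a y\<bar> \<le> \<epsilon>"
proof -
  have D: "D > 0" using y by simp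
  let ?R = "{z :: complex. z ^ D = 1}"
  let ?A = "\<lambda>z :: complex. \<Sum>x<D. a x *\<^sub>R z ^ x"
  have "(\<Sum>z\<in>?R. z ^ (D - y) * ?A z) = (\<Sum>z\<in>?R. \<Sum>x<D. a x *\<^sub>R z ^ (x + (D - y)))"
    by (intro sum.cong refl) (simp add: sum_distrib_left power_add mult.commute)
  also have "\<dots> = (\<Sum>x<D. a x *\<^sub>R (\<Sum>z\<in>?R. z ^ (x + (D - y))))"
    by (subst sum.swap) (simp add: scaleR_sum_right)
  also have "\<dots> = (\<Sum>x<D. if x = y then a x *\<^sub>R of_nat D else 0)"
  proof (intro sum.cong refl)
    fix x assume "x \<in> {..<D}"
    then have x: "x < D" by simp
    have "D dvd x + (D - y) \<longleftrightarrow> x = y"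
    proof
      assume "D dvd x + (D - y)"
      then obtain q where q: "x + (D - y) = D * q" by (elim dvdE)
      have "q = 1"
      proof (rule ccontr)
        assume "q \<noteq> 1"
        then consider "q = 0" | "q \<ge> 2" by linarith
        then show False
        proof cases
          case 2
          then have "D * 2 \<le> D * q" by simp
          then show False using q x y by linarith
        qed (use q y in auto)
      qed
      then show "x = y" using q y by simp
    qed (use y in simp)
    then show "a x *\<^sub>R (\<Sum>z\<in>?R. z ^ (x + (D - y))) = (if x = y then a x *\<^sub>R of_nat D else 0)"
      by (simp add: sum_roots_of_unity_power[OF D])
  qed
  also have "\<dots> = of_real (a y * real D)" using y by (simp add: scaleR_conv_of_real)
  finally have "cmod (of_real (a y * real D)) = cmod (\<Sum>z\<in>?R. z ^ (D - y) * ?A z)"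
    by (rule arg_cong[OF sym])
  also have "\<dots> \<le> (\<Sum>z\<in>?R. \<epsilon>)"
  proof (rule sum_norm_le)
    fix z assume z: "z \<in> ?R"
    then have "cmod z ^ D = 1" by (simp flip: norm_power)
    then have "cmod z = 1" using D power_eq_imp_eq_base[of "cmod z" D 1] by simp
    then show "cmod (z ^ (D - y) * ?A z) \<le> \<epsilon>" using bound[of z] z
      by (simp add: norm_mult norm_power)
  qed
  also have "\<dots> = \<epsilon> * real D" using card_roots_unity_eq[OF D] by simp
  finally have "\<bar>a y\<bar> * real D \<le> \<epsilon> * real D" by (simp only: norm_of_real abs_mult abs_of_nat)
  then show ?thesis using D by simp
qed

lemma law_close:
  assumes e: "\<And>b. b < k \<Longrightarrow> e b \<le> E" and D: "length ss * E < D" "length ss' * E < D"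
    and bound: "\<And>z :: complex. z ^ D = 1 \<Longrightarrow>
      cmod ((\<Prod>s\<leftarrow>ss. \<Sum>b<k. s b *\<^sub>R z ^ e b) - (\<Prod>s\<leftarrow>ss'. \<Sum>b<k. s b *\<^sub>R z ^ e b)) \<le> \<epsilon>"
    and f: "\<And>y. y < D \<Longrightarrow> \<bar>f y\<bar> \<le> 1"
  shows "\<bar>(\<Sum>y<D. law k e ss y * f y) - (\<Sum>y<D. law k e ss' y * f y)\<bar> \<le> real D * \<epsilon>"
proof -
  have "\<bar>law k e ss y - law k e ss' y\<bar> \<le> \<epsilon>" if "y < D" for y
  proof (rule coeff_bound_from_roots_of_unity[OF _ that])
    fix z :: complex assume "z ^ D = 1"
    from bound[OF this] show "cmod (\<Sum>y<D. (law k e ss y - law k e ss' y) *\<^sub>R z ^ y) \<le> \<epsilon>"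
      using law_fourier[OF e D(1), where z = z] law_fourier[OF e D(2), where z = z]
      by (simp add: scaleR_diff_left sum_subtractf)
  qed
  then have *: "\<bar>(law k e ss y - law k e ss' y) * f y\<bar> \<le> \<epsilon>" if "y < D" for y
    using mult_mono[of "\<bar>law k e ss y - law k e ss' y\<bar>" \<epsilon> "\<bar>f y\<bar>" 1] f[OF that] that
    by (fastforce simp: abs_mult)
  have "\<bar>\<Sum>y<D. (law k e ss y - law k e ss' y) * f y\<bar> \<le> (\<Sum>y<D. \<epsilon>)"
    by (rule order_trans[OF sum_abs sum_mono]) (use * in auto)
  then show ?thesis by (simp add: sum_subtractf left_diff_distrib)
qed

section \<open>Lipschitz dependence of expectations on the strategies\<close>

lemma law_expectation_bound:
  assumes e: "\<And>b. b < k \<Longrightarrow> e b \<le> E" and D: "length ss * E < D"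
    and s: "\<And>s. s \<in> set ss \<Longrightarrow> stoch k s"
    and f: "\<And>y. \<bar>f y\<bar> \<le> 1"
  shows "\<bar>\<Sum>y<D. law k e ss y * f y\<bar> \<le> 1"
proof -
  have nn: "0 \<le> law k e ss y" for y using s by (intro law_nonneg) (auto simp: stoch_def)
  have "\<bar>\<Sum>y<D. law k e ss y * f y\<bar> \<le> (\<Sum>y<D. law k e ss y)"
    by (rule order_trans[OF sum_abs sum_mono]) (use f nn in \<open>auto simp: abs_mult mult_left_le\<close>)
  also have "\<dots> = 1" using s by (intro law_total[OF e D]) (auto simp: stoch_def)
  finally show ?thesis .
qed

text \<open>Hybrid argument: strategies are exchanged one at a time. An exchange costs at most the
  l1 distance, since the expectations \<open>X b\<close> given the first choice have modulus at most
  1.\<close>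

lemma law_lipschitz:
  assumes e: "\<And>b. b < k \<Longrightarrow> e b \<le> E"
    and "list_all2 (\<lambda>s s'. stoch k s \<and> stoch k s' \<and> (\<Sum>b<k. \<bar>s b - s' b\<bar>) \<le> \<epsilon>) ss ss'"
    and "length ss * E < D" and "\<And>y. \<bar>f y\<bar> \<le> 1"
  shows "\<bar>(\<Sum>y<D. law k e ss y * f y) - (\<Sum>y<D. law k e ss' y * f y)\<bar> \<le> real (length ss) * \<epsilon>"
  using assms(2-4)
proof (induction arbitrary: f rule: list_all2_induct)
  case (Cons s ss s' ss')
  define X where "X b = (\<Sum>y<D. law k e ss y * f (y + e b))" for b
  define X' where "X' b = (\<Sum>y<D. law k e ss' y * f (y + e b))" for b
  have len: "length ss' = length ss" using Cons.hyps(2) by (simp add: list_all2_lengthD)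
  have ss: "stoch k s" if "s \<in> set ss" for s
    using that Cons.hyps(2) unfolding list_all2_conv_all_nth in_set_conv_nth by blast
  have D: "Suc (length ss) * E < D" "length ss * E < D" using Cons.prems(1) by simp_all
  have XX: "\<bar>X b - X' b\<bar> \<le> real (length ss) * \<epsilon>" for b
    unfolding X_def X'_def by (rule Cons.IH) (use D Cons.prems(2) in auto)
  have X1: "\<bar>X b\<bar> \<le> 1" for b
    unfolding X_def by (rule law_expectation_bound[OF e D(2)]) (use ss Cons.prems(2) in auto)
  have "(\<Sum>y<D. law k e (s # ss) y * f y) - (\<Sum>y<D. law k e (s' # ss') y * f y) =
      (\<Sum>b<k. s b * X b) - (\<Sum>b<k. s' b * X' b)"
    using law_sum_Cons[OF e D(1), where s = s and h = f]
      law_sum_Cons[where ss = ss' and D = D and s = s' and h = f, OF e] D len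
    by (simp add: X_def X'_def)
  also have "\<dots> = (\<Sum>b<k. (s b - s' b) * X b) + (\<Sum>b<k. s' b * (X b - X' b))"
    by (simp add: algebra_simps flip: sum.distrib sum_subtractf)
  also have "\<bar>\<dots>\<bar> \<le> (\<Sum>b<k. \<bar>s b - s' b\<bar>) + (\<Sum>b<k. s' b * (real (length ss) * \<epsilon>))"
  proof (intro order_trans[OF abs_triangle_ineq] add_mono)
    show "\<bar>\<Sum>b<k. (s b - s' b) * X b\<bar> \<le> (\<Sum>b<k. \<bar>s b - s' b\<bar>)"
      by (rule order_trans[OF sum_abs sum_mono]) (use X1 in \<open>auto simp: abs_mult mult_left_le\<close>)
    show "\<bar>\<Sum>b<k. s' b * (X b - X' b)\<bar> \<le> (\<Sum>b<k. s' b * (real (length ss) * \<epsilon>))"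
      by (rule order_trans[OF sum_abs sum_mono])
        (use XX Cons.hyps(1) in \<open>auto simp: abs_mult stoch_def intro!: mult_left_mono\<close>)
  qed
  also have "(\<Sum>b<k. s' b * (real (length ss) * \<epsilon>)) = real (length ss) * \<epsilon>"
    using Cons.hyps(1) by (simp add: stoch_def flip: sum_distrib_right)
  finally show ?case using Cons.hyps(1) by (simp add: algebra_simps)
qed simp

lemma law_Pi_pmf:
  fixes h :: "nat \<Rightarrow> real"
  assumes e: "\<And>b. b < k \<Longrightarrow> e b \<le> E" and "length js * E < D" and "distinct js"
    and s: "\<And>j. j \<in> set js \<Longrightarrow> set_pmf (s j) \<subseteq> {..<k}"
  shows "measure_pmf.expectation (Pi_pmf (set js) d s) (\<lambda>f. h (\<Sum>j\<in>set js. e (f j))) =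
     (\<Sum>y<D. law k e (map (\<lambda>j. pmf (s j)) js) y * h y)"
  using assms(2-4)
proof (induction js arbitrary: h)
  case Nil
  then show ?case by (simp add: if_distrib[of "\<lambda>x. x * _"] cong: if_cong)
next
  case (Cons i js)
  have fin: "finite (set_pmf (s j))" if "j \<in> set (i # js)" for j
    using Cons.prems(3)[OF that] finite_subset by blast
  have finP: "finite (set_pmf (Pi_pmf (set js) d s))"
    using fin by (subst set_Pi_pmf) auto
  have ins: "Pi_pmf (set (i # js)) d s = s i \<bind> (\<lambda>b. map_pmf (\<lambda>f. f(i := b)) (Pi_pmf (set js) d s))"
    using Cons.prems(2) by (simp add: Pi_pmf_insert pair_pmf_def map_bind_pmf map_pmf_def[symmetric] bind_return_pmf)
      (simp add: map_pmf_def bind_assoc_pmf bind_return_pmf)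
  have "measure_pmf.expectation (Pi_pmf (set (i # js)) d s) (\<lambda>f. h (\<Sum>j\<in>set (i # js). e (f j))) =
    (\<Sum>b<k. pmf (s i) b * measure_pmf.expectation (Pi_pmf (set js) d s)
       (\<lambda>f. h (\<Sum>j\<in>set (i # js). e ((f(i := b)) j))))"
    unfolding ins using Cons.prems finP by (subst pmf_expectation_bind[of "{..<k}"]) auto
  also have "\<dots> = (\<Sum>b<k. pmf (s i) b * measure_pmf.expectation (Pi_pmf (set js) d s)
       (\<lambda>f. h ((\<Sum>j\<in>set js. e (f j)) + e b)))"
  proof -
    have "(\<Sum>j\<in>set (i # js). e ((f(i := b)) j)) = (\<Sum>j\<in>set js. e (f j)) + e b" for f b
    proof -
      have "(\<Sum>j\<in>set js. e ((f(i := b)) j)) = (\<Sum>j\<in>set js. e (f j))"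
        using Cons.prems(2) by (intro sum.cong) auto
      then show ?thesis using Cons.prems(2) by simp
    qed
    then show ?thesis by simp
  qed
  also have "\<dots> = (\<Sum>b<k. pmf (s i) b * (\<Sum>y<D. law k e (map (\<lambda>j. pmf (s j)) js) y * h (y + e b)))"
    using Cons.prems by (subst Cons.IH) auto
  also have "\<dots> = (\<Sum>y<D. law k e (map (\<lambda>j. pmf (s j)) (i # js)) y * h y)"
    using law_sum_Cons[where ss = "map (\<lambda>j. pmf (s j)) js" and D = D and s = "pmf (s i)" and h = h, OF e] Cons.prems by simp
  finally show ?case .
qed

section \<open>Weights that determine power sums\<close>

lemma digits_unique:
  fixes B :: nat
  assumes "\<And>i. i < R \<Longrightarrow> a i < B" "\<And>i. i < R \<Longrightarrow> a' i < B"
    and "(\<Sum>i<R. a i * B ^ i) = (\<Sum>i<R. a' i * B ^ i)" "i < R"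
  shows "a i = a' i"
  using assms
proof (induction R arbitrary: a a' i)
  case (Suc R)
  have split: "(\<Sum>i<Suc R. c i * B ^ i) = c 0 + B * (\<Sum>i<R. c (Suc i) * B ^ i)" for c
    unfolding sum.lessThan_Suc_shift by (simp add: sum_distrib_left mult_ac)
  have eq: "a 0 + B * (\<Sum>i<R. a (Suc i) * B ^ i) = a' 0 + B * (\<Sum>i<R. a' (Suc i) * B ^ i)"
    using Suc.prems(3) unfolding split .
  have B: "a 0 < B" "a' 0 < B" using Suc.prems by auto
  from arg_cong[OF eq, of "\<lambda>x. x mod B"] B have 0: "a 0 = a' 0" by simp
  with eq B have "(\<Sum>i<R. a (Suc i) * B ^ i) = (\<Sum>i<R. a' (Suc i) * B ^ i)" by simp
  then have "a (Suc j) = a' (Suc j)" if "j < R" for j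
    using Suc.IH[of "\<lambda>i. a (Suc i)" "\<lambda>i. a' (Suc i)" j] Suc.prems(1,2) that by auto
  with 0 Suc.prems(4) show ?case by (cases i) auto
qed simp

lemma digits_unique_inj:
  fixes B :: nat
  assumes S: "finite S" "inj_on c S"
    and a: "\<And>g. g \<in> S \<Longrightarrow> a g < B" "\<And>g. g \<in> S \<Longrightarrow> a' g < B"
    and eq: "(\<Sum>g\<in>S. a g * B ^ c g) = (\<Sum>g\<in>S. a' g * B ^ c g)" and g: "g \<in> S"
  shows "a g = a' g"
proof -
  obtain R where R: "c ` S \<subseteq> {..<R}" using finite_nat_iff_bounded S(1) by blast
  define F where "F b i = (if i \<in> c ` S then b (inv_into S c i) else 0)" for b :: "'a \<Rightarrow> nat" and i
  have F: "F b (c h) = b h" if "h \<in> S" for b h using that S(2) by (simp add: F_def)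
  have "(\<Sum>i<R. F b i * B ^ i) = (\<Sum>h\<in>S. b h * B ^ c h)" for b
  proof -
    have "(\<Sum>i<R. F b i * B ^ i) = (\<Sum>i\<in>c ` S. F b i * B ^ i)"
      using R by (intro sum.mono_neutral_right) (auto simp: F_def)
    also have "\<dots> = (\<Sum>h\<in>S. b h * B ^ c h)"
      using S(2) by (simp add: sum.reindex F)
    finally show ?thesis .
  qed
  then have eq': "(\<Sum>i<R. F a i * B ^ i) = (\<Sum>i<R. F a' i * B ^ i)" using eq by simp
  have "0 < B" using a(1)[OF g] by simp
  then have lt: "F a i < B" "F a' i < B" for i
    using a by (auto simp: F_def S(2))
  have "F a (c g) = F a' (c g)"
    by (rule digits_unique[OF lt eq']) (use R g in auto)
  with F g show ?thesis by simp
qed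

text \<open>Expanding the product gives one term for each word \<open>g\<close> of length
  \<open>K\<close> over the strategies: the monomial of the \<open>Y (g l)\<close>, times
  \<open>B\<close> to the power whose base-\<open>k\<close> digits are \<open>g\<close>. Summed over
  a list of strategies, the weight is a base-\<open>B\<close> number whose digits are all moments of
  degree \<open>K\<close>.\<close>

definition weight :: "nat \<Rightarrow> nat \<Rightarrow> nat \<Rightarrow> (nat \<Rightarrow> nat) \<Rightarrow> nat" where
  "weight k K B Y = (\<Prod>l<K. \<Sum>b<k. Y b * B ^ (b * k ^ l))"

lemma weight_expand:
  "weight k K B Y = (\<Sum>g\<in>Pi\<^sub>E {..<K} (\<lambda>_. {..<k}). (\<Prod>l<K. Y (g l)) * B ^ (\<Sum>l<K. g l * k ^ l))"
  unfolding weight_def by (subst prod_sum_PiE) (simp_all add: prod.distrib power_sum)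

lemma words_inj: "inj_on (\<lambda>g. \<Sum>l<K. g l * k ^ l) (Pi\<^sub>E {..<K} (\<lambda>_. {..<k :: nat}))"
proof (rule inj_onI)
  fix g h assume gh: "g \<in> Pi\<^sub>E {..<K} (\<lambda>_. {..<k})" "h \<in> Pi\<^sub>E {..<K} (\<lambda>_. {..<k})"
    "(\<Sum>l<K. g l * k ^ l) = (\<Sum>l<K. h l * k ^ l)"
  have "g l = h l" if "l < K" for l
    using gh that by (intro digits_unique[of K g k h]) (auto simp: PiE_iff)
  with gh(1,2) show "g = h" by (auto intro: PiE_ext)
qed

text \<open>Every moment is at most the length of the list times \<open>M ^ K\<close>, hence below
  \<open>B\<close>. So no carries occur, equal weights have equal digits, and both sides are the
  same linear combination of these digits.\<close>

lemma weight_determines_moments: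
  assumes len: "length Ys * M ^ K < B" "length Ys' * M ^ K < B"
    and Y: "\<And>Y b. Y \<in> set Ys \<union> set Ys' \<Longrightarrow> b < k \<Longrightarrow> Y b \<le> M"
    and eq: "(\<Sum>Y\<leftarrow>Ys. weight k K B Y) = (\<Sum>Y\<leftarrow>Ys'. weight k K B Y)"
  shows "(\<Sum>Y\<leftarrow>Ys. \<Prod>l<K. \<Sum>b<k. of_nat (Y b) * \<eta> l b) =
     (\<Sum>Y\<leftarrow>Ys'. \<Prod>l<K. \<Sum>b<k. of_nat (Y b) * (\<eta> l b :: complex))"
proof -
  let ?S = "Pi\<^sub>E {..<K} (\<lambda>_. {..<k})"
  let ?a = "\<lambda>Ys g. \<Sum>Y\<leftarrow>Ys. \<Prod>l<K. Y (g l)"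
  have exp: "(\<Sum>Y\<leftarrow>Ys. weight k K B Y) = (\<Sum>g\<in>?S. ?a Ys g * B ^ (\<Sum>l<K. g l * k ^ l))" for Ys
    by (induction Ys) (auto simp: weight_expand algebra_simps sum.distrib)
  have bound: "?a Zs g \<le> length Zs * M ^ K" if "\<And>Y b. Y \<in> set Zs \<Longrightarrow> b < k \<Longrightarrow> Y b \<le> M" "g \<in> ?S" for Zs g
    using that(1)
  proof (induction Zs)
    case (Cons Y Zs)
    have "(\<Prod>l<K. Y (g l)) \<le> (\<Prod>l<K. M)"
      using Cons.prems that(2) by (intro prod_mono) (auto simp: PiE_iff)
    with Cons show ?case by (auto intro!: add_mono)
  qed simp
  have a: "?a Ys g = ?a Ys' g" if "g \<in> ?S" for g
  proof (rule digits_unique_inj[where a = "?a Ys" and a' = "?a Ys'" and B = B, OF _ words_inj])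
    show "finite ?S" by (intro finite_PiE) auto
    show "(\<Sum>g\<in>?S. ?a Ys g * B ^ (\<Sum>l<K. g l * k ^ l)) = (\<Sum>g\<in>?S. ?a Ys' g * B ^ (\<Sum>l<K. g l * k ^ l))"
      using eq unfolding exp .
    show "?a Ys g < B" "?a Ys' g < B" if "g \<in> ?S" for g
      using bound[OF _ that, of Ys] bound[OF _ that, of Ys'] len Y by (fastforce intro: le_less_trans)+
  qed (use that in auto)
  have exp': "(\<Sum>Y\<leftarrow>Ys. \<Prod>l<K. \<Sum>b<k. of_nat (Y b) * \<eta> l b) =
     (\<Sum>g\<in>?S. of_nat (?a Ys g) * (\<Prod>l<K. \<eta> l (g l)))" for Ys
    by (induction Ys) (auto simp: prod_sum_PiE prod.distrib algebra_simps sum.distrib)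
  show ?thesis unfolding exp' using a by simp
qed

lemma weight_determines_power_sums:
  assumes "length Ys * M ^ K < B" "length Ys' * M ^ K < B"
    and Y: "\<And>Y. Y \<in> set Ys \<union> set Ys' \<Longrightarrow> (\<Sum>b<k. Y b) = M" and M: "M > 0"
    and "(\<Sum>Y\<leftarrow>Ys. weight k K B Y) = (\<Sum>Y\<leftarrow>Ys'. weight k K B Y)" and m: "m \<le> K"
  shows "(\<Sum>Y\<leftarrow>Ys. (\<Sum>b<k. of_nat (Y b) / of_nat M * \<zeta> b) ^ m) =
     (\<Sum>Y\<leftarrow>Ys'. (\<Sum>b<k. of_nat (Y b) / of_nat M * (\<zeta> b :: complex)) ^ m)"
proof -
  have le: "Y b \<le> M" if "Y \<in> set Ys \<union> set Ys'" "b < k" for Y b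
    using Y[OF that(1)] that(2) member_le_sum[of b "{..<k}" Y] by simp
  \<comment> \<open>Degree \<open>m\<close> is padded to degree \<open>K\<close> by factors
    \<open>\<Sum>b<k. Y b\<close>, which have the common value \<open>M\<close>.\<close>
  let ?\<eta> = "\<lambda>l b. if l < m then \<zeta> b else 1"
  have "(\<Prod>l<K. \<Sum>b<k. of_nat (Y b) * ?\<eta> l b) = of_nat M ^ K * (\<Sum>b<k. of_nat (Y b) / of_nat M * \<zeta> b) ^ m"
    if "Y \<in> set Ys \<union> set Ys'" for Y
  proof -
    have "(\<Prod>l<K. \<Sum>b<k. of_nat (Y b) * ?\<eta> l b) =
       (\<Prod>l<K. if l < m then \<Sum>b<k. of_nat (Y b) * \<zeta> b else of_nat M)"
      using Y[OF that] by (intro prod.cong refl) (auto simp flip: of_nat_sum)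
    also have "\<dots> = (\<Sum>b<k. of_nat (Y b) * \<zeta> b) ^ m * of_nat M ^ (K - m)"
    proof -
      have "{..<K} \<inter> {l. l < m} = {..<m}" "{..<K} \<inter> - {l. l < m} = {m..<K}" using m by auto
      then show ?thesis by (simp add: prod.If_cases)
    qed
    also have "\<dots> = of_nat M ^ K * (\<Sum>b<k. of_nat (Y b) / of_nat M * \<zeta> b) ^ m"
    proof -
      have "(\<Sum>b<k. of_nat (Y b) / of_nat M * \<zeta> b) = (\<Sum>b<k. of_nat (Y b) * \<zeta> b) / of_nat M"
        by (simp add: sum_divide_distrib)
      moreover have "of_nat M ^ K = (of_nat M ^ (K - m) * of_nat M ^ m :: complex)"
        using m by (simp flip: power_add)
      ultimately show ?thesis using M by (simp add: power_divide)
    qed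
    finally show ?thesis .
  qed
  then have "(\<Sum>Y\<leftarrow>Zs. \<Prod>l<K. \<Sum>b<k. of_nat (Y b) * ?\<eta> l b) =
      of_nat M ^ K * (\<Sum>Y\<leftarrow>Zs. (\<Sum>b<k. of_nat (Y b) / of_nat M * \<zeta> b) ^ m)"
    if "set Zs \<subseteq> set Ys \<union> set Ys'" for Zs
    using that by (induction Zs) (auto simp: distrib_left)
  moreover have "(\<Sum>Y\<leftarrow>Ys. \<Prod>l<K. \<Sum>b<k. of_nat (Y b) * ?\<eta> l b) =
     (\<Sum>Y\<leftarrow>Ys'. \<Prod>l<K. \<Sum>b<k. of_nat (Y b) * ?\<eta> l b)"
    by (rule weight_determines_moments[where M = M and B = B]) (use assms le in auto)
  ultimately show ?thesis using M by simp
qed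


section \<open>Power sums determine products\<close>

text \<open>Newton's identities, from the logarithmic derivative of \<open>\<Prod>(1 + d X)\<close>.\<close>

lemma prod_eq_from_power_sums:
  fixes ds ds' :: "complex list"
  assumes p: "\<And>m. m \<le> K \<Longrightarrow> (\<Sum>d\<leftarrow>ds. d ^ m) = (\<Sum>d\<leftarrow>ds'. d ^ m)"
    and len: "length ds \<le> K" "length ds' \<le> K"
  shows "(\<Prod>d\<leftarrow>ds. 1 + d) = (\<Prod>d\<leftarrow>ds'. 1 + d)"
proof -
  define P where "P xs = (\<Prod>d\<leftarrow>xs. [:1, d:])" for xs :: "complex list"
  define A where "A xs = (\<Sum>d\<leftarrow>xs. Abs_fps (\<lambda>m. d * (- d) ^ m))" for xs :: "complex list"
  have A1: "fps_of_poly [:1, d:] * Abs_fps (\<lambda>m. d * (- d) ^ m) = fps_const d" for d :: complex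
  proof (rule fps_ext)
    have *: "fps_of_poly [:1, d:] = 1 + fps_X * fps_const d" by (simp add: fps_of_poly_pCons mult.commute)
    show "fps_nth (fps_of_poly [:1, d:] * Abs_fps (\<lambda>m. d * (- d) ^ m)) m = fps_nth (fps_const d) m" for m
      unfolding * by (cases m) (simp_all add: distrib_right mult.assoc)
  qed
  have deriv: "fps_deriv (fps_of_poly (P xs)) = fps_of_poly (P xs) * A xs" for xs
  proof (induction xs)
    case (Cons d xs)
    have *: "fps_of_poly (P (d # xs)) = fps_of_poly [:1, d:] * fps_of_poly (P xs)"
      by (simp only: P_def list.map prod_list.Cons fps_of_poly_mult)
    have "fps_deriv (fps_of_poly [:1, d:]) = fps_const d"
      by (simp add: fps_of_poly_pCons)
    then have "fps_deriv (fps_of_poly (P (d # xs))) =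
       fps_of_poly [:1, d:] * (fps_of_poly (P xs) * A xs) + fps_const d * fps_of_poly (P xs)"
      unfolding * by (simp only: fps_deriv_mult Cons.IH)
    also have "\<dots> = fps_of_poly (P (d # xs)) * A (d # xs)"
      unfolding A1[symmetric] * by (simp add: A_def algebra_simps del: fps_of_poly_pCons)
    finally show ?case .
  qed (simp add: P_def A_def)
  have A_nth: "fps_nth (A xs) m = (-1) ^ m * (\<Sum>d\<leftarrow>xs. d ^ Suc m)" for xs m
  proof (induction xs)
    case (Cons d xs)
    have "fps_nth (A (d # xs)) m = d * (- d) ^ m + fps_nth (A xs) m" by (simp add: A_def)
    then show ?case unfolding Cons power_minus[of d m] by (simp add: algebra_simps)
  qed (simp add: A_def)
  \<comment> \<open>Each coefficient is determined by the lower ones and by the power sums of no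
    higher degree.\<close>
  have rec: "of_nat (Suc m) * coeff (P xs) (Suc m) = (\<Sum>i\<le>m. coeff (P xs) i * fps_nth (A xs) (m - i))" for xs m
    using arg_cong[OF deriv[of xs], of "\<lambda>f. fps_nth f m"] by (simp add: fps_mult_nth atMost_atLeast0)
  have P0: "coeff (P xs) 0 = 1" for xs by (induction xs) (auto simp: P_def)
  have eq: "coeff (P ds) m = coeff (P ds') m" if "m \<le> K" for m
    using that
  proof (induction m rule: less_induct)
    case (less m)
    show ?case
    proof (cases m)
      case (Suc j)
      have "of_nat (Suc j) * coeff (P ds) (Suc j) = of_nat (Suc j) * coeff (P ds') (Suc j)"
        unfolding rec A_nth using less.IH less.prems Suc p[of "Suc (j - i)" for i]
        by (intro sum.cong refl) (auto simp del: power_Suc)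
      then show ?thesis using Suc by (simp del: of_nat_Suc)
    qed (simp add: P0)
  qed
  \<comment> \<open>All coefficients beyond \<open>K\<close> vanish, so agreement up to
    \<open>K\<close> is equality of the polynomials; evaluation at 1 gives the products.\<close>
  have deg: "degree (P xs) \<le> length xs" for xs
  proof (induction xs)
    case (Cons d xs)
    have "P (d # xs) = [:1, d:] * P xs" by (simp only: P_def list.map prod_list.Cons)
    then have "degree (P (d # xs)) \<le> degree [:1, d:] + degree (P xs)"
      by (simp only: degree_mult_le)
    also have "degree [:1, d:] \<le> 1" by simp
    finally show ?case using Cons by simp
  qed (simp add: P_def)
  have "P ds = P ds'"
  proof (rule poly_eqI)
    fix m
    show "coeff (P ds) m = coeff (P ds') m"
    proof (cases "m \<le> K")
      case False
      then show ?thesis using deg[of ds] deg[of ds'] len by (simp add: coeff_eq_0)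
    qed (rule eq)
  qed
  moreover
  have "poly (P xs) 1 = (\<Prod>d\<leftarrow>xs. 1 + d)" for xs
    by (induction xs) (auto simp: P_def distrib_right)
  from this[of ds] this[of ds'] calculation show ?thesis by simp
qed

text \<open>From degree \<open>K + 1\<close> on, the series is dominated by \<open>r^(K+1)\<close>
  times a geometric series of ratio 1/2. The sum may include \<open>m = 0\<close>, as division by 0
  makes that term 0.\<close>

lemma Ln_taylor_remainder:
  fixes d :: complex
  assumes d: "cmod d \<le> r" and r: "r \<le> 1 / 2"
  shows "cmod (ln (1 + d) - (\<Sum>m\<le>K. (-1) ^ Suc m / of_nat m * d ^ m)) \<le> 2 * r ^ Suc K"
proof -
  let ?f = "\<lambda>m. (-1) ^ Suc m / of_nat m * d ^ m"
  have "?f sums ln (1 + d)" using assms by (intro Ln_series) auto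
  from sums_split_initial_segment[OF this, of "Suc K"]
  have s: "(\<lambda>m. ?f (m + Suc K)) sums (ln (1 + d) - (\<Sum>m\<le>K. ?f m))"
    by (simp only: lessThan_Suc_atMost)
  have r0: "0 \<le> r" using d norm_ge_zero order_trans by blast
  have g: "(\<lambda>m. r ^ Suc K * (1 / 2) ^ m) sums (r ^ Suc K * 2)"
    using sums_mult[OF geometric_sums[of "1 / 2 :: real"], of "r ^ Suc K"] by simp
  have le: "cmod (?f (m + Suc K)) \<le> r ^ Suc K * (1 / 2) ^ m" for m
  proof -
    have "cmod (?f (m + Suc K)) = cmod d ^ (m + Suc K) / real (m + Suc K)"
      by (simp add: norm_mult norm_power norm_divide del: of_nat_Suc of_nat_add power_Suc)
    also have "\<dots> \<le> cmod d ^ (m + Suc K) / 1" by (intro divide_left_mono) auto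
    also have "\<dots> = cmod d ^ (m + Suc K)" by simp
    also have "\<dots> \<le> r ^ (m + Suc K)" using d by (intro power_mono) auto
    also have "\<dots> \<le> r ^ Suc K * (1 / 2) ^ m"
      unfolding power_add mult.commute[of "r ^ m"] using r r0 by (intro mult_left_mono power_mono) auto
    finally show ?thesis .
  qed
  have "cmod (ln (1 + d) - (\<Sum>m\<le>K. ?f m)) = cmod (\<Sum>m. ?f (m + Suc K))"
    using sums_unique[OF s] by simp
  also have "\<dots> \<le> (\<Sum>m. r ^ Suc K * (1 / 2) ^ m)"
    by (rule norm_suminf_le[OF le sums_summable[OF g]])
  also have "\<dots> = 2 * r ^ Suc K" using sums_unique[OF g] by simp
  finally show ?thesis .
qed

text \<open>If \<open>a\<close> and \<open>b\<close> are within distance 1, factor out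
  \<open>exp b\<close> and use e \<le> 3; otherwise two points of the unit disc differ by at most
  2.\<close>

lemma norm_exp_diff_le:
  fixes a b :: complex
  assumes "cmod (exp a) \<le> 1" "cmod (exp b) \<le> 1"
  shows "cmod (exp a - exp b) \<le> 3 * cmod (a - b)"
proof (cases "cmod (a - b) \<le> 1")
  case True
  have "cmod (exp (a - b) - 1) \<le> exp \<bar>Re (a - b)\<bar> * cmod (a - b)"
    using Taylor_exp[of "a - b" 0] by simp
  also have "\<dots> \<le> 3 * cmod (a - b)"
  proof (rule mult_right_mono)
    have "exp \<bar>Re (a - b)\<bar> \<le> exp 1" using True abs_Re_le_cmod[of "a - b"] by simp
    then show "exp \<bar>Re (a - b)\<bar> \<le> 3" using exp_le by linarith
  qed simp
  finally have "cmod (exp b * (exp (a - b) - 1)) \<le> 1 * (3 * cmod (a - b))"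
    unfolding norm_mult using assms by (intro mult_mono) auto
  then show ?thesis by (simp add: algebra_simps exp_diff)
next
  case False
  have "cmod (exp a - exp b) \<le> cmod (exp a) + cmod (exp b)" by (rule norm_triangle_ineq4)
  then show ?thesis using False assms by linarith
qed

text \<open>Logarithms truncated at degree \<open>K\<close> are combinations of power sums, so their
  totals agree for both lists. The constant is 3 for passing from logarithms to products, times 2
  for each of the two remainders.\<close>

lemma prod_close_from_power_sums:
  fixes ds ds' :: "complex list"
  assumes p: "\<And>m. m \<le> K \<Longrightarrow> (\<Sum>d\<leftarrow>ds. d ^ m) = (\<Sum>d\<leftarrow>ds'. d ^ m)"
    and d: "\<And>d. d \<in> set ds \<union> set ds' \<Longrightarrow> cmod d \<le> r \<and> cmod (1 + d) \<le> 1" and r: "r \<le> 1 / 2"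
    and len: "length ds = L" "length ds' = L"
  shows "cmod ((\<Prod>d\<leftarrow>ds. 1 + d) - (\<Prod>d\<leftarrow>ds'. 1 + d)) \<le> 12 * real L * r ^ Suc K"
proof -
  let ?T = "\<lambda>d. \<Sum>m\<le>K. (-1) ^ Suc m / of_nat m * (d :: complex) ^ m"
  have ex: "(\<Prod>d\<leftarrow>xs. 1 + d) = exp (\<Sum>d\<leftarrow>xs. ln (1 + d))"
    and nm: "cmod (\<Prod>d\<leftarrow>xs. 1 + d) \<le> 1"
    and tl: "cmod ((\<Sum>d\<leftarrow>xs. ln (1 + d)) - (\<Sum>d\<leftarrow>xs. ?T d)) \<le> real (length xs) * (2 * r ^ Suc K)"
    if "set xs \<subseteq> set ds \<union> set ds'" for xs
  proof -
    have "(\<Prod>d\<leftarrow>xs. 1 + d) = exp (\<Sum>d\<leftarrow>xs. ln (1 + d)) \<and> cmod (\<Prod>d\<leftarrow>xs. 1 + d) \<le> 1 \<and>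
       cmod ((\<Sum>d\<leftarrow>xs. ln (1 + d)) - (\<Sum>d\<leftarrow>xs. ?T d)) \<le> real (length xs) * (2 * r ^ Suc K)"
      using that
    proof (induction xs)
      case (Cons x xs)
      then have x: "cmod x \<le> r" "cmod (1 + x) \<le> 1" using d by auto
      have "1 + x \<noteq> 0"
      proof
        assume "1 + x = 0"
        then have "x = - 1" by (simp add: eq_neg_iff_add_eq_0 add.commute)
        then show False using x r by simp
      qed
      then have "exp (ln (1 + x)) = 1 + x" by simp
      moreover have "cmod ((1 + x) * (\<Prod>d\<leftarrow>xs. 1 + d)) \<le> 1 * 1"
        unfolding norm_mult using Cons x by (intro mult_mono) auto
      moreover have "cmod ((ln (1 + x) - ?T x) + ((\<Sum>d\<leftarrow>xs. ln (1 + d)) - (\<Sum>d\<leftarrow>xs. ?T d)))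
          \<le> 2 * r ^ Suc K + real (length xs) * (2 * r ^ Suc K)"
        using Cons by (intro order_trans[OF norm_triangle_ineq] add_mono Ln_taylor_remainder[OF x(1) r]) auto
      ultimately show ?case using Cons by (simp add: exp_add algebra_simps)
    qed simp
    then show "(\<Prod>d\<leftarrow>xs. 1 + d) = exp (\<Sum>d\<leftarrow>xs. ln (1 + d))" "cmod (\<Prod>d\<leftarrow>xs. 1 + d) \<le> 1"
      "cmod ((\<Sum>d\<leftarrow>xs. ln (1 + d)) - (\<Sum>d\<leftarrow>xs. ?T d)) \<le> real (length xs) * (2 * r ^ Suc K)"
      by blast+
  qed
  have T: "(\<Sum>d\<leftarrow>xs. \<Sum>m\<le>K. c m * d ^ m) = (\<Sum>m\<le>K. c m * (\<Sum>d\<leftarrow>xs. d ^ m))" for c :: "nat \<Rightarrow> complex" and xs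
    by (induction xs) (auto simp: sum.distrib distrib_left)
  have T_eq: "(\<Sum>d\<leftarrow>ds. ?T d) = (\<Sum>d\<leftarrow>ds'. ?T d)" unfolding T using p by simp
  let ?a = "\<Sum>d\<leftarrow>ds. ln (1 + d)" and ?b = "\<Sum>d\<leftarrow>ds'. ln (1 + d)"
  have "cmod (?a - ?b) \<le> cmod (?a - (\<Sum>d\<leftarrow>ds. ?T d)) + cmod (?b - (\<Sum>d\<leftarrow>ds'. ?T d))"
    unfolding T_eq using norm_triangle_ineq4[of "?a - (\<Sum>d\<leftarrow>ds'. ?T d)" "?b - (\<Sum>d\<leftarrow>ds'. ?T d)"] by simp
  also have "\<dots> \<le> real L * (2 * r ^ Suc K) + real L * (2 * r ^ Suc K)"
    using tl[of ds] tl[of ds'] len by (intro add_mono) auto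
  finally have *: "cmod (?a - ?b) \<le> 4 * real L * r ^ Suc K" by (simp add: mult_ac)
  have "cmod (exp ?a - exp ?b) \<le> 3 * cmod (?a - ?b)"
    using ex[of ds] ex[of ds'] nm[of ds] nm[of ds'] by (intro norm_exp_diff_le) auto
  with * show ?thesis using ex[of ds] ex[of ds'] by simp
qed

section \<open>Profiles of equal weight have close laws\<close>

definition noisy :: "nat \<Rightarrow> real \<Rightarrow> nat \<Rightarrow> (nat \<Rightarrow> nat) \<Rightarrow> nat \<Rightarrow> real" where
  "noisy k \<theta> M Y b = (1 - \<theta>) * (real (Y b) / real M) + \<theta> / real k"

lemma stoch_noisy:
  assumes "k \<ge> 1" "M > 0" "0 \<le> \<theta>" "\<theta> \<le> 1" "(\<Sum>b<k. Y b) = M"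
  shows "stoch k (noisy k \<theta> M Y)"
proof -
  have "(\<Sum>b<k. real (Y b) / real M) = 1"
    using assms by (simp flip: sum_divide_distrib of_nat_sum)
  moreover have "(\<Sum>b<k. noisy k \<theta> M Y b) = (1 - \<theta>) * (\<Sum>b<k. real (Y b) / real M) + (\<Sum>b<k. \<theta> / real k)"
    unfolding noisy_def sum.distrib sum_distrib_left ..
  ultimately show ?thesis
    using assms(1,3,4) by (auto simp: stoch_def noisy_def)
qed

text \<open>By the parallelogram law \<open>|1 + w|^2 = 4 - |w - 1|^2\<close>, and the square root
  of \<open>4 - r^2\<close> is at most \<open>2 - r^2 / 4\<close>.\<close>

lemma norm_one_plus_unit:
  fixes w :: complex
  assumes "cmod w = 1" "r < cmod (w - 1)" "0 \<le> r"
  shows "cmod (1 + w) \<le> 2 - r\<^sup>2 / 4"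
proof -
  have "(Re w)\<^sup>2 + (Im w)\<^sup>2 = 1" using assms(1) by (metis cmod_power2 one_power2)
  then have "cmod (1 + w) ^ 2 = 4 - cmod (w - 1) ^ 2"
    unfolding cmod_power2 by (simp add: power2_eq_square algebra_simps)
  moreover have "r\<^sup>2 \<le> cmod (w - 1) ^ 2" using assms by (intro power_mono) auto
  ultimately have "cmod (1 + w) ^ 2 \<le> 4 - r\<^sup>2" by linarith
  also have "\<dots> \<le> (2 - r\<^sup>2 / 4)\<^sup>2" by (simp add: power2_diff)
  finally have *: "cmod (1 + w) ^ 2 \<le> (2 - r\<^sup>2 / 4)\<^sup>2" .
  have "cmod (w - 1) \<le> 2" using norm_triangle_ineq4[of w 1] assms(1) by simp
  then have "r\<^sup>2 \<le> 2\<^sup>2" using assms by (intro power_mono) auto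
  then show ?thesis using power2_le_imp_le[OF *] by simp
qed

lemma norm_prod_list_le:
  fixes f :: "'a \<Rightarrow> complex"
  shows "(\<And>x. x \<in> set xs \<Longrightarrow> cmod (f x) \<le> c) \<Longrightarrow> cmod (\<Prod>x\<leftarrow>xs. f x) \<le> c ^ length xs"
proof (induction xs)
  case (Cons x xs)
  have "0 \<le> c" by (rule order_trans[OF norm_ge_zero Cons.prems[of x]]) simp
  then show ?case using Cons by (auto simp: norm_mult intro!: mult_mono)
qed simp

locale equal_weights =
  fixes k K B M L D E :: nat and e :: "nat \<Rightarrow> nat" and \<theta> :: real and Ys Ys' :: "(nat \<Rightarrow> nat) list"
  assumes k: "k \<ge> 1" and M: "M > 0" and lam: "0 \<le> \<theta>" "\<theta> \<le> 1"
    and len: "length Ys = L" "length Ys' = L" and B: "L * M ^ K < B"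
    and Y: "\<And>Y. Y \<in> set Ys \<union> set Ys' \<Longrightarrow> (\<Sum>b<k. Y b) = M"
    and eq: "(\<Sum>Y\<leftarrow>Ys. weight k K B Y) = (\<Sum>Y\<leftarrow>Ys'. weight k K B Y)"
    and e: "\<And>b. b < k \<Longrightarrow> e b \<le> E" and D: "L * E < D"
begin

context
  fixes z :: complex
  assumes z: "z ^ D = 1"
begin

text \<open>Dividing by the phase of strategy 0 makes \<open>\<zeta> 0 = 1\<close>, so that
  deviations from 1 make sense; this phase is common to all players and drops out of the moduli. The
  uniform noise is folded into \<eta> by means of \<open>(\<Sum>b<k. Y b) = M\<close>, which makes
  \<open>dev\<close> linear in \<open>Y\<close>, the form that the weights control.\<close>

definition "\<zeta> b = z ^ e b / z ^ e 0"
definition "\<eta> b = (1 - \<theta>) *\<^sub>R (\<zeta> b - 1) + (\<theta> / real k) *\<^sub>R (\<Sum>c<k. \<zeta> c - 1)"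
definition "dev Y = (\<Sum>b<k. of_nat (Y b) / of_nat M * \<eta> b)" for Y :: "nat \<Rightarrow> nat"

lemma norm_z: "cmod (z ^ j) = 1"
proof -
  have "cmod z ^ D = 1" using z by (simp flip: norm_power)
  then have "cmod z = 1" using D power_eq_imp_eq_base[of "cmod z" D 1] by simp
  then show ?thesis by (simp add: norm_power)
qed

lemma norm_zeta: "cmod (\<zeta> b) = 1"
  by (simp add: \<zeta>_def norm_divide norm_z)

lemma one_plus_dev:
  assumes "Y \<in> set Ys \<union> set Ys'"
  shows "1 + dev Y = (\<Sum>b<k. noisy k \<theta> M Y b *\<^sub>R \<zeta> b)"
    and "dev Y = (\<Sum>b<k. noisy k \<theta> M Y b *\<^sub>R (\<zeta> b - 1))"
proof -
  have 1: "(\<Sum>b<k. noisy k \<theta> M Y b) = 1"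
    using stoch_noisy[OF k M lam Y[OF assms]] by (simp add: stoch_def)
  have 2: "(\<Sum>b<k. real (Y b) / real M) = 1"
    using Y[OF assms] M by (simp flip: sum_divide_distrib of_nat_sum)
  have "dev Y = (\<Sum>b<k. (real (Y b) / real M) *\<^sub>R \<eta> b)"
    by (simp add: dev_def scaleR_conv_of_real)
  also have "\<dots> = (\<Sum>b<k. ((1 - \<theta>) * (real (Y b) / real M)) *\<^sub>R (\<zeta> b - 1)) +
      (\<Sum>b<k. real (Y b) / real M) *\<^sub>R (\<theta> / real k) *\<^sub>R (\<Sum>c<k. \<zeta> c - 1)"
    unfolding \<eta>_def scaleR_add_right sum.distrib scaleR_sum_left
    by (intro arg_cong2[where f = "(+)"] sum.cong refl) (simp_all add: mult.commute)
  also have "\<dots> = (\<Sum>b<k. noisy k \<theta> M Y b *\<^sub>R (\<zeta> b - 1))"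
    unfolding 2 by (simp add: noisy_def scaleR_add_left sum.distrib scaleR_sum_right)
  finally show *: "dev Y = (\<Sum>b<k. noisy k \<theta> M Y b *\<^sub>R (\<zeta> b - 1))" .
  have "(\<Sum>b<k. noisy k \<theta> M Y b *\<^sub>R (\<zeta> b - 1)) = (\<Sum>b<k. noisy k \<theta> M Y b *\<^sub>R \<zeta> b) - of_real (\<Sum>b<k. noisy k \<theta> M Y b)"
    by (simp add: scaleR_diff_right sum_subtractf of_real_def scaleR_sum_left)
  then show "1 + dev Y = (\<Sum>b<k. noisy k \<theta> M Y b *\<^sub>R \<zeta> b)" unfolding * 1 by simp
qed

lemma fourier_prod:
  assumes "set Zs \<subseteq> set Ys \<union> set Ys'"
  shows "(\<Prod>s\<leftarrow>map (noisy k \<theta> M) Zs. \<Sum>b<k. s b *\<^sub>R z ^ e b) = (z ^ e 0) ^ length Zs * (\<Prod>d\<leftarrow>map dev Zs. 1 + d)"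
  using assms
proof (induction Zs)
  case (Cons Y Zs)
  have "z ^ e 0 \<noteq> 0" using norm_z[of "e 0"] by (metis norm_zero zero_neq_one)
  then have "z ^ e 0 * (1 + dev Y) = (\<Sum>b<k. noisy k \<theta> M Y b *\<^sub>R z ^ e b)"
    using Cons.prems by (subst one_plus_dev(1)) (auto simp: sum_distrib_left \<zeta>_def)
  with Cons show ?case by (simp add: mult_ac)
qed simp

lemma fourier_diff:
  "cmod ((\<Prod>s\<leftarrow>map (noisy k \<theta> M) Ys. \<Sum>b<k. s b *\<^sub>R z ^ e b) - (\<Prod>s\<leftarrow>map (noisy k \<theta> M) Ys'. \<Sum>b<k. s b *\<^sub>R z ^ e b))
     = cmod ((\<Prod>d\<leftarrow>map dev Ys. 1 + d) - (\<Prod>d\<leftarrow>map dev Ys'. 1 + d))"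
proof -
  have "cmod ((z ^ e 0) ^ L) = 1" by (simp only: norm_power[of "z ^ e 0"] norm_z power_one)
  then show ?thesis
    using fourier_prod[of Ys] fourier_prod[of Ys'] len
    by (simp add: norm_mult flip: right_diff_distrib del: map_map)
qed

lemma power_sums: "m \<le> K \<Longrightarrow> (\<Sum>d\<leftarrow>map dev Ys. d ^ m) = (\<Sum>d\<leftarrow>map dev Ys'. d ^ m)"
  using weight_determines_power_sums[OF _ _ Y M eq, of m \<eta>] B len by (simp add: dev_def o_def)

lemma norm_convex:
  assumes "Y \<in> set Ys \<union> set Ys'" "\<And>b. b < k \<Longrightarrow> cmod (w b) \<le> c"
  shows "cmod (\<Sum>b<k. noisy k \<theta> M Y b *\<^sub>R w b) \<le> c"
proof -
  note s = stoch_noisy[OF k M lam Y[OF assms(1)]]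
  have "cmod (\<Sum>b<k. noisy k \<theta> M Y b *\<^sub>R w b) \<le> (\<Sum>b<k. noisy k \<theta> M Y b * c)"
    by (rule sum_norm_le) (use s assms(2) in \<open>auto simp: stoch_def intro!: mult_left_mono\<close>)
  also have "\<dots> = c" using s by (simp add: stoch_def flip: sum_distrib_right)
  finally show ?thesis .
qed

text \<open>Whatever \<open>Y\<close> is, the noise contributes \<open>\<theta> / k\<close> times
  the sum of all \<open>\<zeta> c\<close>. This sum contains \<open>1 + \<zeta> b\<close>, which is
  shorter than 2 by at least \<open>r^2 / 4\<close>; everything else is bounded by its total
  probability.\<close>

lemma norm_dev_far:
  assumes Y: "Y \<in> set Ys \<union> set Ys'" and b: "b < k" "r < cmod (\<zeta> b - 1)" "0 \<le> r"
  shows "cmod (1 + dev Y) \<le> 1 - \<theta> * r\<^sup>2 / (4 * real k)"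
proof -
  have "z ^ e 0 \<noteq> 0" using norm_z[of "e 0"] by (metis norm_zero zero_neq_one)
  then have z0: "\<zeta> 0 = 1" by (simp add: \<zeta>_def)
  have b0: "b \<noteq> 0"
  proof
    assume "b = 0"
    then show False using b(2,3) z0 by simp
  qed
  have "(\<Sum>c<k. \<zeta> c) = (1 + \<zeta> b) + (\<Sum>c\<in>{..<k} - {0, b}. \<zeta> c)"
    using b b0 z0 by (subst sum.subset_diff[of "{0, b}"]) (auto simp: add.commute)
  also have "cmod \<dots> \<le> (2 - r\<^sup>2 / 4) + (\<Sum>c\<in>{..<k} - {0, b}. 1)"
    by (intro order_trans[OF norm_triangle_ineq] add_mono norm_one_plus_unit sum_norm_le)
      (use b norm_zeta in auto)
  also have "\<dots> = real k - r\<^sup>2 / 4"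
  proof -
    have "card ({..<k} - {0, b}) = k - 2" using b b0 by (subst card_Diff_subset) auto
    moreover have "k \<ge> 2" using b b0 by linarith
    ultimately show ?thesis by simp
  qed
  finally have 1: "cmod (\<Sum>c<k. \<zeta> c) \<le> real k - r\<^sup>2 / 4" .
  have s: "(\<Sum>b<k. real (Y b) / real M) = 1"
    using equal_weights.Y[OF equal_weights_axioms Y] M by (simp flip: sum_divide_distrib of_nat_sum)
  have 2: "cmod (\<Sum>b<k. (real (Y b) / real M) *\<^sub>R \<zeta> b) \<le> 1"
  proof -
    have "cmod (\<Sum>b<k. (real (Y b) / real M) *\<^sub>R \<zeta> b) \<le> (\<Sum>b<k. real (Y b) / real M)"
      by (rule sum_norm_le) (simp add: norm_zeta)
    with s show ?thesis by simp
  qed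
  have "1 + dev Y = (1 - \<theta>) *\<^sub>R (\<Sum>b<k. (real (Y b) / real M) *\<^sub>R \<zeta> b) + (\<theta> / real k) *\<^sub>R (\<Sum>c<k. \<zeta> c)"
    unfolding one_plus_dev(1)[OF Y] by (simp add: noisy_def scaleR_add_left sum.distrib scaleR_sum_right)
  also have "cmod \<dots> \<le> (1 - \<theta>) * 1 + (\<theta> / real k) * (real k - r\<^sup>2 / 4)"
    using 1 2 lam by (intro order_trans[OF norm_triangle_ineq] add_mono)
      (auto intro!: mult_left_mono divide_right_mono mult_left_le)
  also have "\<dots> = 1 - \<theta> * r\<^sup>2 / (4 * real k)" using k by (simp add: field_simps)
  finally show ?thesis .
qed

text \<open>Either all \<open>\<zeta> b\<close> are within \<open>r\<close> of 1, and every
  deviation is a convex combination of numbers of modulus at most \<open>r\<close>; or one is not,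
  and each of the \<open>L\<close> factors in both lists has modulus at most
  \<open>exp (- \<theta> * r^2 / (4 * k))\<close>.\<close>

lemma fourier_close:
  assumes r: "0 \<le> r" "r \<le> 1 / 2"
  shows "cmod ((\<Prod>d\<leftarrow>map dev Ys. 1 + d) - (\<Prod>d\<leftarrow>map dev Ys'. 1 + d)) \<le>
     2 * exp (- (real L * \<theta> * r\<^sup>2 / (4 * real k))) + 12 * real L * r ^ Suc K"
proof (cases "\<forall>b<k. cmod (\<zeta> b - 1) \<le> r")
  case True
  have "cmod ((\<Prod>d\<leftarrow>map dev Ys. 1 + d) - (\<Prod>d\<leftarrow>map dev Ys'. 1 + d)) \<le> 12 * real L * r ^ Suc K"
  proof (rule prod_close_from_power_sums[OF power_sums])
    fix d assume "d \<in> set (map dev Ys) \<union> set (map dev Ys')"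
    then obtain Y where "Y \<in> set Ys \<union> set Ys'" "d = dev Y" by auto
    then show "cmod d \<le> r \<and> cmod (1 + d) \<le> 1"
      using True norm_zeta by (metis norm_convex one_plus_dev order_refl)
  qed (use r len in auto)
  then show ?thesis by (smt (verit) exp_gt_zero)
next
  case False
  then obtain b where b: "b < k" "r < cmod (\<zeta> b - 1)" by auto
  let ?q = "\<theta> * r\<^sup>2 / (4 * real k)"
  have "cmod (\<Prod>d\<leftarrow>map dev Zs. 1 + d) \<le> exp (- (real L * \<theta> * r\<^sup>2 / (4 * real k)))"
    if "set Zs \<subseteq> set Ys \<union> set Ys'" "length Zs = L" for Zs
  proof -
    have "cmod (\<Prod>d\<leftarrow>map dev Zs. 1 + d) \<le> exp (- ?q) ^ length (map dev Zs)"
    proof (rule norm_prod_list_le)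
      fix d assume "d \<in> set (map dev Zs)"
      then obtain Y where Y: "Y \<in> set Zs" "d = dev Y" by auto
      then have "Y \<in> set Ys \<union> set Ys'" using that(1) by auto
      with Y have "cmod (1 + d) \<le> 1 - ?q" using norm_dev_far b r by blast
      also have "\<dots> \<le> exp (- ?q)" using exp_ge_add_one_self[of "- ?q"] by simp
      finally show "cmod (1 + d) \<le> exp (- ?q)" .
    qed
    also have "\<dots> = exp (- (real L * \<theta> * r\<^sup>2 / (4 * real k)))"
      using that(2) by (simp flip: exp_of_nat_mult add: mult.assoc)
    finally show ?thesis .
  qed
  from this[of Ys] this[of Ys'] have
    "cmod ((\<Prod>d\<leftarrow>map dev Ys. 1 + d) - (\<Prod>d\<leftarrow>map dev Ys'. 1 + d)) \<le> 2 * exp (- (real L * \<theta> * r\<^sup>2 / (4 * real k)))"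
    using len by (intro order_trans[OF norm_triangle_ineq4]) auto
  then show ?thesis using r by (simp add: add_increasing2)
qed

lemma fourier_eq: "L \<le> K \<Longrightarrow> (\<Prod>d\<leftarrow>map dev Ys. 1 + d) = (\<Prod>d\<leftarrow>map dev Ys'. 1 + d)"
  by (rule prod_eq_from_power_sums[OF power_sums]) (use len in auto)

end

text \<open>With no more strategies than power sums the transforms agree exactly, whatever the
  noise. This serves small \<open>n\<close>, where \<theta> is 0 and the far case gives no
  decay.\<close>

lemma law_eq_small:
  assumes "L \<le> K"
  shows "(\<Sum>y<D. law k e (map (noisy k \<theta> M) Ys) y * f y) = (\<Sum>y<D. law k e (map (noisy k \<theta> M) Ys') y * f y)"
proof -
  have "law k e (map (noisy k \<theta> M) Ys) y = law k e (map (noisy k \<theta> M) Ys') y" if "y < D" for y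
  proof -
    have "\<bar>law k e (map (noisy k \<theta> M) Ys) y - law k e (map (noisy k \<theta> M) Ys') y\<bar> \<le> 0"
    proof (rule coeff_bound_from_roots_of_unity[OF _ that])
      fix z :: complex assume z: "z ^ D = 1"
      show "cmod (\<Sum>y<D. (law k e (map (noisy k \<theta> M) Ys) y - law k e (map (noisy k \<theta> M) Ys') y) *\<^sub>R z ^ y) \<le> 0"
        using fourier_diff[OF z] fourier_eq[OF z assms] D len
        unfolding scaleR_diff_left sum_subtractf by (subst (1 2) law_fourier[OF e]) auto
    qed
    then show ?thesis by simp
  qed
  then show ?thesis by simp
qed

lemma law_close_large:
  assumes r: "0 \<le> r" "r \<le> 1 / 2" and f: "\<And>y. y < D \<Longrightarrow> \<bar>f y\<bar> \<le> 1"
  shows "\<bar>(\<Sum>y<D. law k e (map (noisy k \<theta> M) Ys) y * f y) - (\<Sum>y<D. law k e (map (noisy k \<theta> M) Ys') y * f y)\<bar> \<le>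
     real D * (2 * exp (- (real L * \<theta> * r\<^sup>2 / (4 * real k))) + 12 * real L * r ^ Suc K)"
proof (rule law_close[OF e])
  fix z :: complex assume z: "z ^ D = 1"
  show "cmod ((\<Prod>s\<leftarrow>map (noisy k \<theta> M) Ys. \<Sum>b<k. s b *\<^sub>R z ^ e b) - (\<Prod>s\<leftarrow>map (noisy k \<theta> M) Ys'. \<Sum>b<k. s b *\<^sub>R z ^ e b))
     \<le> 2 * exp (- (real L * \<theta> * r\<^sup>2 / (4 * real k))) + 12 * real L * r ^ Suc K"
    unfolding fourier_diff[OF z] by (rule fourier_close[OF z r])
qed (use D len f in auto)

end

section \<open>Existence of approximate equilibria on a grid\<close>

text \<open>
  A mixed strategy is encoded by stick breaking: \<open>t b\<close> is the conditional probability of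
  \<open>b\<close> given that none of the smaller strategies is played.  A point of the cube
  \<open>{0..H}^(n k)\<close> thus gives a profile without any normalization, and Kuhn's lemma yields an
  approximate complementarity: strategy \<open>b\<close> has positive weight only if it is almost as good
  as the tail \<open>tailv\<close> behind it, and the tail only if it is almost as good as \<open>b\<close>.
\<close>

fun tailv :: "(nat \<Rightarrow> real) \<Rightarrow> (nat \<Rightarrow> real) \<Rightarrow> nat \<Rightarrow> nat \<Rightarrow> real" where
  "tailv t v k 0 = 0"
| "tailv t v k (Suc m) = t (k - Suc m) * v (k - Suc m) + (1 - t (k - Suc m)) * tailv t v k m"

definition stick :: "(nat \<Rightarrow> real) \<Rightarrow> nat \<Rightarrow> real" where
  "stick t b = t b * (\<Prod>l<b. 1 - t l)"

lemma sum_stick: "(\<Sum>b<j. stick t b) = 1 - (\<Prod>l<j. 1 - t l)"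
  by (induction j) (auto simp: stick_def algebra_simps)

lemma stoch_stick:
  assumes "\<And>l. 0 \<le> t l \<and> t l \<le> 1" "t (k - 1) = 1" "k \<ge> 1"
  shows "stoch k (stick t)"
proof -
  have "(\<Prod>l<k. 1 - t l) = 0" using assms(2,3) by (intro prod_zero) (auto intro!: bexI[of _ "k - 1"])
  then show ?thesis
    using assms(1) unfolding stoch_def sum_stick
    by (auto simp: stick_def intro!: mult_nonneg_nonneg prod_nonneg)
qed

lemma sum_stick_tailv:
  assumes "j \<le> k"
  shows "(\<Sum>b<k. stick t b * v b) = (\<Sum>b<j. stick t b * v b) + (\<Prod>l<j. 1 - t l) * tailv t v k (k - j)"
  using assms
proof (induction "k - j" arbitrary: j)
  case (Suc m)
  then have j: "j < k" "k - j = Suc (k - Suc j)" by auto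
  have "(\<Sum>b<k. stick t b * v b) =
     (\<Sum>b<Suc j. stick t b * v b) + (\<Prod>l<Suc j. 1 - t l) * tailv t v k (k - Suc j)"
    using Suc.hyps(2) j by (intro Suc.hyps(1)) auto
  also have "\<dots> = (\<Sum>b<j. stick t b * v b) + (\<Prod>l<j. 1 - t l) * tailv t v k (k - j)"
    unfolding j(2) using j(1) by (simp add: stick_def algebra_simps)
  finally show ?case .
qed simp

lemma tailv_bounds:
  assumes "\<And>l. 0 \<le> t l \<and> t l \<le> 1" "\<And>l. 0 \<le> v l \<and> v l \<le> 1"
  shows "0 \<le> tailv t v k m \<and> tailv t v k m \<le> 1"
proof (induction m)
  case (Suc m)
  let ?l = "k - Suc m"
  have "0 \<le> t ?l * v ?l" "0 \<le> (1 - t ?l) * tailv t v k m"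
    using assms[of ?l] Suc by (auto intro: mult_nonneg_nonneg)
  moreover have "t ?l * v ?l \<le> t ?l * 1" "(1 - t ?l) * tailv t v k m \<le> (1 - t ?l) * 1"
    using assms[of ?l] Suc by (intro mult_left_mono; simp)+
  ultimately show ?case by simp
qed simp

text \<open>The error \<open>g\<close> of the values does not accumulate, because
  \<open>tailv\<close> mixes them convexly; only the weights contribute once per level.\<close>

lemma tailv_lipschitz:
  assumes t: "\<And>l. 0 \<le> t l \<and> t l \<le> 1" "\<And>l. 0 \<le> t' l \<and> t' l \<le> 1" "\<And>l. \<bar>t l - t' l\<bar> \<le> h"
    and v: "\<And>l. 0 \<le> v l \<and> v l \<le> 1" "\<And>l. \<bar>v l - v' l\<bar> \<le> g" and nn: "0 \<le> g" "0 \<le> h"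
  shows "\<bar>tailv t v k m - tailv t' v' k m\<bar> \<le> real m * h + g"
proof (induction m)
  case (Suc m)
  let ?l = "k - Suc m"
  let ?T = "tailv t v k m" and ?T' = "tailv t' v' k m"
  have "tailv t v k (Suc m) - tailv t' v' k (Suc m) =
     (t ?l - t' ?l) * (v ?l - ?T) + (t' ?l * (v ?l - v' ?l) + (1 - t' ?l) * (?T - ?T'))"
    by (simp add: algebra_simps)
  also have "\<bar>\<dots>\<bar> \<le> h * 1 + (t' ?l * (real m * h + g) + (1 - t' ?l) * (real m * h + g))"
  proof (intro order_trans[OF abs_triangle_ineq] add_mono)
    have "\<bar>v ?l - ?T\<bar> \<le> 1" using v(1)[of ?l] tailv_bounds[where t = t and v = v and k = k and m = m, OF t(1) v(1)] by linarith
    then show "\<bar>(t ?l - t' ?l) * (v ?l - ?T)\<bar> \<le> h * 1"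
      unfolding abs_mult using t(3)[of ?l] by (intro mult_mono) auto
    have "g \<le> real m * h + g" using nn by simp
    then show "\<bar>t' ?l * (v ?l - v' ?l)\<bar> \<le> t' ?l * (real m * h + g)"
      using v(2)[of ?l] t(2)[of ?l] by (simp add: abs_mult mult_left_mono)
    show "\<bar>(1 - t' ?l) * (?T - ?T')\<bar> \<le> (1 - t' ?l) * (real m * h + g)"
      using Suc t(2)[of ?l] by (simp add: abs_mult mult_left_mono)
  qed
  also have "\<dots> = real (Suc m) * h + g" by (simp add: algebra_simps)
  finally show ?case .
qed (use nn in simp)

lemma stick_lipschitz:
  assumes t: "\<And>l. 0 \<le> t l \<and> t l \<le> 1" "\<And>l. 0 \<le> t' l \<and> t' l \<le> 1" "\<And>l. \<bar>t l - t' l\<bar> \<le> h"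
  shows "\<bar>stick t b - stick t' b\<bar> \<le> real (Suc b) * h"
proof -
  have p: "\<bar>\<Prod>l<b. 1 - t l\<bar> \<le> 1"
    using t by (simp add: prod_nonneg prod_le_1)
  have d: "\<bar>(\<Prod>l<b. 1 - t l) - (\<Prod>l<b. 1 - t' l)\<bar> \<le> real b * h"
  proof -
    have "norm ((\<Prod>l<b. 1 - t l) - (\<Prod>l<b. 1 - t' l)) \<le> (\<Sum>l<b. norm ((1 - t l) - (1 - t' l)))"
      using t by (intro norm_prod_diff) auto
    also have "\<dots> \<le> (\<Sum>l<b. h)"
      using t(3) by (intro sum_mono) (simp add: abs_minus_commute)
    finally show ?thesis by simp
  qed
  have "stick t b - stick t' b = (t b - t' b) * (\<Prod>l<b. 1 - t l) + t' b * ((\<Prod>l<b. 1 - t l) - (\<Prod>l<b. 1 - t' l))"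
    by (simp add: stick_def algebra_simps)
  also have "\<bar>\<dots>\<bar> \<le> h * 1 + 1 * (real b * h)"
  proof (intro order_trans[OF abs_triangle_ineq] add_mono)
    show "\<bar>(t b - t' b) * (\<Prod>l<b. 1 - t l)\<bar> \<le> h * 1"
      unfolding abs_mult using p t(3)[of b] by (intro mult_mono) auto
    show "\<bar>t' b * ((\<Prod>l<b. 1 - t l) - (\<Prod>l<b. 1 - t' l))\<bar> \<le> 1 * (real b * h)"
      unfolding abs_mult using d t(2)[of b] by (intro mult_mono) auto
  qed
  finally show ?thesis by (simp add: algebra_simps)
qed

text \<open>At most \<open>k - 1\<close> factors have denominator \<open>H\<close>, because the last
  strategy takes all that remains; hence the exponent.\<close>

lemma stick_grid:
  assumes H: "H \<ge> 1" and x: "\<And>l. x l \<le> H" and k: "k \<ge> 1" and b: "b < k"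
  shows "\<exists>Y. stick (\<lambda>l. if l = k - 1 then 1 else real (x l) / real H) b = real Y / real (H ^ (k - 1))"
proof -
  let ?t = "\<lambda>l. if l = k - 1 then 1 else real (x l) / real H"
  have "(\<Prod>l<b. 1 - ?t l) = (\<Prod>l<b. real (H - x l) / real H)"
    using b H x by (intro prod.cong refl) (auto simp: of_nat_diff diff_divide_distrib)
  also have "\<dots> = real (\<Prod>l<b. H - x l) / real H ^ b"
    by (simp add: prod_dividef)
  finally have p: "(\<Prod>l<b. 1 - ?t l) = real (\<Prod>l<b. H - x l) / real H ^ b" .
  show ?thesis
  proof (cases "b = k - 1")
    case True
    then show ?thesis unfolding stick_def p by (intro exI[of _ "\<Prod>l<b. H - x l"]) simp
  next
    case False
    define d where "d = k - 1 - Suc b"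
    have "k - 1 = Suc b + d" using b False by (simp add: d_def)
    then have "real (H ^ (k - 1)) = real H ^ Suc b * real H ^ d"
      by (simp only: of_nat_power of_nat_mult power_add)
    then show ?thesis unfolding stick_def p using False H
      by (intro exI[of _ "x b * (\<Prod>l<b. H - x l) * H ^ d"]) (simp add: field_simps)
  qed
qed

text \<open>Payoffs enter only through their range and a Lipschitz constant \<open>C\<close>, so
  that the noise of the opponents can later be built into \<open>U\<close>.\<close>

theorem exists_grid_equilibrium:
  fixes U :: "nat \<Rightarrow> nat \<Rightarrow> (nat \<Rightarrow> nat \<Rightarrow> real) \<Rightarrow> real"
  assumes k: "k \<ge> 1" and H: "H \<ge> 1" and C: "C \<ge> 0"
    and U01: "\<And>i a y. (\<And>j. j < n \<Longrightarrow> stoch k (y j)) \<Longrightarrow> i < n \<Longrightarrow> 0 \<le> U i a y \<and> U i a y \<le> 1"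
    and lip: "\<And>i a y y' \<epsilon>. (\<And>j. j < n \<Longrightarrow> stoch k (y j) \<and> stoch k (y' j) \<and> (\<Sum>b<k. \<bar>y j b - y' j b\<bar>) \<le> \<epsilon>) \<Longrightarrow>
        i < n \<Longrightarrow> \<bar>U i a y - U i a y'\<bar> \<le> C * \<epsilon>"
  shows "\<exists>Y :: nat \<Rightarrow> nat \<Rightarrow> nat. (\<forall>i<n. (\<Sum>b<k. Y i b) = H ^ (k - 1)) \<and>
     (\<forall>i<n. \<forall>a<k. U i a (\<lambda>j b. real (Y j b) / real (H ^ (k - 1))) \<le>
        (\<Sum>b<k. real (Y i b) / real (H ^ (k - 1)) * U i b (\<lambda>j b. real (Y j b) / real (H ^ (k - 1)))) +
        (2 * C + 2) * real k ^ 3 / real H)"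
proof -
  define cl where "cl x = (\<lambda>j. min (x j) H)" for x :: "nat \<Rightarrow> nat"
  define t where "t x i l = (if l = k - 1 then 1 else real (cl x (i * k + l)) / real H)" for x i l
  define y where "y x i = stick (t x i)" for x i
  define v where "v x i a = U i a (y x)" for x i a
  define D where "D x i l = v x i l - tailv (t x i) (v x i) k (k - Suc l)" for x i l
  \<comment> \<open>The values at 0 and at \<open>H\<close> are forced by the boundary condition of
    Kuhn's lemma; in between, label 0 means that strategy \<open>l\<close> is at least as good as
    the tail behind it.\<close>
  define label where "label x j = (if x j = 0 \<or> (x j < H \<and> 0 \<le> D x (j div k) (j mod k)) then 0 else 1 :: nat)" for x j
  \<comment> \<open>The variation of \<open>D\<close> over a unit cell: \<open>C * k^2 / H\<close>
    for the payoff itself, the same for the payoffs inside the tail, and \<open>k / H\<close> for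
    the stick weights.\<close>
  define \<omega> where "\<omega> = 2 * (C * (real k ^ 2 / real H)) + real k / real H"
  have t01: "0 \<le> t x i l \<and> t x i l \<le> 1" for x i l
    using H by (auto simp: t_def cl_def)
  have y: "stoch k (y x i)" for x i
    unfolding y_def using t01 k by (intro stoch_stick) (auto simp: t_def)
  have v01: "0 \<le> v x i a \<and> v x i a \<le> 1" if "i < n" for x i a
    unfolding v_def using U01 y that by blast
  have D_lip: "\<bar>D x i l - D q i l\<bar> \<le> \<omega>" if i: "i < n" and l: "l < k" and x: "\<forall>j<n * k. q j \<le> x j \<and> x j \<le> q j + 1" for x q i l
  proof -
    have tt: "\<bar>t x j l - t q j l\<bar> \<le> 1 / real H" if "j < n" "l < k" for j l
    proof -
      have "j * k + l < n * k"
      proof -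
        have "j * k + l < Suc j * k" using that by simp
        also have "\<dots> \<le> n * k" using that by (intro mult_le_mono1) simp
        finally show ?thesis .
      qed
      then have "cl q (j * k + l) \<le> cl x (j * k + l)" "cl x (j * k + l) \<le> cl q (j * k + l) + 1"
        using x by (auto simp: cl_def min_def)
      then have "\<bar>real (cl x (j * k + l)) - real (cl q (j * k + l))\<bar> \<le> 1" by linarith
      then show ?thesis using H by (simp add: t_def divide_right_mono flip: diff_divide_distrib)
    qed
    \<comment> \<open>The Lipschitz lemmas ask for bounds at all indices, whereas the cell controls
      only those below \<open>k\<close>.\<close>
    define t' where "t' x j l = (if l < k then t x j l else 0)" for x j l
    have stick_t': "stick (t' x j) b = stick (t x j) b" if "b < k" for x j b
      using that by (auto simp: stick_def t'_def intro!: arg_cong2[where f = "(*)"] prod.cong)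
    have t'01: "0 \<le> t' x j l \<and> t' x j l \<le> 1" for x j l using t01 by (simp add: t'_def)
    have t't': "\<bar>t' x j l - t' q j l\<bar> \<le> 1 / real H" if "j < n" for j l
      using tt[OF that] by (simp add: t'_def)
    have tail_t': "tailv (t' x i) (v x i) k m = tailv (t x i) (v x i) k m" for x m
      using k by (induction m) (auto simp: t'_def)
    have yy: "(\<Sum>b<k. \<bar>y x j b - y q j b\<bar>) \<le> real k ^ 2 / real H" if "j < n" for j
    proof -
      have "(\<Sum>b<k. \<bar>y x j b - y q j b\<bar>) \<le> (\<Sum>b<k. real k * (1 / real H))"
      proof (intro sum_mono)
        fix b assume b: "b \<in> {..<k}"
        have "\<bar>y x j b - y q j b\<bar> \<le> real (Suc b) * (1 / real H)"
          using stick_lipschitz[where t = "t' x j" and t' = "t' q j" and b = b, OF t'01 t'01 t't'[OF that]] b by (simp add: y_def stick_t')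
        also have "\<dots> \<le> real k * (1 / real H)" using b by (intro mult_right_mono) auto
        finally show "\<bar>y x j b - y q j b\<bar> \<le> real k * (1 / real H)" .
      qed
      then show ?thesis by (simp add: power2_eq_square)
    qed
    have vv: "\<bar>v x i a - v q i a\<bar> \<le> C * (real k ^ 2 / real H)" for a
      unfolding v_def using yy y i by (intro lip) auto
    have "\<bar>tailv (t' x i) (v x i) k (k - Suc l) - tailv (t' q i) (v q i) k (k - Suc l)\<bar> \<le>
       real (k - Suc l) * (1 / real H) + C * (real k ^ 2 / real H)"
      by (rule tailv_lipschitz[where t = "t' x i" and t' = "t' q i" and v = "v x i" and v' = "v q i",
          OF t'01 t'01 t't'[OF i] v01[OF i] vv]) (use C in auto)
    also have "real (k - Suc l) * (1 / real H) \<le> real k / real H"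
      by (simp add: divide_right_mono)
    finally show ?thesis using vv[of l] unfolding D_def \<omega>_def tail_t' by linarith
  qed
  obtain q where q: "\<forall>j<n * k. q j < H" "\<forall>j<n * k. \<exists>r s. (\<forall>l<n * k. q l \<le> r l \<and> r l \<le> q l + 1) \<and>
      (\<forall>l<n * k. q l \<le> s l \<and> s l \<le> q l + 1) \<and> label r j \<noteq> label s j"
    by (rule kuhn_lemma[of H "n * k" label]) (use H in \<open>auto simp: label_def\<close>)
  \<comment> \<open>Both labels occur in the cell at every coordinate, so \<open>D\<close> is nearly
    0 unless the cell touches a face, where only one sign is excluded.\<close>
  have comp: "(q j = 0 \<or> - \<omega> \<le> D q i l) \<and> (q j = H - 1 \<or> D q i l \<le> \<omega>)"
    if i: "i < n" and l: "l < k" and j: "j = i * k + l" for i l j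
  proof -
    have jn: "j < n * k"
    proof -
      have "j < Suc i * k" using l j by simp
      also have "\<dots> \<le> n * k" using i by (intro mult_le_mono1) simp
      finally show ?thesis .
    qed
    have dm: "j div k = i" "j mod k = l" using l j by auto
    obtain r s where rs: "\<forall>l<n * k. q l \<le> r l \<and> r l \<le> q l + 1" "\<forall>l<n * k. q l \<le> s l \<and> s l \<le> q l + 1"
      "label r j = 0" "label s j = 1"
    proof -
      obtain r s where "\<forall>l<n * k. q l \<le> r l \<and> r l \<le> q l + 1" "\<forall>l<n * k. q l \<le> s l \<and> s l \<le> q l + 1"
        "label r j \<noteq> label s j" using q(2) jn by blast
      then show ?thesis using that[of r s] that[of s r] by (auto simp: label_def split: if_splits)
    qed
    have "q j = 0 \<or> - \<omega> \<le> D q i l"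
    proof (cases "r j = 0")
      case True
      then show ?thesis using rs(1) jn by (metis le_zero_eq)
    next
      case False
      then have "0 \<le> D r i l" using rs(3) dm by (auto simp: label_def split: if_splits)
      then show ?thesis using D_lip[OF i l rs(1)] by linarith
    qed
    moreover have "q j = H - 1 \<or> D q i l \<le> \<omega>"
    proof (cases "s j < H")
      case False
      then have "H \<le> q j + 1" using rs(2) jn by (meson le_trans not_less)
      then show ?thesis using q(1) jn by (metis Suc_diff_1 Suc_eq_plus1 diff_Suc_1 le_antisym less_eq_Suc_le add_diff_cancel_right')
    next
      case True
      then have "D s i l < 0" using rs(4) dm by (auto simp: label_def split: if_splits)
      then show ?thesis using D_lip[OF i l rs(2)] by linarith
    qed
    ultimately show ?thesis by blast
  qed
  \<comment> \<open>Against \<open>v l\<close> the mixture loses \<open>(1 - ?T) * D\<close>,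
    against the tail behind \<open>l\<close> it loses \<open>- ?T * D\<close>. Next to a face the
    factor of the uncontrolled sign is 0 or \<open>1 / H\<close>; this is the origin of the extra
    \<open>1 / H\<close>.\<close>
  have step: "tailv (t q i) (v q i) k (k - l) \<ge> v q i l - (\<omega> + 1 / real H)
      \<and> tailv (t q i) (v q i) k (k - l) \<ge> tailv (t q i) (v q i) k (k - Suc l) - (\<omega> + 1 / real H)"
    if i: "i < n" and l: "Suc l < k" for i l
  proof -
    let ?T = "t q i l" and ?j = "i * k + l"
    have eq: "tailv (t q i) (v q i) k (k - l) = ?T * v q i l + (1 - ?T) * tailv (t q i) (v q i) k (k - Suc l)"
    proof -
      have "k - l = Suc (k - Suc l)" "k - Suc (k - Suc l) = l" using l by auto
      then show ?thesis by simp
    qed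
    have jn: "?j < n * k"
    proof -
      have "?j < Suc i * k" using l by simp
      also have "\<dots> \<le> n * k" using i by (intro mult_le_mono1) simp
      finally show ?thesis .
    qed
    have T: "?T = real (q ?j) / real H" using l q(1) jn by (auto simp: t_def cl_def min_def)
    have w0: "0 \<le> \<omega>" using C by (simp add: \<omega>_def)
    have D1: "\<bar>D q i l\<bar> \<le> 1"
      using v01[OF i, of q l] tailv_bounds[where t = "t q i" and v = "v q i" and k = k and m = "k - Suc l", OF t01 v01[OF i]] unfolding D_def by linarith
    from comp[OF i _ refl, of l] l have c: "(q ?j = 0 \<or> - \<omega> \<le> D q i l)" "(q ?j = H - 1 \<or> D q i l \<le> \<omega>)" by auto
    have "(1 - ?T) * D q i l \<le> \<omega> + 1 / real H"
    proof (cases "q ?j = H - 1")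
      case True
      then have "1 - ?T = 1 / real H" using H unfolding T by (simp add: of_nat_diff field_simps)
      then have "(1 - ?T) * D q i l \<le> 1 / real H * 1" using D1 by (simp only:) (intro mult_left_mono, auto)
      then show ?thesis using w0 by simp
    next
      case False
      then have "(1 - ?T) * D q i l \<le> (1 - ?T) * \<omega>" using c t01[of q i l] by (intro mult_left_mono) auto
      also have "\<dots> \<le> 1 * \<omega>" using w0 t01[of q i l] by (intro mult_right_mono) auto
      finally show ?thesis by (simp add: add_increasing2)
    qed
    moreover have "- (\<omega> + 1 / real H) \<le> ?T * D q i l"
    proof (cases "q ?j = 0")
      case True
      then have "?T * D q i l = 0" unfolding T by simp
      moreover have "0 \<le> 1 / real H" by simp
      ultimately show ?thesis using w0 by linarith
    next
      case False
      then have "?T * (- \<omega>) \<le> ?T * D q i l" using c t01[of q i l] by (intro mult_left_mono) auto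
      moreover have "?T * \<omega> \<le> 1 * \<omega>" using w0 t01[of q i l] by (intro mult_right_mono) auto
      moreover have "0 \<le> 1 / real H" by simp
      ultimately show ?thesis by linarith
    qed
    ultimately show ?thesis unfolding eq D_def by (simp add: algebra_simps)
  qed
  \<comment> \<open>Induction along the stick: each strategy between \<open>j\<close> and
    \<open>a\<close> costs one \<open>\<omega> + 1 / H\<close>, and the last summand pays for
    strategy \<open>a\<close> itself.\<close>
  have tail_ge: "tailv (t q i) (v q i) k (k - j) \<ge> v q i a - real (a - j) * (\<omega> + 1 / real H) - (\<omega> + 1 / real H)"
    if i: "i < n" and a: "a < k" and "j \<le> a" for i a j
    using \<open>j \<le> a\<close>
  proof (induction "a - j" arbitrary: j)
    case 0
    then have [simp]: "j = a" by simp
    have "0 \<le> \<omega> + 1 / real H" using C by (simp add: \<omega>_def)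
    show ?case
    proof (cases "Suc a < k")
      case True
      then show ?thesis using step[OF i, of a] by simp
    next
      case False
      then have "k - a = Suc 0" "k - Suc 0 = a" using a by auto
      then have "tailv (t q i) (v q i) k (k - a) = v q i a" by (simp add: t_def)
      then show ?thesis using \<open>0 \<le> \<omega> + 1 / real H\<close> by simp
    qed
  next
    case (Suc d)
    have "v q i a - real (a - Suc j) * (\<omega> + 1 / real H) - (\<omega> + 1 / real H) \<le> tailv (t q i) (v q i) k (k - Suc j)"
      using Suc.hyps(2) by (intro Suc.hyps(1)) auto
    moreover have "tailv (t q i) (v q i) k (k - j) \<ge> tailv (t q i) (v q i) k (k - Suc j) - (\<omega> + 1 / real H)"
      using step[OF i, of j] a Suc.hyps(2) by simp
    moreover have "a - j = Suc (a - Suc j)" using Suc.hyps(2) by simp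
    then have "real (a - j) * (\<omega> + 1 / real H) = real (a - Suc j) * (\<omega> + 1 / real H) + (\<omega> + 1 / real H)"
      by (simp only: of_nat_Suc distrib_right mult_1_left add.commute)
    ultimately show ?case by linarith
  qed
  have regret: "v q i a \<le> (\<Sum>b<k. y q i b * v q i b) + (2 * C + 2) * real k ^ 3 / real H" if i: "i < n" and a: "a < k" for i a
  proof -
    have w0: "0 \<le> \<omega> + 1 / real H" using C by (simp add: \<omega>_def)
    have "(real a + 1) * (\<omega> + 1 / real H) \<le> real k * (\<omega> + 1 / real H)"
      using a w0 by (intro mult_right_mono) auto
    also have "\<dots> = (2 * C * real k ^ 3 + (real k * real k + real k)) / real H"
      by (simp add: \<omega>_def add_divide_distrib algebra_simps power2_eq_square power3_eq_cube)
    also have "\<dots> \<le> (2 * C * real k ^ 3 + (real k ^ 3 + real k ^ 3)) / real H"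
    proof (intro divide_right_mono add_mono)
      have k1: "1 \<le> real k" using k by simp
      show "real k * real k \<le> real k ^ 3"
        using power_increasing[OF _ k1, of 2 3] by (simp add: power2_eq_square)
      show "real k \<le> real k ^ 3"
        using power_increasing[OF _ k1, of 1 3] by simp
    qed auto
    also have "\<dots> = (2 * C + 2) * real k ^ 3 / real H" by (simp add: algebra_simps)
    finally have "(real a + 1) * (\<omega> + 1 / real H) \<le> (2 * C + 2) * real k ^ 3 / real H" .
    moreover have "(\<Sum>b<k. y q i b * v q i b) = tailv (t q i) (v q i) k k"
      unfolding y_def using sum_stick_tailv[of 0 k "t q i" "v q i"] by simp
    moreover have "v q i a - real a * (\<omega> + 1 / real H) - (\<omega> + 1 / real H) \<le> tailv (t q i) (v q i) k k"
      using tail_ge[OF i a, of 0] by simp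
    moreover have "(real a + 1) * (\<omega> + 1 / real H) = real a * (\<omega> + 1 / real H) + (\<omega> + 1 / real H)"
      by (simp only: distrib_right mult_1_left)
    ultimately show ?thesis by linarith
  qed
  define Y where "Y i b = (SOME m. y q i b = real m / real (H ^ (k - 1)))" for i b
  have "\<exists>m. y q i b = real m / real (H ^ (k - 1))" if "b < k" for i b
    using stick_grid[OF H _ k that, of "\<lambda>l. cl q (i * k + l)"] by (simp add: y_def t_def[abs_def] cl_def)
  from someI_ex[OF this] have Y: "y q i b = real (Y i b) / real (H ^ (k - 1))" if "b < k" for i b
    using that by (simp add: Y_def)
  define Y' where "Y' i b = (if b < k then Y i b else 0)" for i b
  have sumY: "(\<Sum>b<k. Y' i b) = H ^ (k - 1)" for i
  proof -
    have "real (\<Sum>b<k. Y' i b) / real (H ^ (k - 1)) = (\<Sum>b<k. y q i b)"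
      by (simp add: Y Y'_def sum_divide_distrib)
    also have "\<dots> = 1" using y by (simp add: stoch_def)
    finally have "real (\<Sum>b<k. Y' i b) = real (H ^ (k - 1))" using H by (simp add: field_simps)
    then show ?thesis by (simp only: of_nat_eq_iff)
  qed
  \<comment> \<open>\<open>lip\<close> with distance 0 shows that \<open>U\<close> ignores entries
    at indices from \<open>k\<close> on, the only ones where the two profiles can differ.\<close>
  have UY: "U i a (\<lambda>j b. real (Y' j b) / real (H ^ (k - 1))) = v q i a" if "i < n" for i a
  proof -
    have "stoch k (\<lambda>b. real (Y' j b) / real (H ^ (k - 1)))" for j
      using y[of q j] by (simp add: stoch_def Y Y'_def)
    then have "\<bar>U i a (\<lambda>j b. real (Y' j b) / real (H ^ (k - 1))) - U i a (y q)\<bar> \<le> C * 0"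
      using y that by (intro lip) (auto simp: Y Y'_def)
    then show ?thesis by (simp add: v_def)
  qed
  show ?thesis
  proof (intro exI[of _ Y'] conjI allI impI)
    fix i a assume i: "i < n" and a: "a < k"
    have "(\<Sum>b<k. real (Y' i b) / real (H ^ (k - 1)) * v q i b) = (\<Sum>b<k. y q i b * v q i b)"
      by (intro sum.cong refl) (simp add: Y Y'_def)
    then show "U i a (\<lambda>j b. real (Y' j b) / real (H ^ (k - 1))) \<le>
        (\<Sum>b<k. real (Y' i b) / real (H ^ (k - 1)) * U i b (\<lambda>j b. real (Y' j b) / real (H ^ (k - 1)))) +
        (2 * C + 2) * real k ^ 3 / real H"
      unfolding UY[OF i] using regret[OF i a] by simp
  qed (rule sumY)
qed

section \<open>Searching for an equilibrium by total weight\<close>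

text \<open>Unnormalised in spite of its name: the sum of the laws of all lists of \<open>m\<close>
  admissible codes of total weight \<open>t\<close>. Its total mass is the number of these lists, by
  which \<open>U\<close> divides.\<close>

fun avg :: "nat \<Rightarrow> (nat \<Rightarrow> nat) \<Rightarrow> (nat \<Rightarrow> nat) \<Rightarrow> (nat \<Rightarrow> nat \<Rightarrow> real) \<Rightarrow> (nat \<Rightarrow> bool) \<Rightarrow> nat \<Rightarrow>
    nat \<Rightarrow> nat \<Rightarrow> nat \<Rightarrow> real" where
  "avg k e w st V G 0 t y = (if t = 0 \<and> y = 0 then 1 else 0)"
| "avg k e w st V G (Suc m) t y = (\<Sum>c<G. if V c \<and> w c \<le> t then
     \<Sum>b<k. if e b \<le> y then st c b * avg k e w st V G m (t - w c) (y - e b) else 0 else 0)"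

definition lists_of_weight :: "(nat \<Rightarrow> nat) \<Rightarrow> (nat \<Rightarrow> bool) \<Rightarrow> nat \<Rightarrow> nat \<Rightarrow> nat \<Rightarrow> nat list set" where
  "lists_of_weight w V G m t = {cs. set cs \<subseteq> {c. c < G \<and> V c} \<and> length cs = m \<and> (\<Sum>c\<leftarrow>cs. w c) = t}"

lemma finite_lists_of_weight: "finite (lists_of_weight w V G m t)"
  by (rule finite_subset[OF _ finite_lists_length_eq[of "{c. c < G \<and> V c}" m]])
    (auto simp: lists_of_weight_def)

lemma sum_lists_of_weight_Suc:
  fixes f :: "nat list \<Rightarrow> real"
  shows "(\<Sum>cs\<in>lists_of_weight w V G (Suc m) t. f cs) =
    (\<Sum>c<G. if V c \<and> w c \<le> t then \<Sum>cs\<in>lists_of_weight w V G m (t - w c). f (c # cs) else 0)"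
proof -
  let ?C = "{c. c < G \<and> V c \<and> w c \<le> t}"
  have "(\<Sum>cs\<in>lists_of_weight w V G (Suc m) t. f cs) =
     (\<Sum>(c, cs)\<in>Sigma ?C (\<lambda>c. lists_of_weight w V G m (t - w c)). f (c # cs))"
    by (rule sum.reindex_bij_witness[of _ "\<lambda>(c, cs). c # cs" "\<lambda>cs. (hd cs, tl cs)"])
      (auto simp: lists_of_weight_def length_Suc_conv)
  also have "\<dots> = (\<Sum>c\<in>?C. \<Sum>cs\<in>lists_of_weight w V G m (t - w c). f (c # cs))"
    by (subst sum.Sigma) (auto simp: finite_lists_of_weight)
  also have "\<dots> = (\<Sum>c<G. if V c \<and> w c \<le> t then \<Sum>cs\<in>lists_of_weight w V G m (t - w c). f (c # cs) else 0)"
    by (rule sum.mono_neutral_cong_left) auto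
  finally show ?thesis .
qed

lemma avg_eq_sum:
  "avg k e w st V G m t y = (\<Sum>cs\<in>lists_of_weight w V G m t. law k e (map st cs) y)"
proof (induction m arbitrary: t y)
  case 0
  have "lists_of_weight w V G 0 t = (if t = 0 then {[]} else {})" by (auto simp: lists_of_weight_def)
  then show ?case by simp
next
  case (Suc m)
  show ?case unfolding sum_lists_of_weight_Suc avg.simps
  proof (intro sum.cong refl if_cong)
    fix c
    show "(\<Sum>b<k. if e b \<le> y then st c b * avg k e w st V G m (t - w c) (y - e b) else 0) =
      (\<Sum>cs\<in>lists_of_weight w V G m (t - w c). law k e (map st (c # cs)) y)"
      by (simp add: Suc sum_distrib_left if_distrib) (subst sum.swap, auto simp: Suc sum_distrib_left intro!: sum.cong)
  qed
qed

text \<open>Counts the ways to give the first \<open>m\<close> players accepted codes of total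
  weight \<open>t\<close>. Positivity of the count is an existence test that sums can
  express.\<close>

fun assignments :: "(nat \<Rightarrow> nat \<Rightarrow> bool) \<Rightarrow> (nat \<Rightarrow> nat) \<Rightarrow> nat \<Rightarrow> nat \<Rightarrow> nat \<Rightarrow> real" where
  "assignments acc w G 0 t = (if t = 0 then 1 else 0)"
| "assignments acc w G (Suc m) t =
     (\<Sum>c<G. if acc m c \<and> w c \<le> t then assignments acc w G m (t - w c) else 0)"

lemma assignments_nonneg: "0 \<le> assignments acc w G m t"
  by (induction m arbitrary: t) (auto intro!: sum_nonneg)

lemma assignments_pos:
  assumes "\<And>i. i < m \<Longrightarrow> acc i (cf i) \<and> cf i < G"
  shows "0 < assignments acc w G m (\<Sum>i<m. w (cf i))"
  using assms
proof (induction m)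
  case (Suc m)
  then show ?case
    by (auto intro!: sum_pos2[of _ "cf m"] assignments_nonneg)
qed simp

lemma assignments_step:
  "0 < assignments acc w G (Suc m) t \<Longrightarrow>
    \<exists>c. c < G \<and> acc m c \<and> w c \<le> t \<and> 0 < assignments acc w G m (t - w c)"
proof (rule ccontr)
  assume pos: "0 < assignments acc w G (Suc m) t"
    and "\<not> (\<exists>c. c < G \<and> acc m c \<and> w c \<le> t \<and> 0 < assignments acc w G m (t - w c))"
  then have "(\<Sum>c<G. if acc m c \<and> w c \<le> t then assignments acc w G m (t - w c) else 0) \<le> 0"
    by (intro sum_nonpos) (auto simp: not_less)
  with pos show False by simp
qed

text \<open>Players are served from the last to the first. The code chosen leaves a weight that the
  players before \<open>i\<close> can still realise, so no backtracking arises; 0 is a mere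
  default.\<close>

definition pick :: "(nat \<Rightarrow> nat \<Rightarrow> bool) \<Rightarrow> (nat \<Rightarrow> nat) \<Rightarrow> nat \<Rightarrow> nat \<Rightarrow> nat \<Rightarrow> nat" where
  "pick acc w G i t = (if 0 < assignments acc w G (Suc i) t
     then LEAST c. c < G \<and> acc i c \<and> w c \<le> t \<and> 0 < assignments acc w G i (t - w c) else 0)"

text \<open>The part of \<open>T\<close> still available after the last \<open>j\<close> players
  have picked.\<close>

fun rest :: "(nat \<Rightarrow> nat \<Rightarrow> bool) \<Rightarrow> (nat \<Rightarrow> nat) \<Rightarrow> nat \<Rightarrow> nat \<Rightarrow> nat \<Rightarrow> nat \<Rightarrow> nat" where
  "rest acc w G n T 0 = T"
| "rest acc w G n T (Suc j) = rest acc w G n T j - w (pick acc w G (n - 1 - j) (rest acc w G n T j))"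

definition choice :: "(nat \<Rightarrow> nat \<Rightarrow> bool) \<Rightarrow> (nat \<Rightarrow> nat) \<Rightarrow> nat \<Rightarrow> nat \<Rightarrow> nat \<Rightarrow> nat \<Rightarrow> nat" where
  "choice acc w G n T i = pick acc w G i (rest acc w G n T (n - 1 - i))"

lemma pick:
  assumes "0 < assignments acc w G (Suc i) t"
  shows "pick acc w G i t < G" "acc i (pick acc w G i t)" "w (pick acc w G i t) \<le> t"
    "0 < assignments acc w G i (t - w (pick acc w G i t))"
  using LeastI_ex[OF assignments_step[OF assms]] assms by (auto simp: pick_def)

lemma choice:
  assumes "0 < assignments acc w G n T"
  shows "\<And>i. i < n \<Longrightarrow> choice acc w G n T i < G \<and> acc i (choice acc w G n T i)"
    and "(\<Sum>i<n. w (choice acc w G n T i)) = T"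
proof -
  let ?R = "rest acc w G n T"
  \<comment> \<open>What remains can always be completed, and the picked weights together with the
    rest make up \<open>T\<close>.\<close>
  have inv: "0 < assignments acc w G (n - j) (?R j) \<and> (\<Sum>i\<in>{n - j..<n}. w (choice acc w G n T i)) + ?R j = T"
    if "j \<le> n" for j
    using that
  proof (induction j)
    case (Suc j)
    let ?i = "n - 1 - j"
    have i: "n - j = Suc ?i" "n - Suc j = ?i" "n - 1 - ?i = j" using Suc.prems by auto
    have IH: "0 < assignments acc w G (Suc ?i) (?R j)"
      "(\<Sum>i\<in>{n - j..<n}. w (choice acc w G n T i)) + ?R j = T"
      using Suc.IH Suc.prems i(1) by auto
    note p = pick[OF IH(1)]
    have c: "choice acc w G n T ?i = pick acc w G ?i (?R j)" unfolding choice_def i(3) ..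
    have "{n - Suc j..<n} = insert ?i {n - j..<n}" "?i \<notin> {n - j..<n}" using Suc.prems by auto
    then have "(\<Sum>i\<in>{n - Suc j..<n}. w (choice acc w G n T i)) =
       w (pick acc w G ?i (?R j)) + (\<Sum>i\<in>{n - j..<n}. w (choice acc w G n T i))"
      using c by simp
    with p IH(2) show ?case unfolding i(2) by simp
  qed (use assms in simp)
  show "choice acc w G n T i < G \<and> acc i (choice acc w G n T i)" if "i < n" for i
  proof -
    have "n - (n - 1 - i) = Suc i" using that by simp
    then have "0 < assignments acc w G (Suc i) (?R (n - 1 - i))" using inv[of "n - 1 - i"] that by simp
    from pick[OF this] show ?thesis by (simp add: choice_def)
  qed
  \<comment> \<open>With no player left the count is positive only at weight 0, so \<open>T\<close>
    is used up exactly.\<close>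
  have "?R n = 0" using inv[of n] by (auto split: if_splits)
  then show "(\<Sum>i<n. w (choice acc w G n T i)) = T" using inv[of n] by (simp add: atLeast0LessThan)
qed

section \<open>The search, abstracted from the form of the strategies\<close>

definition other_list :: "nat \<Rightarrow> nat \<Rightarrow> nat list" where
  "other_list n i = filter (\<lambda>j. j \<noteq> i) [0..<n]"

lemma other_list: "distinct (other_list n i)" "set (other_list n i) = {..<n} - {i}"
  by (auto simp: other_list_def)

lemma length_other_list: "i < n \<Longrightarrow> length (other_list n i) = n - 1"
  using distinct_card[OF other_list(1)[of n i]] by (simp add: other_list(2))

lemma sum_other_list:
  assumes "i < n"
  shows "(\<Sum>j\<leftarrow>other_list n i. f j) + f i = (\<Sum>j<n. f j :: nat)"
proof -
  have "(\<Sum>j\<leftarrow>other_list n i. f j) = (\<Sum>j\<in>{..<n} - {i}. f j)"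
    by (simp add: sum_list_distinct_conv_sum_set other_list)
  then show ?thesis using assms by (simp add: sum.remove[of "{..<n}" i f])
qed

text \<open>\<kappa> bounds how much a payoff can differ between two opponent lists of equal weight;
  \<eta> is the regret of some profile of codes. \<open>n * w c < W\<close> keeps the total weight
  of a profile below \<open>W\<close>.\<close>

locale weighted_search =
  fixes n k :: nat and e w :: "nat \<Rightarrow> nat" and st :: "nat \<Rightarrow> nat \<Rightarrow> real" and V :: "nat \<Rightarrow> bool"
    and G D E W :: nat and f :: "nat \<Rightarrow> nat \<Rightarrow> nat \<Rightarrow> real" and thr \<kappa> \<eta> :: real
  assumes n: "n \<ge> 1"
    and e: "\<And>b. b < k \<Longrightarrow> e b \<le> E" and D: "(n - 1) * E < D"
    and st: "\<And>c. V c \<Longrightarrow> stoch k (st c)"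
    and W: "\<And>c. V c \<Longrightarrow> n * w c < W"
    and close: "\<And>cs cs' i a. set cs \<subseteq> Collect V \<Longrightarrow> set cs' \<subseteq> Collect V \<Longrightarrow> length cs = n - 1 \<Longrightarrow>
        length cs' = n - 1 \<Longrightarrow> (\<Sum>c\<leftarrow>cs. w c) = (\<Sum>c\<leftarrow>cs'. w c) \<Longrightarrow> i < n \<Longrightarrow> a < k \<Longrightarrow>
        \<bar>(\<Sum>y<D. law k e (map st cs) y * f i a y) - (\<Sum>y<D. law k e (map st cs') y * f i a y)\<bar> \<le> \<kappa>"
    and ex: "\<exists>cf. (\<forall>i<n. V (cf i) \<and> cf i < G) \<and> (\<forall>i<n. \<forall>a<k.
        (\<Sum>y<D. law k e (map (\<lambda>j. st (cf j)) (other_list n i)) y * f i a y) \<le>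
        (\<Sum>b<k. st (cf i) b * (\<Sum>y<D. law k e (map (\<lambda>j. st (cf j)) (other_list n i)) y * f i b y)) + \<eta>)"
    and thr: "\<eta> + 2 * \<kappa> \<le> thr"
begin

abbreviation "A \<equiv> avg k e w st V G (n - 1)"
definition "U t i a = (\<Sum>y<D. A t y * f i a y) / (\<Sum>y<D. A t y)"
text \<open>Given \<open>T\<close>, the weight \<open>T - w c\<close> of the opponents is known
  without knowing the opponents, so acceptance is a condition on each player separately. The
  positivity clause discards weights that no opponent list has.\<close>

definition "acc T i c \<longleftrightarrow> V c \<and> w c \<le> T \<and> 0 < (\<Sum>y<D. A (T - w c) y) \<and>
   (\<forall>a<k. U (T - w c) i a \<le> thr + (\<Sum>b<k. st c b * U (T - w c) i b))"
definition "good T \<longleftrightarrow> T < W \<and> 0 < assignments (acc T) w G n T"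

abbreviation "EV cs i a \<equiv> (\<Sum>y<D. law k e (map st cs) y * f i a y)"

lemma A_total: "(\<Sum>y<D. A t y) = real (card (lists_of_weight w V G (n - 1) t))"
proof -
  have "(\<Sum>y<D. law k e (map st cs) y) = 1" if "cs \<in> lists_of_weight w V G (n - 1) t" for cs
    using that D by (intro law_total[OF e]) (auto simp: lists_of_weight_def dest!: st simp: stoch_def)
  then show ?thesis unfolding avg_eq_sum by (subst sum.swap) simp
qed

text \<open>\<open>U\<close> averages the payoffs against all lists of weight \<open>t\<close>, each
  of which is within \<kappa> of the payoff against \<open>cs\<close>.\<close>

lemma U_close:
  assumes cs: "cs \<in> lists_of_weight w V G (n - 1) t" and ia: "i < n" "a < k"
  shows "\<bar>U t i a - EV cs i a\<bar> \<le> \<kappa>"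
proof -
  let ?S = "lists_of_weight w V G (n - 1) t"
  have pos: "real (card ?S) > 0" using cs finite_lists_of_weight by (auto simp: card_gt_0_iff)
  have "(\<Sum>y<D. A t y * f i a y) = (\<Sum>cs'\<in>?S. EV cs' i a)"
    unfolding avg_eq_sum sum_distrib_right by (rule sum.swap)
  then have "U t i a - EV cs i a = (\<Sum>cs'\<in>?S. EV cs' i a - EV cs i a) / real (card ?S)"
    using pos unfolding U_def A_total by (simp add: sum_subtractf diff_divide_distrib)
  moreover have "\<bar>\<Sum>cs'\<in>?S. EV cs' i a - EV cs i a\<bar> \<le> (\<Sum>cs'\<in>?S. \<kappa>)"
    using cs ia by (intro order_trans[OF sum_abs sum_mono] close) (auto simp: lists_of_weight_def)
  ultimately show ?thesis using pos by (simp add: abs_divide pos_divide_le_eq mult.commute)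
qed

lemma regret_close:
  assumes cs: "cs \<in> lists_of_weight w V G (n - 1) t" and ia: "i < n" "a < k" and c: "V c"
  shows "\<bar>(U t i a - (\<Sum>b<k. st c b * U t i b)) - (EV cs i a - (\<Sum>b<k. st c b * EV cs i b))\<bar> \<le> 2 * \<kappa>"
proof -
  have "\<bar>(\<Sum>b<k. st c b * U t i b) - (\<Sum>b<k. st c b * EV cs i b)\<bar> = \<bar>\<Sum>b<k. st c b * (U t i b - EV cs i b)\<bar>"
    by (simp add: sum_subtractf right_diff_distrib)
  also have "\<dots> \<le> (\<Sum>b<k. st c b * \<kappa>)"
    using st[OF c] U_close[OF cs ia(1)]
    by (intro order_trans[OF sum_abs sum_mono]) (auto simp: abs_mult stoch_def intro!: mult_left_mono)
  also have "\<dots> = \<kappa>" using st[OF c] by (simp add: stoch_def flip: sum_distrib_right)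
  finally show ?thesis using U_close[OF cs ia] by linarith
qed

lemma others_weight:
  assumes "i < n" "\<And>j. j < n \<Longrightarrow> V (cf j) \<and> cf j < G"
  shows "map cf (other_list n i) \<in> lists_of_weight w V G (n - 1) ((\<Sum>j<n. w (cf j)) - w (cf i))"
  using assms sum_other_list[OF assms(1), of "\<lambda>j. w (cf j)"]
  by (auto simp: lists_of_weight_def length_other_list other_list o_def)

text \<open>The profile given by \<open>ex\<close> passes the test at its own total weight:
  replacing its opponents by the average changes a regret by at most \<open>2 * \<kappa>\<close>,
  which \<open>thr\<close> allows for.\<close>

lemma good_exists: "\<exists>T. good T"
proof -
  obtain cf where cf: "\<And>i. i < n \<Longrightarrow> V (cf i) \<and> cf i < G"
    "\<And>i a. i < n \<Longrightarrow> a < k \<Longrightarrow> EV (map cf (other_list n i)) i a \<le>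
        (\<Sum>b<k. st (cf i) b * EV (map cf (other_list n i)) i b) + \<eta>"
    using ex by (auto simp: o_def)
  define T where "T = (\<Sum>j<n. w (cf j))"
  have "acc T i (cf i)" if i: "i < n" for i
  proof -
    note cs = others_weight[where cf = cf, OF i cf(1), folded T_def]
    have "0 < (\<Sum>y<D. A (T - w (cf i)) y)"
      unfolding A_total using cs finite_lists_of_weight by (auto simp: card_gt_0_iff)
    moreover have "w (cf i) \<le> T" unfolding T_def using i by (intro member_le_sum) auto
    moreover have "U (T - w (cf i)) i a \<le> thr + (\<Sum>b<k. st (cf i) b * U (T - w (cf i)) i b)" if "a < k" for a
      using regret_close[OF cs i that, of "cf i"] cf(1)[OF i] cf(2)[OF i that] thr by linarith
    ultimately show ?thesis using cf(1)[OF i] by (auto simp: acc_def)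
  qed
  then have "0 < assignments (acc T) w G n T"
    using cf(1) unfolding T_def by (intro assignments_pos) auto
  moreover have "T < W"
  proof -
    have "n * T = (\<Sum>j<n. n * w (cf j))" by (simp add: T_def sum_distrib_left)
    also have "\<dots> < (\<Sum>j<n. W)" using n W cf(1) by (intro sum_strict_mono) (auto simp: lessThan_empty_iff)
    finally show ?thesis using n by simp
  qed
  ultimately show ?thesis by (auto simp: good_def)
qed

text \<open>The accepted codes really add up to \<open>T\<close>, so the actual opponents of
  \<open>i\<close> are among the lists averaged over, and the comparison of regrets applies in the
  opposite direction.\<close>

lemma choice_regret:
  assumes T: "good T" and i: "i < n" and a: "a < k"
  defines "cf \<equiv> choice (acc T) w G n T"
  shows "V (cf i) \<and> EV (map cf (other_list n i)) i a \<le>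
     (\<Sum>b<k. st (cf i) b * EV (map cf (other_list n i)) i b) + (thr + 2 * \<kappa>)"
proof -
  have pos: "0 < assignments (acc T) w G n T" using T by (simp add: good_def)
  have cf: "V (cf j) \<and> cf j < G" "acc T j (cf j)" if "j < n" for j
    using choice(1)[OF pos that] by (auto simp: cf_def acc_def)
  have "(\<Sum>j<n. w (cf j)) = T" using choice(2)[OF pos] by (simp add: cf_def)
  with others_weight[where cf = cf, OF i cf(1)]
  have cs: "map cf (other_list n i) \<in> lists_of_weight w V G (n - 1) (T - w (cf i))" by simp
  from cf(2)[OF i] a have "U (T - w (cf i)) i a \<le> thr + (\<Sum>b<k. st (cf i) b * U (T - w (cf i)) i b)"
    by (simp add: acc_def)
  with regret_close[OF cs i a, of "cf i"] cf(1)[OF i] show ?thesis by linarith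
qed

end

section \<open>The parameters of the algorithm\<close>

text \<open>The integer part of the \<open>q\<close>-th root of \<open>n + 1\<close>, counted out so
  that a term can compute it.\<close>

definition rt :: "nat \<Rightarrow> nat \<Rightarrow> nat" where
  "rt q n = (\<Sum>i<n + 1. if (i + 1) ^ q \<le> n + 1 then 1 else 0)"

lemma rt_bounds:
  assumes "q \<ge> 1"
  shows "rt q n ^ q \<le> n + 1" "n + 1 < (rt q n + 1) ^ q" "rt q n \<le> n + 1"
proof -
  define j where "j = (GREATEST j. j ^ q \<le> n + 1)"
  have bd: "\<And>i. i ^ q \<le> n + 1 \<Longrightarrow> i \<le> n + 1"
    using assms by (metis One_nat_def le_trans self_le_power Suc_leI not_less_eq_eq zero_le Suc_le_eq le_0_eq)
  have "(0::nat) ^ q \<le> n + 1" using assms by (simp add: power_0_left)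
  from GreatestI_nat[of "\<lambda>j. j ^ q \<le> n + 1", OF this bd] have j: "j ^ q \<le> n + 1"
    by (simp add: j_def)
  have jmax: "i \<le> j" if "i ^ q \<le> n + 1" for i
    using Greatest_le_nat[of "\<lambda>j. j ^ q \<le> n + 1", OF that bd] by (simp add: j_def)
  have "{i \<in> {..<n + 1}. (i + 1) ^ q \<le> n + 1} = {..<j}"
  proof (intro set_eqI iffI)
    fix i assume "i \<in> {i \<in> {..<n + 1}. (i + 1) ^ q \<le> n + 1}"
    then show "i \<in> {..<j}" using jmax[of "i + 1"] by auto
  next
    fix i assume "i \<in> {..<j}"
    then have i: "i + 1 \<le> j" by auto
    then have "(i + 1) ^ q \<le> j ^ q" by (intro power_mono) auto
    then have "(i + 1) ^ q \<le> n + 1" using j by linarith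
    moreover have "i < n + 1" using i bd[OF j] by linarith
    ultimately show "i \<in> {i \<in> {..<n + 1}. (i + 1) ^ q \<le> n + 1}" by auto
  qed
  moreover have "rt q n = card {i \<in> {..<n + 1}. (i + 1) ^ q \<le> n + 1}"
    unfolding rt_def card_eq_sum by (rule sum.inter_filter[symmetric]) simp
  ultimately have rt: "rt q n = j" by simp
  show "rt q n ^ q \<le> n + 1" "rt q n \<le> n + 1" using j bd[OF j] rt by auto
  show "n + 1 < (rt q n + 1) ^ q" using jmax[of "j + 1"] rt by (force simp: not_le[symmetric])
qed

text \<open>The noise \<theta>, of order \<open>n^(1/q - 1)\<close>. It is 0 below
  \<open>N0\<close>, where the exact argument makes it dispensable.\<close>

definition lam :: "nat \<Rightarrow> nat \<Rightarrow> nat \<Rightarrow> real" where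
  "lam q N0 n = (if n < N0 then 0 else real (rt q n) / real (n + 1))"

lemma lam_bounds: "q \<ge> 1 \<Longrightarrow> 0 \<le> lam q N0 n \<and> lam q N0 n \<le> 1"
  using rt_bounds(3)[of q n] by (auto simp: lam_def divide_le_eq)

lemma tv_bound_eventually:
  fixes a b k :: nat
  assumes "k \<ge> 1"
  shows "eventually (\<lambda>x :: real. 16 * (x + 1) ^ a * (2 * exp (- (sqrt x / (12 * real k))) + 12 * (x + 1) ^ b * (1 / x) ^ (a + b + 1)) \<le> 1) at_top"
proof -
  have c: "1 / (12 * real k) > 0" using assms by simp
  have 1: "((\<lambda>x :: real. 32 * ((x + 1) powr real a * exp (- (1 / (12 * real k) * sqrt x)))) \<longlongrightarrow> 0) at_top"
    using c by real_asymp
  have 2: "((\<lambda>x :: real. 192 * (((x + 1) / x) ^ (a + b) * (1 / x))) \<longlongrightarrow> 192 * (1 ^ (a + b) * 0)) at_top"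
    by (intro tendsto_mult tendsto_const tendsto_power) real_asymp+
  have 3: "((\<lambda>x :: real. 32 * ((x + 1) powr real a * exp (- (1 / (12 * real k) * sqrt x))) + 192 * (((x + 1) / x) ^ (a + b) * (1 / x)))
      \<longlongrightarrow> 0) at_top"
    using tendsto_add[OF 1 2] by simp
  have "eventually (\<lambda>x :: real. 32 * ((x + 1) powr real a * exp (- (1 / (12 * real k) * sqrt x))) + 192 * (((x + 1) / x) ^ (a + b) * (1 / x)) < 1) at_top"
    using order_tendstoD(2)[OF 3, of 1] by simp
  then show ?thesis using eventually_gt_at_top[of 0]
  proof eventually_elim
    case (elim x)
    have 1: "(x + 1) powr real a = (x + 1) ^ a" using elim by (simp add: powr_realpow)
    have 2: "((x + 1) / x) ^ (a + b) * (1 / x) = (x + 1) ^ a * (x + 1) ^ b * (1 / x) ^ (a + b + 1)"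
      by (simp add: power_divide power_add)
    have 3: "- (1 / (12 * real k) * sqrt x) = - (sqrt x / (12 * real k))" by simp
    have "16 * P * (2 * E + 12 * B * R) = 32 * (P * E) + 192 * (P * B * R)" for P E B R :: real
      by (simp add: algebra_simps)
    then show ?case using elim(1)[unfolded 1 2 3] by (simp only: less_imp_le)
  qed
qed

text \<open>Put \<open>x = rt q n\<close>. Then \<open>n + 1\<close> is at most
  \<open>(x + 1)^q\<close>, and \<open>n - 1\<close> times the noise is at least
  \<open>x / 3\<close>. The radius \<open>r = x^(-1/4)\<close> makes the exponent of the far case at
  least \<open>sqrt x / (12 k)\<close>, and \<open>K + 1 \<ge> 4 d\<close> turns
  \<open>r^(K+1)\<close> into at most \<open>x^(-d)\<close>; \<open>x \<ge> 16\<close> gives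
  \<open>r \<le> 1/2\<close>.\<close>

lemma tv_bound_large:
  fixes k q :: nat
  assumes k: "k \<ge> 1" and q: "q \<ge> 1"
  shows "\<exists>K1 N1. \<forall>N0 K n. K \<ge> K1 \<longrightarrow> n \<ge> N0 \<longrightarrow> n \<ge> N1 \<longrightarrow> (\<exists>r. 0 \<le> r \<and> r \<le> 1 / 2 \<and>
     real ((n + 1) ^ k) * (2 * exp (- (real (n - 1) * lam q N0 n * r\<^sup>2 / (4 * real k))) + 12 * real (n - 1) * r ^ Suc K)
       \<le> 1 / (16 * real (n + 1)))"
proof -
  define a where "a = q * (k + 1)"
  define d where "d = a + q + 1"
  obtain x0 where x0: "\<And>x :: real. x \<ge> x0 \<Longrightarrow>
     16 * (x + 1) ^ a * (2 * exp (- (sqrt x / (12 * real k))) + 12 * (x + 1) ^ q * (1 / x) ^ d) \<le> 1"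
    using tv_bound_eventually[OF k, of a q] unfolding eventually_at_top_linorder d_def by blast
  define \<rho>0 where "\<rho>0 = max 16 (nat \<lceil>x0\<rceil>)"
  show ?thesis
  proof (rule exI[of _ "4 * d - 1"], rule exI[of _ "max 2 ((\<rho>0 + 1) ^ q)"], intro allI impI)
    fix N0 K n assume K: "K \<ge> 4 * d - 1" and n0: "n \<ge> N0" and n1: "n \<ge> max 2 ((\<rho>0 + 1) ^ q)"
    define \<rho> where "\<rho> = rt q n"
    note rt = rt_bounds[OF q, of n, folded \<rho>_def]
    have rho: "\<rho> \<ge> \<rho>0"
    proof (rule ccontr)
      assume "\<not> \<rho> \<ge> \<rho>0"
      then have "(\<rho> + 1) ^ q \<le> (\<rho>0 + 1) ^ q" by (intro power_mono) auto
      then show False using rt(2) n1 by simp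
    qed
    define x where "x = real \<rho>"
    have x: "x \<ge> 16" "x \<ge> x0" using rho by (auto simp: x_def \<rho>0_def)
    define r where "r = 1 / sqrt (sqrt x)"
    have r2: "r\<^sup>2 = 1 / sqrt x" using x by (simp add: r_def power_divide)
    have "r ^ 4 = (r\<^sup>2)\<^sup>2" by simp
    then have r4: "r ^ 4 = 1 / x" unfolding r2 using x by (simp add: power_divide)
    have r0: "0 \<le> r" using x by (simp add: r_def)
    have "r ^ 4 \<le> (1 / 2) ^ 4" unfolding r4 using x by (simp add: field_simps)
    then have r12: "r \<le> 1 / 2" using r0 power_mono_iff[of r "1 / 2" 4] by simp
    have "r ^ Suc K \<le> r ^ (4 * d)"
      using r0 r12 K by (intro power_decreasing) (auto simp: d_def)
    also have "\<dots> = (1 / x) ^ d" unfolding power_mult r4 ..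
    finally have rK: "r ^ Suc K \<le> (1 / x) ^ d" .
    have "n \<ge> 2" using n1 by simp
    then have "3 * (n - 1) \<ge> n + 1" by linarith
    then have "real (n + 1) \<le> 3 * real (n - 1)" by linarith
    then have "1 / 3 \<le> real (n - 1) / real (n + 1)" by (simp add: field_simps)
    then have "x / 3 \<le> real (n - 1) * lam q N0 n"
      using n0 mult_right_mono[of "1 / 3" "real (n - 1) / real (n + 1)" x] x
      by (simp add: lam_def x_def \<rho>_def)
    then have "x / 3 * r\<^sup>2 / (4 * real k) \<le> real (n - 1) * lam q N0 n * r\<^sup>2 / (4 * real k)"
      by (intro divide_right_mono mult_right_mono) auto
    moreover have "x / 3 * r\<^sup>2 / (4 * real k) = sqrt x / (12 * real k)"
    proof -
      have "x / 3 * r\<^sup>2 / (4 * real k) = (x / sqrt x) / (12 * real k)" unfolding r2 by simp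
      also have "x / sqrt x = sqrt x" using x by (simp add: real_div_sqrt)
      finally show ?thesis .
    qed
    ultimately have ex: "exp (- (real (n - 1) * lam q N0 n * r\<^sup>2 / (4 * real k))) \<le> exp (- (sqrt x / (12 * real k)))"
      by (simp only: exp_le_cancel_iff neg_le_iff_le)
    have N: "real (n + 1) \<le> (x + 1) ^ q"
    proof -
      have "real (n + 1) \<le> real ((\<rho> + 1) ^ q)" using rt(2) by (intro of_nat_mono) simp
      then show ?thesis by (simp add: x_def add.commute)
    qed
    have "16 * real (n + 1) * (real ((n + 1) ^ k) * (2 * exp (- (real (n - 1) * lam q N0 n * r\<^sup>2 / (4 * real k))) + 12 * real (n - 1) * r ^ Suc K))
       = 16 * real (n + 1) ^ (k + 1) * (2 * exp (- (real (n - 1) * lam q N0 n * r\<^sup>2 / (4 * real k))) + 12 * real (n - 1) * r ^ Suc K)"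
      by simp
    also have "\<dots> \<le> 16 * (x + 1) ^ a * (2 * exp (- (sqrt x / (12 * real k))) + 12 * (x + 1) ^ q * (1 / x) ^ d)"
    proof (intro mult_mono add_mono mult_nonneg_nonneg add_nonneg_nonneg order_refl)
      have "real (n + 1) ^ (k + 1) \<le> ((x + 1) ^ q) ^ (k + 1)" using N by (intro power_mono) auto
      then show "real (n + 1) ^ (k + 1) \<le> (x + 1) ^ a" by (simp only: a_def power_mult)
      show "real (n - 1) \<le> (x + 1) ^ q" using N by linarith
    qed (use ex rK r0 x in auto)
    also have "\<dots> \<le> 1" by (rule x0[OF x(2)])
    finally have "real ((n + 1) ^ k) * (2 * exp (- (real (n - 1) * lam q N0 n * r\<^sup>2 / (4 * real k))) + 12 * real (n - 1) * r ^ Suc K)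
       \<le> 1 / (16 * real (n + 1))"
      by (simp add: field_simps)
    with r0 r12 show "\<exists>r. 0 \<le> r \<and> r \<le> 1 / 2 \<and>
      real ((n + 1) ^ k) * (2 * exp (- (real (n - 1) * lam q N0 n * r\<^sup>2 / (4 * real k))) + 12 * real (n - 1) * r ^ Suc K)
       \<le> 1 / (16 * real (n + 1))" by blast
  qed
qed

text \<open>With 1/q below \<delta> both summands vanish against \<open>n^(\<delta> - 1)\<close>.
  For \<open>n < N0\<close> the noise is 0 and \<open>3 / (8 * (n + 1)) \<le> 1 / n\<close>
  suffices.\<close>

lemma target_bound:
  fixes \<delta> :: real
  assumes d: "\<delta> > 0"
  shows "\<exists>q N1. q \<ge> 1 \<and> (\<forall>N0 n. N0 \<ge> N1 \<longrightarrow> n \<ge> 1 \<longrightarrow> lam q N0 n + 3 / (8 * real (n + 1)) \<le> 1 / real n powr (1 - \<delta>))"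
proof -
  obtain q where q: "q > 0" "inverse (real q) < \<delta>" using reals_Archimedean[OF d] by (metis zero_less_Suc)
  define s where "s = inverse (real q)"
  define g where "g = \<delta> - s"
  have g: "g > 0" using q by (simp add: g_def s_def)
  have "((\<lambda>x :: real. (x + 1) powr s / (x + 1) * x powr (1 - (s + g)) + 3 / (8 * (x + 1)) * x powr (1 - (s + g))) \<longlongrightarrow> 0) at_top"
  proof -
    have "s > 0" using q by (simp add: s_def)
    then show ?thesis using g by real_asymp
  qed
  then have "eventually (\<lambda>x :: real. (x + 1) powr s / (x + 1) * x powr (1 - (s + g)) + 3 / (8 * (x + 1)) * x powr (1 - (s + g)) < 1) at_top"
    by (rule order_tendstoD) simp
  then obtain x0 where x0: "\<And>x :: real. x \<ge> x0 \<Longrightarrow>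
     (x + 1) powr s / (x + 1) * x powr (1 - \<delta>) + 3 / (8 * (x + 1)) * x powr (1 - \<delta>) < 1"
    unfolding eventually_at_top_linorder by (auto simp: g_def)
  show ?thesis
  proof (rule exI[of _ q], rule exI[of _ "nat \<lceil>x0\<rceil>"], intro conjI allI impI)
    show "q \<ge> 1" using q by simp
    fix N0 n :: nat assume N0: "N0 \<ge> nat \<lceil>x0\<rceil>" and n: "n \<ge> 1"
    have pos: "real n powr (1 - \<delta>) > 0" using n by simp
    show "lam q N0 n + 3 / (8 * real (n + 1)) \<le> 1 / real n powr (1 - \<delta>)"
    proof (cases "n < N0")
      case True
      have "3 / (8 * real (n + 1)) \<le> 1 / real n" using n by (simp add: field_simps)
      also have "\<dots> \<le> 1 / real n powr (1 - \<delta>)"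
        using n d powr_mono[of "1 - \<delta>" 1 "real n"] by (intro divide_left_mono) auto
      finally show ?thesis using True by (simp add: lam_def)
    next
      case False
      then have "real n \<ge> x0" using N0 by linarith
      note x = x0[OF this]
      have "real (rt q n) = (real (rt q n) ^ q) powr s"
        using q by (cases "rt q n = 0") (auto simp: s_def powr_powr simp flip: powr_realpow)
      also have "\<dots> \<le> (real n + 1) powr s"
      proof (rule powr_mono2)
        have "real (rt q n ^ q) \<le> real (n + 1)" using rt_bounds(1)[of q n] q by (intro of_nat_mono) simp
        then show "real (rt q n) ^ q \<le> real n + 1" by simp
      qed (use q in \<open>auto simp: s_def\<close>)
      finally have "lam q N0 n \<le> (real n + 1) powr s / (real n + 1)"
        using False by (simp add: lam_def divide_right_mono add.commute)
      then have "(lam q N0 n + 3 / (8 * real (n + 1))) * real n powr (1 - \<delta>) \<le>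
        ((real n + 1) powr s / (real n + 1) + 3 / (8 * real (n + 1))) * real n powr (1 - \<delta>)"
        using pos by (intro mult_right_mono add_right_mono) auto
      also have "\<dots> \<le> 1" using x unfolding of_nat_add of_nat_1 distrib_right by simp
      finally show ?thesis using pos by (simp add: le_divide_eq)
    qed
  qed
qed

text \<open>The order of choice matters: \<open>q\<close> from \<delta>, then \<open>N0\<close>,
  then \<open>K\<close> at least \<open>N0\<close>, so that the exact case covers all smaller
  \<open>n\<close>. The thresholds for \<open>K\<close> and \<open>n\<close> are uniform in
  \<open>N0\<close> and \<open>K\<close>, so nothing is circular.\<close>

lemma parameters_exist:
  fixes \<delta> :: real and k :: nat
  assumes "\<delta> > 0" "k \<ge> 1"
  shows "\<exists>q N0 K h. q \<ge> 1 \<and> N0 \<le> K \<and> h \<ge> 2 \<and> 16 * k ^ 3 \<le> 2 ^ (h - 2) \<and>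
    (\<forall>n\<ge>1. lam q N0 n + 3 / (8 * real (n + 1)) \<le> 1 / real n powr (1 - \<delta>)) \<and>
    (\<forall>n\<ge>N0. \<exists>r. 0 \<le> r \<and> r \<le> 1 / 2 \<and>
     real ((n + 1) ^ k) * (2 * exp (- (real (n - 1) * lam q N0 n * r\<^sup>2 / (4 * real k))) + 12 * real (n - 1) * r ^ Suc K)
       \<le> 1 / (16 * real (n + 1)))"
proof -
  obtain q N1 where q: "q \<ge> 1"
    "\<And>N0 n. N0 \<ge> N1 \<Longrightarrow> n \<ge> 1 \<Longrightarrow> lam q N0 n + 3 / (8 * real (n + 1)) \<le> 1 / real n powr (1 - \<delta>)"
    using target_bound[OF assms(1)] by blast
  obtain K1 N2 where K1: "\<forall>N0 K n. K \<ge> K1 \<longrightarrow> n \<ge> N0 \<longrightarrow> n \<ge> N2 \<longrightarrow> (\<exists>r. 0 \<le> r \<and> r \<le> 1 / 2 \<and>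
     real ((n + 1) ^ k) * (2 * exp (- (real (n - 1) * lam q N0 n * r\<^sup>2 / (4 * real k))) + 12 * real (n - 1) * r ^ Suc K)
       \<le> 1 / (16 * real (n + 1)))"
    using tv_bound_large[OF assms(2) q(1)] by blast
  have "16 * k ^ 3 < 2 ^ (16 * k ^ 3)" by (rule less_exp)
  then show ?thesis
    using q K1
    by - (rule exI[of _ q], rule exI[of _ "max N1 N2"], rule exI[of _ "max K1 (max N1 N2)"],
      rule exI[of _ "16 * k ^ 3 + 2"], auto)
qed

section \<open>Numbering the partitions\<close>

fun lcode :: "nat \<Rightarrow> nat list \<Rightarrow> nat" where
  "lcode N [] = 0"
| "lcode N (x # xs) = x * N ^ length xs + lcode N xs"

lemma lcode_less: "(\<And>x. x \<in> set xs \<Longrightarrow> x < N) \<Longrightarrow> lcode N xs < N ^ length xs"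
proof (induction xs)
  case (Cons x xs)
  then show ?case using mixed_radix_less[of x N "lcode N xs" "N ^ length xs"] by simp
qed simp

definition dsum :: "nat \<Rightarrow> nat \<Rightarrow> nat \<Rightarrow> nat" where
  "dsum N k y = (\<Sum>b<k. y div N ^ b mod N)"

lemma dsum_Suc:
  assumes "N > 0"
  shows "dsum N (Suc k) y = y div N ^ k mod N + dsum N k (y mod N ^ k)"
proof -
  have "(y mod N ^ k) div N ^ b mod N = y div N ^ b mod N" if "b < k" for b
  proof -
    define c where "c = k - Suc b"
    have "k = b + Suc c" using that by (simp add: c_def)
    then have k: "N ^ k = N ^ b * (N * N ^ c)" by (simp add: power_add)
    have "(y mod N ^ k) div N ^ b = y div N ^ b mod (N * N ^ c)"
      unfolding k mod_mult2_eq using assms by simp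
    then show ?thesis by (simp add: mod_mod_cancel)
  qed
  then show ?thesis by (simp add: dsum_def)
qed

lemma dsum_lcode:
  assumes "N > 0" "\<And>x. x \<in> set xs \<Longrightarrow> x < N"
  shows "dsum N (length xs) (lcode N xs) = sum_list xs"
  using assms(2)
proof (induction xs)
  case (Cons x xs)
  have "lcode N xs < N ^ length xs" using Cons.prems by (intro lcode_less) auto
  then show ?case using Cons assms(1) by (simp add: dsum_Suc)
qed (simp add: dsum_def)

lemma lcode_surj:
  assumes "N > 0" "y < N ^ k"
  shows "\<exists>xs. length xs = k \<and> (\<forall>x\<in>set xs. x < N) \<and> lcode N xs = y"
  using assms(2)
proof (induction k arbitrary: y)
  case (Suc k)
  obtain xs where xs: "length xs = k" "\<forall>x\<in>set xs. x < N" "lcode N xs = y mod N ^ k"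
    using Suc.IH[of "y mod N ^ k"] assms(1) by auto
  have "y div N ^ k < N" using Suc.prems by (simp add: less_mult_imp_div_less)
  then show ?case using xs by (intro exI[of _ "y div N ^ k # xs"]) (auto simp: div_mult_mod_eq)
qed auto

text \<open>Validity of a code becomes a digit-sum test that terms can perform; \<open>m < N\<close>
  keeps every entry a single digit.\<close>

lemma partitions_codes:
  assumes "m < N"
  shows "{y. y < N ^ k \<and> dsum N k y = m} = lcode N ` partitions k m"
proof (intro set_eqI iffI)
  fix y assume "y \<in> {y. y < N ^ k \<and> dsum N k y = m}"
  then have y: "y < N ^ k" "dsum N k y = m" by auto
  obtain xs where xs: "length xs = k" "\<forall>x\<in>set xs. x < N" "lcode N xs = y"
    using lcode_surj[OF _ y(1)] assms by auto
  then have "sum_list xs = m" using dsum_lcode[of N xs] assms y(2) by auto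
  then show "y \<in> lcode N ` partitions k m" using xs by (auto simp: partitions_def)
next
  fix y assume "y \<in> lcode N ` partitions k m"
  then obtain xs where xs: "length xs = k" "sum_list xs = m" "y = lcode N xs"
    by (auto simp: partitions_def)
  have "x < N" if "x \<in> set xs" for x
    using member_le_sum_list[OF that] xs(2) assms by linarith
  with xs lcode_less[of xs N] dsum_lcode[of N xs] assms show "y \<in> {y. y < N ^ k \<and> dsum N k y = m}" by auto
qed

text \<open>\<open>partition_list\<close> enumerates in lexicographic order, which the codes
  preserve. Hence the position of a partition in the input is the number of valid codes below its
  own, and no list has to be constructed.\<close>

lemma sorted_partition_list:
  "m < N \<Longrightarrow> sorted_wrt (<) (map (lcode N) (partition_list k m))"
proof (induction k arbitrary: m)
  case (Suc k)
  note outer = Suc.IH and m = Suc.prems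
  let ?L = "\<lambda>j. map (\<lambda>xs. j * N ^ k + lcode N xs) (partition_list k (m - j))"
  have len: "length xs = k" "lcode N xs < N ^ k" if "xs \<in> set (partition_list k (m - j))" for xs j
  proof -
    have xs: "length xs = k" "sum_list xs = m - j" using that by (auto simp: set_partition_list partitions_def)
    then show "length xs = k" by simp
    have "x < N" if "x \<in> set xs" for x
      using member_le_sum_list[OF that] xs(2) Suc.prems by linarith
    from lcode_less[of xs N, OF this] show "lcode N xs < N ^ k" using xs by simp
  qed
  \<comment> \<open>Generalised to the first \<open>r\<close> blocks, together with the bound that
    separates them from block \<open>r\<close>.\<close>
  have sorted: "sorted_wrt (<) (concat (map ?L [0..<r])) \<and> (\<forall>y\<in>set (concat (map ?L [0..<r])). y < r * N ^ k)" for r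
  proof (induction r)
    case (Suc r)
    have s: "sorted_wrt (<) (?L r)"
      using outer[of "m - r"] m by (simp add: sorted_wrt_map)
    have hi: "\<forall>y\<in>set (?L r). r * N ^ k \<le> y \<and> y < Suc r * N ^ k"
      using len(2) by auto
    have lo: "sorted_wrt (<) (concat (map ?L [0..<r]))" "\<forall>y\<in>set (concat (map ?L [0..<r])). y < r * N ^ k"
      using Suc by auto
    have eq: "concat (map ?L [0..<Suc r]) = concat (map ?L [0..<r]) @ ?L r" by simp
    have "sorted_wrt (<) (concat (map ?L [0..<r]) @ ?L r)"
      unfolding sorted_wrt_append using s lo hi less_le_trans by blast
    moreover have "\<forall>y\<in>set (concat (map ?L [0..<r]) @ ?L r). y < Suc r * N ^ k"
    proof
      fix y assume "y \<in> set (concat (map ?L [0..<r]) @ ?L r)"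
      then consider "y < r * N ^ k" | "y < Suc r * N ^ k"
        using lo(2) hi unfolding set_append Un_iff by blast
      then show "y < Suc r * N ^ k" by cases auto
    qed
    ultimately show ?case unfolding eq by blast
  qed simp
  have "map (lcode N) (partition_list (Suc k) m) = concat (map ?L [0..<Suc m])"
  proof -
    have *: "map (lcode N) (map ((#) j) (partition_list k (m - j))) = ?L j" for j
      using len(1) by (auto simp: o_def)
    have "map (lcode N) (partition_list (Suc k) m) =
        concat (map (\<lambda>j. map (lcode N) (map ((#) j) (partition_list k (m - j)))) [0..<Suc m])"
      by (simp only: partition_list.simps map_concat map_map o_def)
    then show ?thesis unfolding * .
  qed
  then show ?case using conjunct1[OF sorted[of "Suc m"]] by (simp only:)
qed simp

lemma rank_sorted:
  fixes L :: "nat list"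
  assumes "sorted_wrt (<) L" "j < length L"
  shows "card {y \<in> set L. y < L ! j} = j"
proof -
  have lt: "L ! i < L ! i'" if "i < i'" "i' < length L" for i i'
    using sorted_wrt_nth_less[OF assms(1) that] .
  have "{y \<in> set L. y < L ! j} = (!) L ` {..<j}"
  proof (intro set_eqI iffI)
    fix y assume "y \<in> {y \<in> set L. y < L ! j}"
    then obtain i where i: "i < length L" "y = L ! i" "L ! i < L ! j" by (auto simp: in_set_conv_nth)
    have "i < j"
    proof (rule ccontr)
      assume "\<not> i < j"
      then consider "i = j" | "j < i" by linarith
      then show False using i lt[of j i] by cases auto
    qed
    with i show "y \<in> (!) L ` {..<j}" by auto
  qed (use assms lt in auto)
  moreover have "inj_on ((!) L) {..<j}"
  proof (rule inj_onI)
    fix i i' assume "i \<in> {..<j}" "i' \<in> {..<j}" "L ! i = L ! i'"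
    then show "i = i'" using lt[of i i'] lt[of i' i] assms(2)
      by (cases i i' rule: linorder_cases) auto
  qed
  ultimately show ?thesis by (simp add: card_image)
qed

section \<open>Position of a payoff in the input\<close>

lemma concat_nth_block:
  "(\<And>x. x \<in> set xs \<Longrightarrow> length (f x) = L) \<Longrightarrow> i < length xs \<Longrightarrow> j < L \<Longrightarrow>
    concat (map f xs) ! (i * L + j) = f (xs ! i) ! j"
proof (induction xs arbitrary: i)
  case (Cons x xs)
  then show ?case by (cases i) (auto simp: nth_append)
qed simp

lemma length_concat_block:
  "(\<And>x. x \<in> set xs \<Longrightarrow> length (f x) = L) \<Longrightarrow> length (concat (map f xs)) = length xs * L"
  by (induction xs) auto

lemma payoff_list_nth:
  assumes "i < n" "a < k" "j < length (partition_list k (n - 1))"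
  shows "payoff_list n k u ! ((i * k + a) * length (partition_list k (n - 1)) + j) =
     u i a (partition_list k (n - 1) ! j)"
proof -
  let ?P = "partition_list k (n - 1)"
  let ?L = "length ?P"
  let ?g = "\<lambda>i a. map (\<lambda>x. u i a x) ?P"
  have len: "length (concat (map (?g i) [0..<k])) = k * ?L" for i
    by (subst length_concat_block[of _ _ ?L]) auto
  have pl: "payoff_list n k u = concat (map (\<lambda>i. concat (map (?g i) [0..<k])) [0..<n])"
    unfolding payoff_list_def by (simp add: concat_map_singleton)
  have "a * ?L + j < k * ?L" using assms(2,3) by (rule mixed_radix_less)
  then have "payoff_list n k u ! (i * (k * ?L) + (a * ?L + j)) = concat (map (?g i) [0..<k]) ! (a * ?L + j)"
    unfolding pl using assms(1) len by (subst concat_nth_block[of _ _ "k * ?L"]) auto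
  also have "\<dots> = u i a (?P ! j)"
    using assms(2,3) by (subst concat_nth_block[of _ _ ?L]) auto
  finally show ?thesis by (simp add: algebra_simps)
qed

lemma length_payoff_list: "length (payoff_list n k u) = n * (k * length (partition_list k (n - 1)))"
proof -
  let ?P = "partition_list k (n - 1)"
  have len: "length (concat (map (\<lambda>a. map (\<lambda>x. u i a x) ?P) [0..<k])) = k * length ?P" for i
    by (subst length_concat_block[of _ _ "length ?P"]) auto
  have "payoff_list n k u = concat (map (\<lambda>i. concat (map (\<lambda>a. map (\<lambda>x. u i a x) ?P) [0..<k])) [0..<n])"
    unfolding payoff_list_def by (simp add: concat_map_singleton)
  then show ?thesis using len by (simp add: length_concat_block)
qed

section \<open>Digits, weights and finite distributions\<close>

lemma law_cong:
  "(\<And>j b. j \<in> set js \<Longrightarrow> b < k \<Longrightarrow> s j b = s' j b) \<Longrightarrow> law k e (map s js) y = law k e (map s' js) y"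
  by (induction js arbitrary: y) (auto intro!: sum.cong)

lemma digit_of_sum:
  fixes B :: nat
  shows "(\<And>b. b < k \<Longrightarrow> Y b < B) \<Longrightarrow> j < k \<Longrightarrow> (\<Sum>b<k. Y b * B ^ b) div B ^ j mod B = Y j"
proof (induction k arbitrary: Y j)
  case (Suc k)
  have split: "(\<Sum>b<Suc k. Y b * B ^ b) = Y 0 + B * (\<Sum>b<k. Y (Suc b) * B ^ b)"
    unfolding sum.lessThan_Suc_shift by (simp add: sum_distrib_left mult_ac)
  have Y0: "Y 0 < B" using Suc.prems by simp
  show ?case
  proof (cases j)
    case 0
    then show ?thesis unfolding split using Y0 by simp
  next
    case (Suc j')
    have "(Y 0 + B * (\<Sum>b<k. Y (Suc b) * B ^ b)) div B ^ Suc j' = (\<Sum>b<k. Y (Suc b) * B ^ b) div B ^ j'"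
      using Y0 by (simp add: div_mult2_eq)
    then show ?thesis unfolding split Suc using Suc.IH[of "\<lambda>b. Y (Suc b)" j'] Suc.prems Suc by simp
  qed
qed simp

lemma sum_digits_less:
  fixes B :: nat
  shows "(\<And>b. b < k \<Longrightarrow> Y b < B) \<Longrightarrow> (\<Sum>b<k. Y b * B ^ b) < B ^ k"
proof (induction k)
  case (Suc k)
  then show ?case using mixed_radix_less[of "Y k" B "\<Sum>b<k. Y b * B ^ b" "B ^ k"] by (simp add: add.commute)
qed simp

lemma weight_less:
  fixes k K B M :: nat
  assumes "k \<ge> 1" "B \<ge> 1" "(\<Sum>b<k. Y b) = M"
  shows "weight k K B Y \<le> M ^ K * B ^ (k * (\<Sum>l<K. k ^ l))"
proof -
  have "weight k K B Y \<le> (\<Prod>l<K. M * B ^ (k * k ^ l))"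
    unfolding weight_def
  proof (intro prod_mono conjI)
    fix l
    have "(\<Sum>b<k. Y b * B ^ (b * k ^ l)) \<le> (\<Sum>b<k. Y b * B ^ (k * k ^ l))"
      using assms(2) by (intro sum_mono mult_left_mono power_increasing mult_right_mono) auto
    then show "(\<Sum>b<k. Y b * B ^ (b * k ^ l)) \<le> M * B ^ (k * k ^ l)"
      using assms(3) by (simp flip: sum_distrib_right)
  qed simp
  also have "\<dots> = M ^ K * B ^ (k * (\<Sum>l<K. k ^ l))"
    by (simp add: prod.distrib power_sum sum_distrib_left)
  finally show ?thesis .
qed

lemma stoch_pmf:
  assumes "stoch k s"
  shows "\<exists>p. set_pmf p \<subseteq> {..<k} \<and> (\<forall>a<k. pmf p a = s a)"
proof -
  let ?s = "\<lambda>a. if a < k then s a else 0"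
  have nn: "0 \<le> ?s a" for a using assms by (auto simp: stoch_def)
  have "(\<integral>\<^sup>+ a. ennreal (?s a) \<partial>count_space UNIV) = (\<Sum>a<k. ennreal (?s a))"
    by (rule nn_integral_count_space') auto
  also have "\<dots> = ennreal (\<Sum>a<k. ?s a)" by (rule sum_ennreal) (rule nn)
  also have "(\<Sum>a<k. ?s a) = 1" using assms by (simp add: stoch_def)
  finally have "(\<integral>\<^sup>+ a. ennreal (?s a) \<partial>count_space UNIV) = 1" by simp
  from pmf_embed_pmf[OF nn this] have p: "pmf (embed_pmf ?s) a = ?s a" for a .
  have "set_pmf (embed_pmf ?s) \<subseteq> {..<k}"
    using p by (auto simp: set_pmf_eq)
  with p show ?thesis by auto
qed

text \<open>The code is additive: a player who chooses \<open>b\<close> adds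
  \<open>N ^ (k - 1 - b)\<close>. This turns the random partition into the sum described by
  \<open>law\<close>.\<close>

lemma lcode_partition_of:
  assumes J: "finite J" "\<And>j. j \<in> J \<Longrightarrow> f j < k"
  shows "lcode N (partition_of k J f) = (\<Sum>j\<in>J. N ^ (k - 1 - f j))"
    and "sum_list (partition_of k J f) = card J"
proof -
  have lc: "lcode N (map g [a..<k]) = (\<Sum>b\<in>{a..<k}. g b * N ^ (k - 1 - b))" if "a \<le> k" for g a
    using that
  proof (induction "k - a" arbitrary: a)
    case (Suc d)
    then have "[a..<k] = a # [Suc a..<k]" "{a..<k} = insert a {Suc a..<k}" by (auto simp: upt_conv_Cons)
    with Suc show ?case by simp
  qed simp
  have "lcode N (partition_of k J f) = (\<Sum>b<k. card {j \<in> J. f j = b} * N ^ (k - 1 - b))"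
    unfolding partition_of_def using lc[of 0] by (simp add: atLeast0LessThan)
  also have "\<dots> = (\<Sum>b<k. \<Sum>j | j \<in> J \<and> f j = b. N ^ (k - 1 - f j))"
    by (intro sum.cong refl) simp
  also have "\<dots> = (\<Sum>j\<in>J. N ^ (k - 1 - f j))"
    using J by (intro sum.group) auto
  finally show "lcode N (partition_of k J f) = (\<Sum>j\<in>J. N ^ (k - 1 - f j))" .
  have "sum_list (partition_of k J f) = (\<Sum>b<k. card {j \<in> J. f j = b})"
    by (simp add: partition_of_def interv_sum_list_conv_sum_set_nat atLeast0LessThan)
  also have "\<dots> = (\<Sum>b<k. \<Sum>j | j \<in> J \<and> f j = b. 1)" by simp
  also have "\<dots> = (\<Sum>j\<in>J. 1)" using J by (intro sum.group) auto
  finally show "sum_list (partition_of k J f) = card J" by simp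
qed

lemma expectation_pair_pmf:
  fixes f :: "'a \<Rightarrow> nat \<Rightarrow> real"
  assumes "finite (set_pmf A)" "set_pmf B \<subseteq> {..<k}"
  shows "measure_pmf.expectation (pair_pmf A B) (\<lambda>(x, a). f x a) =
     (\<Sum>a<k. pmf B a * measure_pmf.expectation A (\<lambda>x. f x a))"
proof -
  have "pair_pmf A B = B \<bind> (\<lambda>b. map_pmf (\<lambda>x. (x, b)) A)"
    by (subst pair_commute_pmf) (simp add: pair_pmf_def map_bind_pmf map_pmf_def bind_assoc_pmf bind_return_pmf)
  then show ?thesis
    using assms by (simp add: pmf_expectation_bind[of "{..<k}"])
qed

section \<open>Correctness of the search\<close>

text \<open>The parameters depend on \<delta> and \<open>k\<close> only, never on \<open>n\<close>
  or the payoffs, so they may be constants of the program.\<close>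

locale scheme =
  fixes k q N0 K h :: nat and \<delta> :: real
  assumes k: "k \<ge> 1" and q: "q \<ge> 1" and N0: "N0 \<le> K" and h: "h \<ge> 2" "16 * k ^ 3 \<le> 2 ^ (h - 2)"
    and target: "\<And>n. n \<ge> 1 \<Longrightarrow> lam q N0 n + 3 / (8 * real (n + 1)) \<le> 1 / real n powr (1 - \<delta>)"
    and large: "\<And>n. n \<ge> N0 \<Longrightarrow> \<exists>r. 0 \<le> r \<and> r \<le> 1 / 2 \<and>
     real ((n + 1) ^ k) * (2 * exp (- (real (n - 1) * lam q N0 n * r\<^sup>2 / (4 * real k))) + 12 * real (n - 1) * r ^ Suc K)
       \<le> 1 / (16 * real (n + 1))"
begin

text \<open>
  A strategy \<open>c\<close> is coded by its probabilities in units of \<open>1 / M n\<close>, the digits of \<open>c\<close> in base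
  \<open>(n + 1) ^ bd\<close>.  A partition \<open>x\<close> is coded by \<open>y\<close> with digits \<open>x\<close> in base \<open>n + 1\<close>, most significant
  first, so that the numerical order of codes is the order of the payoffs in the input.
\<close>

definition m0 :: nat where "m0 = h * (k - 1)"
text \<open>This is \<open>H ^ (k - 1)\<close> for the stick-breaking grid with
  \<open>H = (n + 1) ^ h\<close>.\<close>

definition M :: "nat \<Rightarrow> nat" where "M n = (n + 1) ^ m0"
text \<open>One more than \<open>m0\<close>, so that a digit can take the value \<open>M n\<close>
  itself.\<close>

definition bd :: nat where "bd = m0 + 1"
definition dig :: "nat \<Rightarrow> nat \<Rightarrow> nat \<Rightarrow> nat" where "dig n c b = c div (n + 1) ^ (bd * b) mod (n + 1) ^ bd"
definition V :: "nat \<Rightarrow> nat \<Rightarrow> bool" where "V n c \<longleftrightarrow> (\<Sum>b<k. dig n c b) = M n"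
definition gE :: nat where "gE = bd * k"
text \<open>\<open>(n + 1) ^ bE\<close> equals \<open>(n + 1) * M n ^ K\<close> and exceeds every
  moment of at most \<open>n\<close> strategies, as needed to exclude carries.\<close>

definition bE :: nat where "bE = m0 * K + 1"
definition wt :: "nat \<Rightarrow> nat \<Rightarrow> nat" where "wt n c = weight k K ((n + 1) ^ bE) (dig n c)"
definition wE :: nat where "wE = m0 * K + 1 + bE * (k * (\<Sum>l<K. k ^ l))"
definition st :: "nat \<Rightarrow> nat \<Rightarrow> nat \<Rightarrow> real" where "st n c = noisy k (lam q N0 n) (M n) (dig n c)"
definition enc :: "nat \<Rightarrow> nat \<Rightarrow> nat" where "enc n b = (n + 1) ^ (k - 1 - b)"
text \<open>The 1/4 consists of 1/8 for the grid and twice 1/16 for replacing laws by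
  averages.\<close>

definition thr :: "nat \<Rightarrow> real" where "thr n = lam q N0 n + 1 / (4 * real (n + 1))"
definition validy :: "nat \<Rightarrow> nat \<Rightarrow> bool" where "validy n y \<longleftrightarrow> dsum (n + 1) k y = n - 1"
definition rank :: "nat \<Rightarrow> nat \<Rightarrow> nat" where
  "rank n y = (\<Sum>y'<(n + 1) ^ k. if y' < y \<and> validy n y' then 1 else 0)"
definition np :: "nat \<Rightarrow> nat" where "np n = (\<Sum>y<(n + 1) ^ k. if validy n y then 1 else 0)"
definition pay :: "nat \<Rightarrow> payoffs \<Rightarrow> nat \<Rightarrow> nat \<Rightarrow> nat \<Rightarrow> real" where
  "pay n u i a y = (if y < (n + 1) ^ k \<and> validy n y then payoff_list n k u ! ((i * k + a) * np n + rank n y) else 0)"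

section \<open>Payoffs as a function of codes\<close>

lemma codes:
  assumes n: "n \<ge> 1"
  shows "{y. y < (n + 1) ^ k \<and> validy n y} = set (map (lcode (n + 1)) (partition_list k (n - 1)))"
  using partitions_codes[of "n - 1" "n + 1" k] n by (simp add: validy_def set_partition_list)

lemma np: "n \<ge> 1 \<Longrightarrow> np n = length (partition_list k (n - 1))"
proof -
  assume n: "n \<ge> 1"
  have "np n = card {y \<in> {..<(n + 1) ^ k}. validy n y}"
    unfolding np_def card_eq_sum by (rule sum.inter_filter[symmetric]) simp
  also have "{y \<in> {..<(n + 1) ^ k}. validy n y} = set (map (lcode (n + 1)) (partition_list k (n - 1)))"
    using codes[OF n] by auto
  also have "card \<dots> = length (map (lcode (n + 1)) (partition_list k (n - 1)))"
    using sorted_partition_list[of "n - 1" "n + 1" k] n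
    by (intro distinct_card) (simp add: strict_sorted_iff)
  finally show ?thesis by simp
qed

lemma rank_less_np: "y < (n + 1) ^ k \<Longrightarrow> validy n y \<Longrightarrow> rank n y < np n"
  unfolding rank_def np_def by (rule sum_strict_mono_ex1) auto

lemma rank_code:
  assumes n: "n \<ge> 1" and j: "j < length (partition_list k (n - 1))"
  shows "rank n (lcode (n + 1) (partition_list k (n - 1) ! j)) = j"
proof -
  let ?L = "map (lcode (n + 1)) (partition_list k (n - 1))"
  let ?y = "lcode (n + 1) (partition_list k (n - 1) ! j)"
  have "rank n ?y = card {y \<in> {..<(n + 1) ^ k}. y < ?y \<and> validy n y}"
    unfolding rank_def card_eq_sum by (rule sum.inter_filter[symmetric]) simp
  also have "{y \<in> {..<(n + 1) ^ k}. y < ?y \<and> validy n y} = {y \<in> set ?L. y < ?L ! j}"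
    using codes[OF n] j by auto
  also have "card \<dots> = j"
    using j n by (intro rank_sorted sorted_partition_list) auto
  finally show ?thesis .
qed

lemma pay_code:
  assumes n: "n \<ge> 1" and i: "i < n" and a: "a < k" and x: "x \<in> partitions k (n - 1)"
  shows "pay n u i a (lcode (n + 1) x) = u i a x"
proof -
  obtain j where j: "j < length (partition_list k (n - 1))" "x = partition_list k (n - 1) ! j"
    using x by (metis in_set_conv_nth set_partition_list)
  have "lcode (n + 1) x \<in> {y. y < (n + 1) ^ k \<and> validy n y}"
    unfolding codes[OF n] using x by (simp add: set_partition_list)
  then show ?thesis
    using payoff_list_nth[OF i a j(1), of u] rank_code[OF n j(1)] np[OF n] j(2) by (simp add: pay_def)
qed

lemma pay_bounds:
  assumes n: "n \<ge> 1" and g: "anonymous_game n k u" and i: "i < n" and a: "a < k"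
  shows "0 \<le> pay n u i a y \<and> pay n u i a y \<le> 1"
proof (cases "y < (n + 1) ^ k \<and> validy n y")
  case True
  then obtain x where x: "x \<in> partitions k (n - 1)" "y = lcode (n + 1) x"
    using codes[OF n] by (auto simp: set_partition_list)
  then show ?thesis using pay_code[OF n i a x(1), of u] g i a by (auto simp: anonymous_game_def)
next
  case False
  then show ?thesis by (simp only: pay_def if_False) simp
qed

section \<open>Size bounds for codes, digits and weights\<close>

lemma enc_le: "b < k \<Longrightarrow> enc n b \<le> (n + 1) ^ (k - 1)"
  by (simp add: enc_def power_increasing)

lemma size_bound: "(m :: nat) \<le> n \<Longrightarrow> m * (n + 1) ^ (k - 1) < (n + 1) ^ k"
proof -
  assume "m \<le> n"
  then have "m < n + 1" by simp
  from mult_strict_right_mono[OF this, of "(n + 1) ^ (k - 1)"]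
  have "m * (n + 1) ^ (k - 1) < (n + 1) * (n + 1) ^ (k - 1)" by simp
  also have "\<dots> = (n + 1) ^ k" using k by (metis power_eq_if not_one_le_zero)
  finally show ?thesis .
qed

lemma M_pos: "M n > 0" by (simp add: M_def)

lemma lam01: "0 \<le> lam q N0 n" "lam q N0 n \<le> 1"
  using lam_bounds[OF q, of N0 n] by auto

lemma stoch_st: "V n c \<Longrightarrow> stoch k (st n c)"
  unfolding st_def V_def using k M_pos lam01 by (intro stoch_noisy) auto

lemma moments_bound: "m \<le> n \<Longrightarrow> m * M n ^ K < (n + 1) ^ bE"
proof -
  assume "m \<le> n"
  then have "m * M n ^ K < (n + 1) * M n ^ K"
    by (intro mult_strict_right_mono) (auto simp: M_def)
  also have "\<dots> = (n + 1) ^ bE" by (simp add: M_def bE_def power_mult)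
  finally show ?thesis .
qed

lemma wt_bound: "V n c \<Longrightarrow> n * wt n c < (n + 1) ^ wE"
proof -
  assume c: "V n c"
  let ?s = "k * (\<Sum>l<K. k ^ l)"
  have "wt n c \<le> M n ^ K * ((n + 1) ^ bE) ^ ?s"
    unfolding wt_def using c k by (intro weight_less) (auto simp: V_def)
  then have "n * wt n c \<le> n * (M n ^ K * ((n + 1) ^ bE) ^ ?s)" by simp
  also have "\<dots> < (n + 1) * (M n ^ K * ((n + 1) ^ bE) ^ ?s)" using M_pos by simp
  also have "\<dots> = (n + 1) ^ wE" by (simp add: M_def wE_def power_mult power_add)
  finally show ?thesis .
qed

lemma code_exists:
  assumes n: "n \<ge> 1" and Y: "(\<Sum>b<k. Y b) = M n"
  shows "\<exists>c<(n + 1) ^ gE. \<forall>b<k. dig n c b = Y b"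
proof -
  let ?B = "(n + 1) ^ bd"
  have lt: "Y b < ?B" if "b < k" for b
  proof -
    have "Y b \<le> M n" using that Y member_le_sum[of b "{..<k}" Y] by simp
    also have "M n < ?B" unfolding M_def bd_def using n by (intro power_strict_increasing) auto
    finally show ?thesis .
  qed
  show ?thesis
  proof (intro exI[of _ "\<Sum>b<k. Y b * ?B ^ b"] conjI allI impI)
    show "(\<Sum>b<k. Y b * ?B ^ b) < (n + 1) ^ gE"
      using sum_digits_less[of k Y ?B, OF lt] by (simp add: gE_def power_mult)
    fix b assume "b < k"
    then show "dig n (\<Sum>b<k. Y b * ?B ^ b) b = Y b"
      using digit_of_sum[of k Y ?B b, OF lt] by (simp add: dig_def power_mult)
  qed
qed

lemma codes_close:
  assumes n: "n \<ge> 1"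
    and cs: "set cs \<subseteq> Collect (V n)" "set cs' \<subseteq> Collect (V n)" "length cs = n - 1" "length cs' = n - 1"
    and w: "(\<Sum>c\<leftarrow>cs. wt n c) = (\<Sum>c\<leftarrow>cs'. wt n c)" and f: "\<And>y. \<bar>f y\<bar> \<le> 1"
  shows "\<bar>(\<Sum>y<(n + 1) ^ k. law k (enc n) (map (st n) cs) y * f y) -
     (\<Sum>y<(n + 1) ^ k. law k (enc n) (map (st n) cs') y * f y)\<bar> \<le> 1 / (16 * real (n + 1))"
proof -
  interpret E: equal_weights k K "(n + 1) ^ bE" "M n" "n - 1" "(n + 1) ^ k" "(n + 1) ^ (k - 1)" "enc n" "lam q N0 n"
    "map (dig n) cs" "map (dig n) cs'"
  proof
    show "(\<Sum>Y\<leftarrow>map (dig n) cs. weight k K ((n + 1) ^ bE) Y) = (\<Sum>Y\<leftarrow>map (dig n) cs'. weight k K ((n + 1) ^ bE) Y)"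
      using w by (simp add: wt_def o_def)
    show "(n - 1) * M n ^ K < (n + 1) ^ bE" by (rule moments_bound) simp
    show "(n - 1) * (n + 1) ^ (k - 1) < (n + 1) ^ k" by (rule size_bound) simp
  qed (use k M_pos lam01 cs enc_le in \<open>auto simp: V_def\<close>)
  have st: "map (st n) xs = map (noisy k (lam q N0 n) (M n)) (map (dig n) xs)" for xs
    by (simp add: st_def o_def)
  show ?thesis
  proof (cases "n < N0")
    case True
    then show ?thesis unfolding st using E.law_eq_small[of f] N0 by simp
  next
    case False
    then obtain r where r: "0 \<le> r" "r \<le> 1 / 2"
      "real ((n + 1) ^ k) * (2 * exp (- (real (n - 1) * lam q N0 n * r\<^sup>2 / (4 * real k))) + 12 * real (n - 1) * r ^ Suc K)
       \<le> 1 / (16 * real (n + 1))" using large[of n] by auto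
    show ?thesis unfolding st using E.law_close_large[where f = f, OF r(1,2) f] r(3) by linarith
  qed
qed

text \<open>The grid theorem is applied to payoffs against opponents that are already noisy, so
  their noise does not disturb the equilibrium. Adding noise to the player's own strategy costs at
  most \<theta>, since payoffs lie between 0 and 1. The Lipschitz constant is
  \<open>n\<close>.\<close>

lemma equilibrium_exists:
  assumes n: "n \<ge> 1" and g: "anonymous_game n k u"
  shows "\<exists>cf. (\<forall>i<n. V n (cf i) \<and> cf i < (n + 1) ^ gE) \<and> (\<forall>i<n. \<forall>a<k.
        (\<Sum>y<(n + 1) ^ k. law k (enc n) (map (\<lambda>j. st n (cf j)) (other_list n i)) y * pay n u i a y) \<le>
        (\<Sum>b<k. st n (cf i) b * (\<Sum>y<(n + 1) ^ k. law k (enc n) (map (\<lambda>j. st n (cf j)) (other_list n i)) y * pay n u i b y))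
          + (lam q N0 n + 1 / (8 * real (n + 1))))"
proof -
  let ?\<theta> = "lam q N0 n"
  let ?D = "(n + 1) ^ k"
  define nz where "nz s b = (1 - ?\<theta>) * s b + ?\<theta> / real k" for s and b :: nat
  define U where "U i a y = (if i < n \<and> a < k then \<Sum>x<?D. law k (enc n) (map (\<lambda>j. nz (y j)) (other_list n i)) x * pay n u i a x else 0)"
    for i a and y :: "nat \<Rightarrow> nat \<Rightarrow> real"
  have st_nz: "stoch k (nz s)" if "stoch k s" for s
    using that lam01 k by (auto simp: stoch_def nz_def sum.distrib simp flip: sum_distrib_left)
  have size: "length (map g (other_list n i)) * (n + 1) ^ (k - 1) < ?D" if "i < n" for i and g :: "nat \<Rightarrow> nat \<Rightarrow> real"
    using that size_bound[of "n - 1" n] by (simp add: length_other_list)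
  have U01: "0 \<le> U i a y \<and> U i a y \<le> 1" if "\<And>j. j < n \<Longrightarrow> stoch k (y j)" "i < n" for i a y
  proof (cases "a < k")
    case a: True
    let ?ss = "map (\<lambda>j. nz (y j)) (other_list n i)"
    have ss: "stoch k s" if "s \<in> set ?ss" for s
      using that \<open>\<And>j. j < n \<Longrightarrow> stoch k (y j)\<close> by (auto simp: other_list intro!: st_nz)
    have pb: "0 \<le> pay n u i a x" "\<bar>pay n u i a x\<bar> \<le> 1" for x
      using pay_bounds[OF n g \<open>i < n\<close> a, of x] by auto
    have "\<bar>\<Sum>x<?D. law k (enc n) ?ss x * pay n u i a x\<bar> \<le> 1"
      by (rule law_expectation_bound[OF enc_le size[OF \<open>i < n\<close>] ss pb(2)])
    moreover have "0 \<le> (\<Sum>x<?D. law k (enc n) ?ss x * pay n u i a x)"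
      using ss pb(1) by (intro sum_nonneg mult_nonneg_nonneg law_nonneg) (auto simp: stoch_def)
    ultimately show ?thesis using a \<open>i < n\<close> by (simp add: U_def)
  qed (simp add: U_def)
  have lip: "\<bar>U i a y - U i a y'\<bar> \<le> real n * \<epsilon>"
    if y: "\<And>j. j < n \<Longrightarrow> stoch k (y j) \<and> stoch k (y' j) \<and> (\<Sum>b<k. \<bar>y j b - y' j b\<bar>) \<le> \<epsilon>" and i: "i < n" for i a y y' \<epsilon>
  proof (cases "a < k")
    case a: True
    have eps: "0 \<le> \<epsilon>" using y[OF i] by (meson abs_ge_zero order_trans sum_nonneg)
    have nzd: "(\<Sum>b<k. \<bar>nz (y j) b - nz (y' j) b\<bar>) \<le> \<epsilon>" if "j < n" for j
    proof -
      have "(\<Sum>b<k. \<bar>nz (y j) b - nz (y' j) b\<bar>) = (\<Sum>b<k. (1 - ?\<theta>) * \<bar>y j b - y' j b\<bar>)"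
        using lam01 by (intro sum.cong refl) (simp add: nz_def abs_mult flip: right_diff_distrib)
      also have "\<dots> \<le> (\<Sum>b<k. 1 * \<bar>y j b - y' j b\<bar>)"
        using lam01 by (intro sum_mono mult_right_mono) auto
      finally show ?thesis using y[OF that] by simp
    qed
    have "\<bar>(\<Sum>x<?D. law k (enc n) (map (\<lambda>j. nz (y j)) (other_list n i)) x * pay n u i a x) -
       (\<Sum>x<?D. law k (enc n) (map (\<lambda>j. nz (y' j)) (other_list n i)) x * pay n u i a x)\<bar>
       \<le> real (length (map (\<lambda>j. nz (y j)) (other_list n i))) * \<epsilon>"
    proof (rule law_lipschitz[OF enc_le _ size[OF i]])
      show "list_all2 (\<lambda>s s'. stoch k s \<and> stoch k s' \<and> (\<Sum>b<k. \<bar>s b - s' b\<bar>) \<le> \<epsilon>)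
        (map (\<lambda>j. nz (y j)) (other_list n i)) (map (\<lambda>j. nz (y' j)) (other_list n i))"
        using y nzd by (auto simp: list_all2_map1 list_all2_map2 other_list intro!: list.rel_refl_strong st_nz)
      show "\<bar>pay n u i a x\<bar> \<le> 1" for x using pay_bounds[OF n g i a, of x] by auto
    qed
    also have "\<dots> \<le> real n * \<epsilon>" using i eps by (intro mult_right_mono) (auto simp: length_other_list)
    finally show ?thesis using a i by (simp add: U_def)
  next
    case False
    have "0 \<le> \<epsilon>" using y[OF i] by (meson abs_ge_zero order_trans sum_nonneg)
    with False show ?thesis by (simp add: U_def)
  qed
  have H1: "(n + 1) ^ h \<ge> 1" by simp
  have MH: "((n + 1) ^ h) ^ (k - 1) = M n" by (simp add: M_def m0_def power_mult)
  have "\<exists>Y :: nat \<Rightarrow> nat \<Rightarrow> nat. (\<forall>i<n. (\<Sum>b<k. Y i b) = ((n + 1) ^ h) ^ (k - 1)) \<and>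
     (\<forall>i<n. \<forall>a<k. U i a (\<lambda>j b. real (Y j b) / real (((n + 1) ^ h) ^ (k - 1))) \<le>
        (\<Sum>b<k. real (Y i b) / real (((n + 1) ^ h) ^ (k - 1)) * U i b (\<lambda>j b. real (Y j b) / real (((n + 1) ^ h) ^ (k - 1)))) +
        (2 * real n + 2) * real k ^ 3 / real ((n + 1) ^ h))"
    by (rule exists_grid_equilibrium[OF k H1 _ U01 lip]) simp_all
  then obtain Y where "(\<forall>i<n. (\<Sum>b<k. Y i b) = M n) \<and> (\<forall>i<n. \<forall>a<k. U i a (\<lambda>j b. real (Y j b) / real (M n)) \<le>
       (\<Sum>b<k. real (Y i b) / real (M n) * U i b (\<lambda>j b. real (Y j b) / real (M n))) +
       (2 * real n + 2) * real k ^ 3 / real ((n + 1) ^ h))"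
    unfolding MH by (elim exE)
  then have Y: "\<And>i. i < n \<Longrightarrow> (\<Sum>b<k. Y i b) = M n"
    "\<And>i a. i < n \<Longrightarrow> a < k \<Longrightarrow> U i a (\<lambda>j b. real (Y j b) / real (M n)) \<le>
       (\<Sum>b<k. real (Y i b) / real (M n) * U i b (\<lambda>j b. real (Y j b) / real (M n))) +
       (2 * real n + 2) * real k ^ 3 / real ((n + 1) ^ h)"
    by blast+
  obtain cf where cf: "\<And>i. i < n \<Longrightarrow> cf i < (n + 1) ^ gE" "\<And>i b. i < n \<Longrightarrow> b < k \<Longrightarrow> dig n (cf i) b = Y i b"
  proof -
    have "\<forall>i. \<exists>c. i < n \<longrightarrow> c < (n + 1) ^ gE \<and> (\<forall>b<k. dig n c b = Y i b)"
      using code_exists[OF n Y(1)] by blast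
    then show ?thesis using that by metis
  qed
  have Vcf: "V n (cf i)" if "i < n" for i using cf(2)[OF that] Y(1)[OF that] by (simp add: V_def)
  define y where "y j b = real (Y j b) / real (M n)" for j b
  have st_cf: "st n (cf i) b = nz (y i) b" if "i < n" "b < k" for i b
    using cf(2)[OF that] by (simp add: st_def noisy_def nz_def y_def)
  have EU: "(\<Sum>x<?D. law k (enc n) (map (\<lambda>j. st n (cf j)) (other_list n i)) x * pay n u i a x) = U i a y" if "i < n" "a < k" for i a
  proof -
    have "law k (enc n) (map (\<lambda>j. st n (cf j)) (other_list n i)) x = law k (enc n) (map (\<lambda>j. nz (y j)) (other_list n i)) x" for x
      by (rule law_cong) (auto simp: other_list st_cf)
    then show ?thesis using that by (simp add: U_def)
  qed
  have ys: "stoch k (y i)" if "i < n" for i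
    using Y(1)[OF that] M_pos[of n] by (auto simp: stoch_def y_def simp flip: sum_divide_distrib of_nat_sum)
  \<comment> \<open>\<open>h\<close> was chosen for this: \<open>(n + 1)^h\<close> is
    \<open>(n + 1)^2\<close> times a factor of at least \<open>16 * k^3\<close>, because
    \<open>n + 1\<close> is at least 2.\<close>
  have err: "(2 * real n + 2) * real k ^ 3 / real ((n + 1) ^ h) \<le> 1 / (8 * real (n + 1))"
  proof -
    have "16 * k ^ 3 \<le> 2 ^ (h - 2)" by (rule h)
    also have "(2::nat) ^ (h - 2) \<le> (n + 1) ^ (h - 2)" using n by (intro power_mono) auto
    finally have "real (16 * k ^ 3) \<le> real ((n + 1) ^ (h - 2))" by (rule of_nat_mono)
    then have 1: "16 * real k ^ 3 \<le> real ((n + 1) ^ (h - 2))" by simp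
    define x where "x = real (n + 1)"
    have x: "x > 0" by (simp add: x_def)
    have "(n + 1) ^ h = (n + 1) * (n + 1) * (n + 1) ^ (h - 2)"
      using h(1) by (metis le_add_diff_inverse power2_eq_square power_add)
    then have X: "real ((n + 1) ^ h) = x * x * real ((n + 1) ^ (h - 2))" by (simp only: of_nat_mult x_def)
    have "(2 * real n + 2) * real k ^ 3 = (x * x * (16 * real k ^ 3)) / (8 * x)"
    proof -
      have "2 * real n + 2 = 2 * x" by (simp add: x_def)
      then show ?thesis using x by (simp add: field_simps)
    qed
    also have "\<dots> \<le> (x * x * real ((n + 1) ^ (h - 2))) / (8 * x)"
      using x 1 by (intro divide_right_mono mult_left_mono) auto
    also have "\<dots> = 1 / (8 * x) * real ((n + 1) ^ h)" unfolding X by simp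
    finally have "(2 * real n + 2) * real k ^ 3 \<le> 1 / (8 * x) * real ((n + 1) ^ h)" .
    then show ?thesis unfolding x_def by (intro mult_imp_div_pos_le) auto
  qed
  show ?thesis
  proof (intro exI[of _ cf] conjI allI impI)
    fix i a assume i: "i < n" and a: "a < k"
    have "U i a y \<le> (\<Sum>b<k. y i b * U i b y) + 1 / (8 * real (n + 1))"
      using Y(2)[OF i a] err unfolding y_def by linarith
    also have "(\<Sum>b<k. y i b * U i b y) \<le> (\<Sum>b<k. nz (y i) b * U i b y) + ?\<theta>"
    proof -
      have "(\<Sum>b<k. y i b * U i b y) \<le> (\<Sum>b<k. y i b)"
        using ys[OF i] U01[OF ys i] by (intro sum_mono mult_left_le) (auto simp: stoch_def)
      then have "?\<theta> * (\<Sum>b<k. y i b * U i b y) \<le> ?\<theta> * 1"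
        using lam01 ys[OF i] by (intro mult_left_mono) (auto simp: stoch_def)
      moreover have "0 \<le> (\<Sum>b<k. ?\<theta> / real k * U i b y)"
        using lam01 U01[OF ys i] by (intro sum_nonneg mult_nonneg_nonneg) auto
      moreover have "(\<Sum>b<k. nz (y i) b * U i b y) = (1 - ?\<theta>) * (\<Sum>b<k. y i b * U i b y) + (\<Sum>b<k. ?\<theta> / real k * U i b y)"
        unfolding nz_def distrib_right sum.distrib sum_distrib_left by (simp add: mult.assoc)
      ultimately show ?thesis by (simp add: left_diff_distrib)
    qed
    also have "(\<Sum>b<k. nz (y i) b * U i b y) =
       (\<Sum>b<k. st n (cf i) b * (\<Sum>x<?D. law k (enc n) (map (\<lambda>j. st n (cf j)) (other_list n i)) x * pay n u i b x))"
      using EU[OF i] st_cf[OF i] by (intro sum.cong) auto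
    finally show "(\<Sum>x<?D. law k (enc n) (map (\<lambda>j. st n (cf j)) (other_list n i)) x * pay n u i a x) \<le>
        (\<Sum>b<k. st n (cf i) b * (\<Sum>x<?D. law k (enc n) (map (\<lambda>j. st n (cf j)) (other_list n i)) x * pay n u i b x))
          + (?\<theta> + 1 / (8 * real (n + 1)))"
      unfolding EU[OF i a] by simp
  qed (use Vcf cf in auto)
qed

section \<open>From the search to approximate equilibria\<close>

lemma search:
  assumes n: "n \<ge> 1" and g: "anonymous_game n k u"
  shows "weighted_search n k (enc n) (wt n) (st n) (V n) ((n + 1) ^ gE) ((n + 1) ^ k) ((n + 1) ^ (k - 1)) ((n + 1) ^ wE)
    (pay n u) (thr n) (1 / (16 * real (n + 1))) (lam q N0 n + 1 / (8 * real (n + 1)))"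
proof
  fix cs cs' i a
  assume "set cs \<subseteq> Collect (V n)" "set cs' \<subseteq> Collect (V n)" "length cs = n - 1" "length cs' = n - 1"
    "(\<Sum>c\<leftarrow>cs. wt n c) = (\<Sum>c\<leftarrow>cs'. wt n c)" "i < n" "a < k"
  then show "\<bar>(\<Sum>y<(n + 1) ^ k. law k (enc n) (map (st n) cs) y * pay n u i a y) -
     (\<Sum>y<(n + 1) ^ k. law k (enc n) (map (st n) cs') y * pay n u i a y)\<bar> \<le> 1 / (16 * real (n + 1))"
    using pay_bounds[OF n g] by (intro codes_close[OF n]) (auto simp: abs_le_iff intro: order_trans)
next
  show "lam q N0 n + 1 / (8 * real (n + 1)) + 2 * (1 / (16 * real (n + 1))) \<le> thr n"
  proof -
    have "1 / (8 * x) + 2 * (1 / (16 * x)) = 1 / (4 * x)" if "x > 0" for x :: real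
      using that by (simp add: field_simps)
    from this[of "real (n + 1)", OF of_nat_0_less_iff[THEN iffD2]] show ?thesis unfolding thr_def by simp
  qed
next
  show "(n - 1) * (n + 1) ^ (k - 1) < (n + 1) ^ k" by (rule size_bound) simp
qed (use n enc_le stoch_st wt_bound equilibrium_exists[OF n g] in auto)

lemma expectation_others:
  assumes n: "n \<ge> 1" and i: "i < n" and a: "a < k"
    and s: "\<And>j. j < n \<Longrightarrow> set_pmf (s j) \<subseteq> {..<k}" "\<And>j b. j < n \<Longrightarrow> b < k \<Longrightarrow> pmf (s j) b = st n (cf j) b"
  shows "measure_pmf.expectation (others_pmf n k s i) (\<lambda>x. u i a x) =
    (\<Sum>y<(n + 1) ^ k. law k (enc n) (map (\<lambda>j. st n (cf j)) (other_list n i)) y * pay n u i a y)"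
proof -
  let ?J = "others n i"
  have J: "finite ?J" "card ?J = n - 1" "set (other_list n i) = ?J"
    using i by (auto simp: others_def other_list)
  have "measure_pmf.expectation (others_pmf n k s i) (\<lambda>x. u i a x) =
     measure_pmf.expectation (Pi_pmf ?J 0 s) (\<lambda>f. u i a (partition_of k ?J f))"
    by (simp add: others_pmf_def)
  also have "\<dots> = measure_pmf.expectation (Pi_pmf ?J 0 s) (\<lambda>f. pay n u i a (\<Sum>j\<in>?J. enc n (f j)))"
  proof (intro integral_cong_AE AE_pmfI)
    fix f assume "f \<in> set_pmf (Pi_pmf ?J 0 s)"
    then have f: "f j < k" if "j \<in> ?J" for j
      using that J(1) s(1) by (auto simp: set_Pi_pmf PiE_dflt_def others_def)
    have "partition_of k ?J f \<in> partitions k (n - 1)"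
      using lcode_partition_of(2)[OF J(1) f] J(2) by (simp add: partitions_def partition_of_def)
    from pay_code[OF n i a this, of u] show "u i a (partition_of k ?J f) = pay n u i a (\<Sum>j\<in>?J. enc n (f j))"
      using lcode_partition_of(1)[where N = "n + 1", OF J(1) f] by (simp add: enc_def)
  qed auto
  also have "\<dots> = (\<Sum>y<(n + 1) ^ k. law k (enc n) (map (\<lambda>j. pmf (s j)) (other_list n i)) y * pay n u i a y)"
    unfolding J(3)[symmetric]
    by (rule law_Pi_pmf[OF enc_le]) (use i s(1) size_bound[of "n - 1" n] in \<open>auto simp: length_other_list other_list\<close>)
  also have "\<dots> = (\<Sum>y<(n + 1) ^ k. law k (enc n) (map (\<lambda>j. st n (cf j)) (other_list n i)) y * pay n u i a y)"
    using s(2) by (intro sum.cong refl arg_cong2[where f = "(*)"] law_cong) (auto simp: other_list)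
  finally show ?thesis .
qed

text \<open>The regret adds up to \<theta> plus 1/4 + 1/8 = 3/8 of \<open>1 / (n + 1)\<close>, the
  quantity bounded in \<open>target\<close>.\<close>

lemma approx_nash_of_codes:
  assumes n: "n \<ge> 1" and cf: "\<And>i. i < n \<Longrightarrow> V n (cf i)"
    and regret: "\<And>i a. i < n \<Longrightarrow> a < k \<Longrightarrow>
        (\<Sum>y<(n + 1) ^ k. law k (enc n) (map (\<lambda>j. st n (cf j)) (other_list n i)) y * pay n u i a y) \<le>
        (\<Sum>b<k. st n (cf i) b * (\<Sum>y<(n + 1) ^ k. law k (enc n) (map (\<lambda>j. st n (cf j)) (other_list n i)) y * pay n u i b y))
          + (thr n + 2 * (1 / (16 * real (n + 1))))"
  shows "\<exists>s. approx_nash n k u (1 / real n powr (1 - \<delta>)) s \<and> (\<forall>i<n. \<forall>a<k. pmf (s i) a = st n (cf i) a)"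
proof -
  have "\<forall>i. \<exists>p. i < n \<longrightarrow> set_pmf p \<subseteq> {..<k} \<and> (\<forall>a<k. pmf p a = st n (cf i) a)"
    using stoch_pmf stoch_st cf by blast
  then obtain s where s: "\<And>i. i < n \<Longrightarrow> set_pmf (s i) \<subseteq> {..<k}" "\<And>i a. i < n \<Longrightarrow> a < k \<Longrightarrow> pmf (s i) a = st n (cf i) a"
    by metis
  have "measure_pmf.expectation (others_pmf n k s i) (\<lambda>x. u i a' x)
        \<le> measure_pmf.expectation (pair_pmf (others_pmf n k s i) (s i)) (\<lambda>(x, a). u i a x) + 1 / real n powr (1 - \<delta>)"
    if i: "i < n" and a': "a' < k" for i a'
  proof -
    have "finite (set_pmf (Pi_pmf (others n i) 0 s))"
      using finite_subset[OF s(1) finite_lessThan]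
      by (subst set_Pi_pmf) (auto simp: others_def intro!: finite_PiE_dflt)
    then have fin: "finite (set_pmf (others_pmf n k s i))" by (simp add: others_pmf_def)
    have "measure_pmf.expectation (pair_pmf (others_pmf n k s i) (s i)) (\<lambda>(x, a). u i a x) =
      (\<Sum>b<k. pmf (s i) b * measure_pmf.expectation (others_pmf n k s i) (\<lambda>x. u i b x))"
      by (rule expectation_pair_pmf[OF fin s(1)[OF i]])
    also have "\<dots> = (\<Sum>b<k. st n (cf i) b * (\<Sum>y<(n + 1) ^ k. law k (enc n) (map (\<lambda>j. st n (cf j)) (other_list n i)) y * pay n u i b y))"
      using s i by (intro sum.cong refl arg_cong2[where f = "(*)"] expectation_others n) auto
    finally have pair: "measure_pmf.expectation (pair_pmf (others_pmf n k s i) (s i)) (\<lambda>(x, a). u i a x) = \<dots>" .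
    have "thr n + 2 * (1 / (16 * real (n + 1))) = lam q N0 n + 3 / (8 * real (n + 1))"
    proof -
      have "1 / (4 * x) + 2 * (1 / (16 * x)) = 3 / (8 * x)" if "x > 0" for x :: real
        using that by (simp add: field_simps)
      from this[of "real (n + 1)", OF of_nat_0_less_iff[THEN iffD2]] show ?thesis unfolding thr_def by simp
    qed
    moreover note target[OF n] regret[OF i a'] expectation_others[where cf = cf and s = s and u = u, OF n i a' s]
    ultimately show ?thesis unfolding pair by linarith
  qed
  then have "approx_nash n k u (1 / real n powr (1 - \<delta>)) s"
    using s(1) by (auto simp: approx_nash_def mixed_profile_def)
  with s(2) show ?thesis by blast
qed

end

section \<open>The program\<close>

lemma cmp_shift:
  assumes "cmp P f" "\<And>n u A \<rho>. Q n u A \<rho> \<Longrightarrow> P n u A (\<lambda>j. \<rho> (Suc j))"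
  shows "cmp Q (\<lambda>n u \<rho>. f n u (\<lambda>j. \<rho> (Suc j)))"
proof -
  from assms(1) obtain t where t: "\<And>n u A \<rho>. P n u A \<rho> \<Longrightarrow> ev t \<rho> A n = f n u \<rho>"
    unfolding cmp_def by blast
  have "ev (shift 0 t) \<rho> A n = f n u (\<lambda>j. \<rho> (Suc j))" if "Q n u A \<rho>" for n u A \<rho>
    unfolding ev_shift using t[OF assms(2)[OF that]] by simp
  then show ?thesis unfolding cmp_def by blast
qed

lemma cmp_mono: "cmp P f \<Longrightarrow> (\<And>n u A \<rho>. Q n u A \<rho> \<Longrightarrow> P n u A \<rho>) \<Longrightarrow> cmp Q f"
  unfolding cmp_def by blast

text \<open>With \<open>N = (n + 1) ^ a\<close>, the quotient of \<open>x\<close> is the only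
  \<open>i\<close> such that \<open>i * N \<le> x < (i + 1) * N\<close>; the bound on
  \<open>f\<close> supplies a range for the search.\<close>

lemma cmp_real_div:
  assumes f: "cmp P (\<lambda>n u \<rho>. real (f n u \<rho>))" and b: "\<And>n u A \<rho>. P n u A \<rho> \<Longrightarrow> f n u \<rho> < (n + 1) ^ e"
  shows "cmp P (\<lambda>n u \<rho>. real (f n u \<rho> div (n + 1) ^ a))"
proof -
  have "cmp P (\<lambda>n u \<rho>. \<Sum>i<(n + 1) ^ e. if i * (n + 1) ^ a \<le> f n u \<rho> \<and> f n u \<rho> < (i + 1) * (n + 1) ^ a then real i else 0)"
    by (intro cmp_sum cmp_if cmpb_conj cmpb_nat_le cmpb_nat_less cmp_real_mult cmp_real_add cmp_real_power
        cmp_n cmp_var cmp_const'(1,4) cmp_shift[OF f]) auto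
  then show ?thesis
  proof (rule cmp_cong)
    fix n u A \<rho> assume P: "P n u A \<rho>"
    let ?x = "f n u \<rho>" and ?N = "(n + 1) ^ a"
    have iff: "i * ?N \<le> ?x \<and> ?x < (i + 1) * ?N \<longleftrightarrow> i = ?x div ?N" for i
    proof
      assume "i * ?N \<le> ?x \<and> ?x < (i + 1) * ?N"
      then show "i = ?x div ?N" by (intro div_nat_eqI[symmetric]) (auto simp: mult.commute)
    next
      assume "i = ?x div ?N"
      then show "i * ?N \<le> ?x \<and> ?x < (i + 1) * ?N"
      proof -
        have "?x mod ?N < ?N" by simp
        then show ?thesis
          using div_mult_mod_eq[of ?x ?N] unfolding distrib_right mult_1_left \<open>i = ?x div ?N\<close>
          by (intro conjI) linarith+
      qed
    qed
    have "?x div ?N < (n + 1) ^ e" using b[OF P] by (meson div_le_dividend le_less_trans)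
    then show "real (?x div ?N) = (\<Sum>i<(n + 1) ^ e. if i * ?N \<le> ?x \<and> ?x < (i + 1) * ?N then real i else 0)"
      unfolding iff by simp
  qed
qed

lemma cmp_real_mod:
  assumes f: "cmp P (\<lambda>n u \<rho>. real (f n u \<rho>))" and b: "\<And>n u A \<rho>. P n u A \<rho> \<Longrightarrow> f n u \<rho> < (n + 1) ^ e"
  shows "cmp P (\<lambda>n u \<rho>. real (f n u \<rho> mod (n + 1) ^ a))"
proof (rule cmp_cong)
  show "cmp P (\<lambda>n u \<rho>. real (f n u \<rho>) - real (f n u \<rho> div (n + 1) ^ a * (n + 1) ^ a))"
    by (intro cmp_diff f cmp_real_mult cmp_real_div[OF f b] cmp_real_power cmp_real_add cmp_n cmp_const'(4))
  show "real (f n u \<rho> mod (n + 1) ^ a) = real (f n u \<rho>) - real (f n u \<rho> div (n + 1) ^ a * (n + 1) ^ a)"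
    for n u \<rho>
    using div_mult_mod_eq[of "f n u \<rho>" "(n + 1) ^ a"] by (metis add_diff_cancel_left' of_nat_add)
qed

text \<open>The least witness is the only \<open>i\<close> that satisfies \<open>b\<close> while the
  number of smaller witnesses is 0; \<open>ex\<close> puts it into the range of the search.\<close>

lemma cmp_least:
  assumes b: "cmpb (\<lambda>n u A \<rho>. \<rho> 0 < (n + 1) ^ e \<and> P n u A (\<lambda>j. \<rho> (Suc j))) (\<lambda>n u \<rho>. b n u (\<rho> 0) (\<lambda>j. \<rho> (Suc j)))"
    and ex: "\<And>n u A \<rho>. P n u A \<rho> \<Longrightarrow> \<exists>i<(n + 1) ^ e. b n u i \<rho>"
  shows "cmp P (\<lambda>n u \<rho>. real (LEAST i. b n u i \<rho>))"
proof -
  let ?f = "\<lambda>n u i \<rho>. if b n u i \<rho> then 1 else 0 :: real"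
  obtain t where t: "\<And>n u A \<rho>. \<rho> 0 < (n + 1) ^ e \<and> P n u A (\<lambda>j. \<rho> (Suc j)) \<Longrightarrow> ev t \<rho> A n = ?f n u (\<rho> 0) (\<lambda>j. \<rho> (Suc j))"
    using b unfolding cmpb_def cmp_def by blast
  have "cmp P (\<lambda>n u \<rho>. \<Sum>i<(n + 1) ^ e. if b n u i \<rho> \<and> \<not> 0 < (\<Sum>j<(n + 1) ^ e. if j < i then ?f n u j \<rho> else 0) then real i else 0)"
  proof (intro cmp_sum cmp_if cmpb_conj cmpb_not cmpb_less cmpb_nat_less cmp_var cmp_const'(1,2) b)
    \<comment> \<open>In the inner sum the candidate \<open>i\<close> sits at index 1, between the
      tested \<open>j\<close> and the outer variables; shifting at 1 skips it.\<close>
    have "ev (shift 1 t) \<rho> A n = ?f n u (\<rho> 0) (\<lambda>j. \<rho> (Suc (Suc j)))"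
      if "\<rho> 0 < (n + 1) ^ e" "P n u A (\<lambda>j. \<rho> (Suc (Suc j)))" for n u A \<rho>
    proof -
      have *: "(\<lambda>j. if Suc j < 1 then \<rho> (Suc j) else \<rho> (Suc (Suc j))) = (\<lambda>j. \<rho> (Suc (Suc j)))" by auto
      show ?thesis unfolding ev_shift
        using t[of "\<lambda>j. if j < 1 then \<rho> j else \<rho> (Suc j)" n u A] that by simp
    qed
    then show "cmpb (\<lambda>n u A \<rho>. \<rho> 0 < \<rho> (Suc 0) \<and> \<rho> 0 < (n + 1) ^ e \<and> b n u (\<rho> (Suc 0)) (\<lambda>j. \<rho> (Suc (Suc j))) \<and>
         \<rho> (Suc 0) < (n + 1) ^ e \<and> P n u A (\<lambda>j. \<rho> (Suc (Suc j)))) (\<lambda>n u \<rho>. b n u (\<rho> 0) (\<lambda>j. \<rho> (Suc (Suc j))))"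
      unfolding cmpb_def cmp_def by (intro exI[of _ "shift 1 t"]) blast
  qed
  then show ?thesis
  proof (rule cmp_cong)
    fix n u A \<rho> assume P: "P n u A \<rho>"
    let ?L = "LEAST i. b n u i \<rho>"
    obtain i0 where i0: "i0 < (n + 1) ^ e" "b n u i0 \<rho>" using ex[OF P] by blast
    have L: "b n u ?L \<rho>" "?L < (n + 1) ^ e"
      using LeastI[of "\<lambda>i. b n u i \<rho>", OF i0(2)] Least_le[of "\<lambda>i. b n u i \<rho>", OF i0(2)] i0(1) by auto
    have "b n u i \<rho> \<and> \<not> 0 < (\<Sum>j<(n + 1) ^ e. if j < i then ?f n u j \<rho> else 0) \<longleftrightarrow> i = ?L" if "i < (n + 1) ^ e" for i
    proof
      assume i: "b n u i \<rho> \<and> \<not> 0 < (\<Sum>j<(n + 1) ^ e. if j < i then ?f n u j \<rho> else 0)"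
      have least: "\<not> b n u j \<rho>" if "j < i" for j
      proof
        assume "b n u j \<rho>"
        then have "0 < (\<Sum>j<(n + 1) ^ e. if j < i then ?f n u j \<rho> else 0)"
          using that \<open>i < (n + 1) ^ e\<close> by (intro sum_pos2[of _ j]) auto
        with i show False by simp
      qed
      have "?L \<le> i" using i by (intro Least_le) blast
      moreover have "i \<le> ?L" using least[of ?L] L(1) by (intro leI) blast
      ultimately show "i = ?L" by (intro le_antisym)
    next
      assume i: "i = ?L"
      have "(\<Sum>j<(n + 1) ^ e. if j < i then ?f n u j \<rho> else 0) = 0"
      proof (intro sum.neutral ballI)
        show "(if j < i then ?f n u j \<rho> else 0) = 0" for j
          using not_less_Least[of j "\<lambda>i. b n u i \<rho>"] unfolding i by simp
      qed
      with L i show "b n u i \<rho> \<and> \<not> 0 < (\<Sum>j<(n + 1) ^ e. if j < i then ?f n u j \<rho> else 0)" by simp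
    qed
    then have "(\<Sum>i<(n + 1) ^ e. if b n u i \<rho> \<and> \<not> 0 < (\<Sum>j<(n + 1) ^ e. if j < i then ?f n u j \<rho> else 0) then real i else 0) =
      (\<Sum>i<(n + 1) ^ e. if i = ?L then real i else 0)"
      by (intro sum.cong refl) auto
    also have "\<dots> = real ?L" using L(2) by simp
    finally show "real ?L = (\<Sum>i<(n + 1) ^ e. if b n u i \<rho> \<and> \<not> 0 < (\<Sum>j<(n + 1) ^ e. if j < i then ?f n u j \<rho> else 0) then real i else 0)" ..
  qed
qed

section \<open>Access to complete and partial tables\<close>

lemma storedD:
  "stored a e1 e2 e3 g n A \<Longrightarrow> i < (n + 1) ^ e1 \<Longrightarrow> j < (n + 1) ^ e2 \<Longrightarrow> l < (n + 1) ^ e3 \<Longrightarrow>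
    A a ((i * (n + 1) ^ e2 + j) * (n + 1) ^ e3 + l) = g i j l"
  by (simp add: stored_def)

lemma cmp_table:
  assumes "a \<noteq> ''y''"
    and "cmp P (\<lambda>n u \<rho>. real (f1 n u \<rho>))" "cmp P (\<lambda>n u \<rho>. real (f2 n u \<rho>))" "cmp P (\<lambda>n u \<rho>. real (f3 n u \<rho>))"
    and "\<And>n u A \<rho>. P n u A \<rho> \<Longrightarrow> stored a e1 e2 e3 (g n u) n A"
    and "\<And>n u A \<rho>. P n u A \<rho> \<Longrightarrow> f1 n u \<rho> < (n + 1) ^ e1" "\<And>n u A \<rho>. P n u A \<rho> \<Longrightarrow> f2 n u \<rho> < (n + 1) ^ e2"
      "\<And>n u A \<rho>. P n u A \<rho> \<Longrightarrow> f3 n u \<rho> < (n + 1) ^ e3"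
  shows "cmp P (\<lambda>n u \<rho>. g n u (f1 n u \<rho>) (f2 n u \<rho>) (f3 n u \<rho>))"
proof (rule cmp_stored[where ?e1.0 = e1 and ?e2.0 = e2 and ?e3.0 = e3, OF assms(1-4)])
  fix n u A \<rho> assume P: "P n u A \<rho>"
  show "f1 n u \<rho> < (n + 1) ^ e1 \<and> f2 n u \<rho> < (n + 1) ^ e2 \<and> f3 n u \<rho> < (n + 1) ^ e3 \<and>
      A a ((f1 n u \<rho> * (n + 1) ^ e2 + f2 n u \<rho>) * (n + 1) ^ e3 + f3 n u \<rho>) = g n u (f1 n u \<rho>) (f2 n u \<rho>) (f3 n u \<rho>)"
    by (intro conjI assms(6-8)[OF P] storedD[OF assms(5)[OF P]])
qed

definition stored_below ::
  "vname \<Rightarrow> nat \<Rightarrow> nat \<Rightarrow> nat \<Rightarrow> (nat \<Rightarrow> nat \<Rightarrow> nat \<Rightarrow> real) \<Rightarrow> nat \<Rightarrow> arrays \<Rightarrow> bool" where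
  "stored_below a m e2 e3 g n A \<longleftrightarrow> (\<forall>i<m. \<forall>j<(n + 1) ^ e2. \<forall>l<(n + 1) ^ e3.
     A a ((i * (n + 1) ^ e2 + j) * (n + 1) ^ e3 + l) = g i j l)"

lemma stored_belowD:
  "stored_below a m e2 e3 g n A \<Longrightarrow> i < m \<Longrightarrow> j < (n + 1) ^ e2 \<Longrightarrow> l < (n + 1) ^ e3 \<Longrightarrow>
    A a ((i * (n + 1) ^ e2 + j) * (n + 1) ^ e3 + l) = g i j l"
  by (simp add: stored_below_def)

lemma cmp_table_rec:
  assumes "a \<noteq> ''y''"
    and "cmp P (\<lambda>n u \<rho>. real (f1 n u \<rho>))" "cmp P (\<lambda>n u \<rho>. real (f2 n u \<rho>))" "cmp P (\<lambda>n u \<rho>. real (f3 n u \<rho>))"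
    and "\<And>n u A \<rho>. P n u A \<rho> \<Longrightarrow> stored_below a (m n u \<rho>) e2 e3 (g n u) n A"
    and "\<And>n u A \<rho>. P n u A \<rho> \<Longrightarrow> f1 n u \<rho> < m n u \<rho>"
    and "\<And>n u A \<rho>. P n u A \<rho> \<Longrightarrow> f1 n u \<rho> < (n + 1) ^ e1" "\<And>n u A \<rho>. P n u A \<rho> \<Longrightarrow> f2 n u \<rho> < (n + 1) ^ e2"
      "\<And>n u A \<rho>. P n u A \<rho> \<Longrightarrow> f3 n u \<rho> < (n + 1) ^ e3"
  shows "cmp P (\<lambda>n u \<rho>. g n u (f1 n u \<rho>) (f2 n u \<rho>) (f3 n u \<rho>))"
proof (rule cmp_stored[where ?e1.0 = e1 and ?e2.0 = e2 and ?e3.0 = e3, OF assms(1-4)])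
  fix n u A \<rho> assume P: "P n u A \<rho>"
  show "f1 n u \<rho> < (n + 1) ^ e1 \<and> f2 n u \<rho> < (n + 1) ^ e2 \<and> f3 n u \<rho> < (n + 1) ^ e3 \<and>
      A a ((f1 n u \<rho> * (n + 1) ^ e2 + f2 n u \<rho>) * (n + 1) ^ e3 + f3 n u \<rho>) = g n u (f1 n u \<rho>) (f2 n u \<rho>) (f3 n u \<rho>)"
    by (intro conjI assms(7-9)[OF P] stored_belowD[OF assms(5)[OF P] assms(6)[OF P]])
qed

text \<open>What is known when the entry with indices \<open>\<rho> 2\<close>,
  \<open>\<rho> 1\<close>, \<open>\<rho> 0\<close> is computed: the earlier tables and all layers
  below \<open>\<rho> 2\<close> of the present one. The last index is the innermost summation
  variable of \<open>prog_table\<close>, hence index 0.\<close>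

abbreviation entry_known ::
  "nat \<Rightarrow> (nat \<Rightarrow> payoffs \<Rightarrow> arrays \<Rightarrow> bool) \<Rightarrow> vname \<Rightarrow> nat \<Rightarrow> nat \<Rightarrow> nat \<Rightarrow>
    (nat \<Rightarrow> payoffs \<Rightarrow> nat \<Rightarrow> nat \<Rightarrow> nat \<Rightarrow> real) \<Rightarrow> nat \<Rightarrow> payoffs \<Rightarrow> arrays \<Rightarrow> (nat \<Rightarrow> nat) \<Rightarrow> bool" where
  "entry_known k I a e1 e2 e3 g n u A \<rho> \<equiv>
     \<rho> 0 < (n + 1) ^ e3 \<and> \<rho> 1 < (n + 1) ^ e2 \<and> \<rho> 2 < (n + 1) ^ e1 \<and> 1 \<le> n \<and> anonymous_game n k u \<and>
     I n u A \<and> stored_below a (\<rho> 2) e2 e3 (g n u) n A"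

lemmas prog_table' = prog_table[folded stored_below_def]

lemma cmp_real_sub:
  assumes "cmp P (\<lambda>n u \<rho>. real (f n u \<rho>))" "cmp P (\<lambda>n u \<rho>. real (g n u \<rho>))"
  shows "cmp P (\<lambda>n u \<rho>. real (f n u \<rho> - g n u \<rho>))"
proof (rule cmp_cong)
  show "cmp P (\<lambda>n u \<rho>. (if g n u \<rho> \<le> f n u \<rho> then 1 else 0) * (real (f n u \<rho>) - real (g n u \<rho>)))"
    using cmpb_nat_le[OF assms(2,1)] by (intro cmp_mult cmp_diff assms) (simp add: cmpb_def)
qed (auto simp: of_nat_diff)

lemmas cmp_arith = cmp_const' cmp_n cmp_var cmp_add cmp_diff cmp_mult cmp_divide cmp_real_add cmp_real_mult
  cmp_real_power cmpb_nat_less cmpb_nat_le cmpb_nat_eq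

lemma cmp_lam: "cmp P (\<lambda>n u \<rho>. lam q N0 n)"
proof -
  have "cmp P (\<lambda>n u \<rho>. if n < N0 then 0 else (\<Sum>i<(n + 1) ^ 1. if (i + 1) ^ q \<le> n + 1 then 1 else 0) / real (n + 1))"
    by (intro cmp_if cmp_sum cmp_arith)
  then show ?thesis by (rule cmp_cong) (simp add: lam_def rt_def of_nat_sum if_distrib cong: if_cong)
qed

context scheme begin

text \<open>The quantities of \<open>weighted_search\<close> with \<open>n\<close> and
  \<open>u\<close> as arguments, because a single program has to work for all of them.\<close>

definition Ux :: "nat \<Rightarrow> payoffs \<Rightarrow> nat \<Rightarrow> nat \<Rightarrow> nat \<Rightarrow> real" where
  "Ux n u t i a = (\<Sum>y<(n + 1) ^ k. avg k (enc n) (wt n) (st n) (V n) ((n + 1) ^ gE) (n - 1) t y * pay n u i a y) /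
     (\<Sum>y<(n + 1) ^ k. avg k (enc n) (wt n) (st n) (V n) ((n + 1) ^ gE) (n - 1) t y)"

definition accx :: "nat \<Rightarrow> payoffs \<Rightarrow> nat \<Rightarrow> nat \<Rightarrow> nat \<Rightarrow> bool" where
  "accx n u T i c \<longleftrightarrow> V n c \<and> wt n c \<le> T \<and>
     0 < (\<Sum>y<(n + 1) ^ k. avg k (enc n) (wt n) (st n) (V n) ((n + 1) ^ gE) (n - 1) (T - wt n c) y) \<and>
     (\<forall>a<k. Ux n u (T - wt n c) i a \<le> thr n + (\<Sum>b<k. st n c b * Ux n u (T - wt n c) i b))"

definition goodx :: "nat \<Rightarrow> payoffs \<Rightarrow> nat \<Rightarrow> bool" where
  "goodx n u T \<longleftrightarrow> T < (n + 1) ^ wE \<and> 0 < assignments (accx n u T) (wt n) ((n + 1) ^ gE) n T"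

definition Tx :: "nat \<Rightarrow> payoffs \<Rightarrow> nat" where "Tx n u = (LEAST T. goodx n u T)"

text \<open>
  Every table has three indices; an index that is not needed ranges over \<open>{..<(n + 1) ^ 0}\<close>.
\<close>

definition tV :: "nat \<Rightarrow> payoffs \<Rightarrow> nat \<Rightarrow> nat \<Rightarrow> nat \<Rightarrow> real" where "tV n u c j l = (if V n c then 1 else 0)"
definition tW :: "nat \<Rightarrow> payoffs \<Rightarrow> nat \<Rightarrow> nat \<Rightarrow> nat \<Rightarrow> real" where "tW n u c j l = real (wt n c)"
text \<open>A variable strategy \<open>b\<close> is dispatched by a sum over constants
  \<open>a\<close>, because \<open>dig\<close> has it in an exponent, where a term admits only
  constants.\<close>

definition tS :: "nat \<Rightarrow> payoffs \<Rightarrow> nat \<Rightarrow> nat \<Rightarrow> nat \<Rightarrow> real" where "tS n u c j b = (\<Sum>a<k. if b = a then st n c a else 0)"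
definition tX :: "nat \<Rightarrow> payoffs \<Rightarrow> nat \<Rightarrow> nat \<Rightarrow> nat \<Rightarrow> real" where "tX n u y j l = (if validy n y then 1 else 0)"
definition tR :: "nat \<Rightarrow> payoffs \<Rightarrow> nat \<Rightarrow> nat \<Rightarrow> nat \<Rightarrow> real" where "tR n u y j l = real (rank n y)"
definition tN :: "nat \<Rightarrow> payoffs \<Rightarrow> nat \<Rightarrow> nat \<Rightarrow> nat \<Rightarrow> real" where "tN n u i j l = real (np n)"
definition tA :: "nat \<Rightarrow> payoffs \<Rightarrow> nat \<Rightarrow> nat \<Rightarrow> nat \<Rightarrow> real" where
  "tA n u m t y = avg k (enc n) (wt n) (st n) (V n) ((n + 1) ^ gE) m t y"
definition tU :: "nat \<Rightarrow> payoffs \<Rightarrow> nat \<Rightarrow> nat \<Rightarrow> nat \<Rightarrow> real" where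
  "tU n u t i a = (if i < n \<and> a < k then Ux n u t i a else 0)"
definition tC :: "nat \<Rightarrow> payoffs \<Rightarrow> nat \<Rightarrow> nat \<Rightarrow> nat \<Rightarrow> real" where
  "tC n u T i c = (if i < n \<and> accx n u T i c then 1 else 0)"
definition tF :: "nat \<Rightarrow> payoffs \<Rightarrow> nat \<Rightarrow> nat \<Rightarrow> nat \<Rightarrow> real" where
  "tF n u m T t = assignments (accx n u T) (wt n) ((n + 1) ^ gE) m t"
definition tT :: "nat \<Rightarrow> payoffs \<Rightarrow> nat \<Rightarrow> nat \<Rightarrow> nat \<Rightarrow> real" where "tT n u i j l = real (Tx n u)"
definition tP :: "nat \<Rightarrow> payoffs \<Rightarrow> nat \<Rightarrow> nat \<Rightarrow> nat \<Rightarrow> real" where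
  "tP n u i t l = (if i < n then real (pick (accx n u (Tx n u)) (wt n) ((n + 1) ^ gE) i t) else 0)"
definition tQ :: "nat \<Rightarrow> payoffs \<Rightarrow> nat \<Rightarrow> nat \<Rightarrow> nat \<Rightarrow> real" where
  "tQ n u i j l = real (rest (accx n u (Tx n u)) (wt n) ((n + 1) ^ gE) n (Tx n u) i)"
definition ch :: "nat \<Rightarrow> payoffs \<Rightarrow> nat \<Rightarrow> nat" where
  "ch n u i = choice (accx n u (Tx n u)) (wt n) ((n + 1) ^ gE) n (Tx n u) i"
text \<open>The output layout has radix \<open>k\<close>, in general not a power of
  \<open>n + 1\<close>. So a table with one proper index is used, and \<open>i * k + a\<close> is
  decoded by search.\<close>

definition tO :: "nat \<Rightarrow> payoffs \<Rightarrow> nat \<Rightarrow> nat \<Rightarrow> nat \<Rightarrow> real" where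
  "tO n u v j l = (\<Sum>i<(n + 1) ^ 1. if i < n then \<Sum>a<k. if v = i * k + a then st n (ch n u i) a else 0 else 0)"

lemma search_x:
  assumes "n \<ge> 1" "anonymous_game n k u"
  shows "\<exists>T. goodx n u T" and "\<And>i. i < n \<Longrightarrow> ch n u i < (n + 1) ^ gE"
    and "\<exists>s. approx_nash n k u (1 / real n powr (1 - \<delta>)) s \<and> (\<forall>i<n. \<forall>a<k. pmf (s i) a = st n (ch n u i) a)"
proof -
  interpret W: weighted_search n k "enc n" "wt n" "st n" "V n" "(n + 1) ^ gE" "(n + 1) ^ k" "(n + 1) ^ (k - 1)" "(n + 1) ^ wE"
    "pay n u" "thr n" "1 / (16 * real (n + 1))" "lam q N0 n + 1 / (8 * real (n + 1))"
    by (rule search[OF assms])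
  have acc: "W.acc = accx n u" by (intro ext) (simp only: W.acc_def accx_def W.U_def Ux_def)
  have good: "W.good = goodx n u" by (intro ext) (simp only: W.good_def goodx_def acc)
  show ex: "\<exists>T. goodx n u T" using W.good_exists unfolding good .
  then have T: "goodx n u (Tx n u)" unfolding Tx_def by (rule LeastI_ex)
  then show "ch n u i < (n + 1) ^ gE" if "i < n" for i
    using choice(1)[of "accx n u (Tx n u)" "wt n" "(n + 1) ^ gE" n "Tx n u" i] that by (simp add: goodx_def ch_def)
  have chf: "choice (accx n u (Tx n u)) (wt n) ((n + 1) ^ gE) n (Tx n u) = ch n u"
    by (intro ext) (simp only: ch_def)
  note R = W.choice_regret[unfolded acc good, OF T, unfolded chf]
  show "\<exists>s. approx_nash n k u (1 / real n powr (1 - \<delta>)) s \<and> (\<forall>i<n. \<forall>a<k. pmf (s i) a = st n (ch n u i) a)"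
  proof (rule approx_nash_of_codes[OF assms(1)])
    show "V n (ch n u i)" if "i < n" for i using R[OF that, of 0] k by simp
    show "(\<Sum>y<(n + 1) ^ k. law k (enc n) (map (\<lambda>j. st n (ch n u j)) (other_list n i)) y * pay n u i a y) \<le>
        (\<Sum>b<k. st n (ch n u i) b * (\<Sum>y<(n + 1) ^ k. law k (enc n) (map (\<lambda>j. st n (ch n u j)) (other_list n i)) y * pay n u i b y))
          + (thr n + 2 * (1 / (16 * real (n + 1))))" if "i < n" "a < k" for i a
      using R[OF that] by (simp add: o_def)
  qed
qed

lemma cmp_dig:
  assumes "cmp P (\<lambda>n u \<rho>. real (f n u \<rho>))" "\<And>n u A \<rho>. P n u A \<rho> \<Longrightarrow> f n u \<rho> < (n + 1) ^ gE"
  shows "cmp P (\<lambda>n u \<rho>. real (dig n (f n u \<rho>) b))"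
  unfolding dig_def
proof (rule cmp_real_mod[where e = gE, OF cmp_real_div[where e = gE, OF assms]])
  show "f n u \<rho> div (n + 1) ^ (bd * b) < (n + 1) ^ gE" if "P n u A \<rho>" for n u A \<rho>
    using assms(2)[OF that] by (rule le_less_trans[OF div_le_dividend])
qed

section \<open>The memory after each table\<close>

definition I0 :: "nat \<Rightarrow> payoffs \<Rightarrow> arrays \<Rightarrow> bool" where
  "I0 n u A \<longleftrightarrow> (\<forall>j<length (payoff_list n k u). A ''u'' j = payoff_list n k u ! j)"
definition "I1 n u A \<longleftrightarrow> I0 n u A \<and> stored ''V'' gE 0 0 (tV n u) n A"
definition "I2 n u A \<longleftrightarrow> I1 n u A \<and> stored ''W'' gE 0 0 (tW n u) n A"
definition "I3 n u A \<longleftrightarrow> I2 n u A \<and> stored ''S'' gE 0 k (tS n u) n A"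
definition "I4 n u A \<longleftrightarrow> I3 n u A \<and> stored ''X'' k 0 0 (tX n u) n A"
definition "I5 n u A \<longleftrightarrow> I4 n u A \<and> stored ''R'' k 0 0 (tR n u) n A"
definition "I6 n u A \<longleftrightarrow> I5 n u A \<and> stored ''N'' 0 0 0 (tN n u) n A"
definition "I7 n u A \<longleftrightarrow> I6 n u A \<and> stored ''A'' 1 wE k (tA n u) n A"
definition "I8 n u A \<longleftrightarrow> I7 n u A \<and> stored ''U'' wE 1 k (tU n u) n A"
definition "I9 n u A \<longleftrightarrow> I8 n u A \<and> stored ''C'' wE 1 gE (tC n u) n A"
definition "I10 n u A \<longleftrightarrow> I9 n u A \<and> stored ''F'' 1 wE wE (tF n u) n A"
definition "I11 n u A \<longleftrightarrow> I10 n u A \<and> stored ''T'' 0 0 0 (tT n u) n A"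
definition "I12 n u A \<longleftrightarrow> I11 n u A \<and> stored ''P'' 1 wE 0 (tP n u) n A"
definition "I13 n u A \<longleftrightarrow> I12 n u A \<and> stored ''Q'' 1 0 0 (tQ n u) n A"
definition "I14 n u A \<longleftrightarrow> I13 n u A \<and> stored ''s'' (k + 1) 0 0 (tO n u) n A"

lemmas I_defs = I0_def I1_def I2_def I3_def I4_def I5_def I6_def I7_def I8_def I9_def I10_def I11_def I12_def I13_def

lemma prog0: "prog k I0"
  using prog_init by (simp add: I0_def[abs_def])

lemma prog1: "prog k I1"
  unfolding I1_def[abs_def]
proof (rule prog_table'[OF prog0])
  show "cmp (entry_known k I0 ''V'' gE 0 0 tV) (\<lambda>n u \<rho>. tV n u (\<rho> 2) (\<rho> 1) (\<rho> 0))"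
    unfolding tV_def V_def M_def by (intro cmp_if cmp_arith cmp_real_fsum cmp_dig) auto
qed (auto simp: I_defs stored_def)

lemma prog2: "prog k I2"
  unfolding I2_def[abs_def]
proof (rule prog_table'[OF prog1])
  show "cmp (entry_known k I1 ''W'' gE 0 0 tW) (\<lambda>n u \<rho>. tW n u (\<rho> 2) (\<rho> 1) (\<rho> 0))"
    unfolding tW_def wt_def weight_def by (intro cmp_real_fprod cmp_real_fsum cmp_arith cmp_dig) auto
qed (auto simp: I_defs stored_def)

lemma prog3: "prog k I3"
  unfolding I3_def[abs_def]
proof (rule prog_table'[OF prog2])
  show "cmp (entry_known k I2 ''S'' gE 0 k tS) (\<lambda>n u \<rho>. tS n u (\<rho> 2) (\<rho> 1) (\<rho> 0))"
    unfolding tS_def st_def noisy_def M_def by (intro cmp_fsum cmp_if cmp_arith cmp_dig cmp_lam) auto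
qed (auto simp: I_defs stored_def)

lemma prog4: "prog k I4"
  unfolding I4_def[abs_def]
proof (rule prog_table'[OF prog3])
  show "cmp (entry_known k I3 ''X'' k 0 0 tX) (\<lambda>n u \<rho>. tX n u (\<rho> 2) (\<rho> 1) (\<rho> 0))"
  proof -
    have *: "validy n y \<longleftrightarrow> (\<Sum>b<k. y div (n + 1) ^ b mod (n + 1) ^ 1) = n - 1" for n y
      by (simp add: validy_def dsum_def)
    show ?thesis unfolding tX_def *
      by (intro cmp_if cmpb_nat_eq cmp_real_fsum cmp_real_mod[where e = k] cmp_real_div[where e = k] cmp_real_sub cmp_arith)
        (auto intro: le_less_trans[OF div_le_dividend])
  qed
qed (auto simp: I_defs stored_def)

section \<open>Reading the tables and filling the next ones\<close>

lemma rd_V: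
  assumes "cmp P (\<lambda>n u \<rho>. real (f n u \<rho>))" "\<And>n u A \<rho>. P n u A \<rho> \<Longrightarrow> stored ''V'' gE 0 0 (tV n u) n A"
    "\<And>n u A \<rho>. P n u A \<rho> \<Longrightarrow> f n u \<rho> < (n + 1) ^ gE"
  shows "cmpb P (\<lambda>n u \<rho>. V n (f n u \<rho>))"
  using cmp_table[where a = "''V''" and g = tV, OF _ assms(1) cmp_const'(4)[of P 0] cmp_const'(4)[of P 0] assms(2,3)]
  by (simp add: tV_def cmpb_def)

lemma rd_W:
  assumes "cmp P (\<lambda>n u \<rho>. real (f n u \<rho>))" "\<And>n u A \<rho>. P n u A \<rho> \<Longrightarrow> stored ''W'' gE 0 0 (tW n u) n A"
    "\<And>n u A \<rho>. P n u A \<rho> \<Longrightarrow> f n u \<rho> < (n + 1) ^ gE"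
  shows "cmp P (\<lambda>n u \<rho>. real (wt n (f n u \<rho>)))"
  using cmp_table[where a = "''W''" and g = tW, OF _ assms(1) cmp_const'(4)[of P 0] cmp_const'(4)[of P 0] assms(2,3)]
  by (simp add: tW_def)

text \<open>For small \<open>n\<close> the range \<open>n + 1\<close> can be too short for
  \<open>k\<close> strategies; \<open>(n + 1)^k\<close> never is, which is why strategies index a
  side of that length.\<close>

lemma const_less: "1 \<le> n \<Longrightarrow> b < k \<Longrightarrow> b < (n + 1) ^ k"
proof -
  assume n: "1 \<le> n" and b: "b < k"
  have "k < 2 ^ k" by (rule less_exp)
  also have "(2 :: nat) ^ k \<le> (n + 1) ^ k" using n by (intro power_mono) auto
  finally show ?thesis using b by linarith
qed

lemma rd_S:
  assumes "cmp P (\<lambda>n u \<rho>. real (f n u \<rho>))" "\<And>n u A \<rho>. P n u A \<rho> \<Longrightarrow> 1 \<le> n \<and> stored ''S'' gE 0 k (tS n u) n A"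
    "\<And>n u A \<rho>. P n u A \<rho> \<Longrightarrow> f n u \<rho> < (n + 1) ^ gE" "b < k"
  shows "cmp P (\<lambda>n u \<rho>. st n (f n u \<rho>) b)"
proof -
  have "cmp P (\<lambda>n u \<rho>. tS n u (f n u \<rho>) 0 b)"
    by (rule cmp_table[where a = "''S''" and g = tS, OF _ assms(1) cmp_const'(4)[of P 0] cmp_const'(4)[of P b] _ assms(3)])
      (use assms(2,4) const_less in auto)
  then show ?thesis using assms(4) by (simp add: tS_def)
qed

lemma rd_X:
  assumes "cmp P (\<lambda>n u \<rho>. real (f n u \<rho>))" "\<And>n u A \<rho>. P n u A \<rho> \<Longrightarrow> stored ''X'' k 0 0 (tX n u) n A"
    "\<And>n u A \<rho>. P n u A \<rho> \<Longrightarrow> f n u \<rho> < (n + 1) ^ k"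
  shows "cmpb P (\<lambda>n u \<rho>. validy n (f n u \<rho>))"
  using cmp_table[where a = "''X''" and g = tX, OF _ assms(1) cmp_const'(4)[of P 0] cmp_const'(4)[of P 0] assms(2,3)]
  by (simp add: tX_def cmpb_def)

lemma rd_R:
  assumes "cmp P (\<lambda>n u \<rho>. real (f n u \<rho>))" "\<And>n u A \<rho>. P n u A \<rho> \<Longrightarrow> stored ''R'' k 0 0 (tR n u) n A"
    "\<And>n u A \<rho>. P n u A \<rho> \<Longrightarrow> f n u \<rho> < (n + 1) ^ k"
  shows "cmp P (\<lambda>n u \<rho>. real (rank n (f n u \<rho>)))"
  using cmp_table[where a = "''R''" and g = tR, OF _ assms(1) cmp_const'(4)[of P 0] cmp_const'(4)[of P 0] assms(2,3)]
  by (simp add: tR_def)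

lemma rd_N:
  assumes "\<And>n u A \<rho>. P n u A \<rho> \<Longrightarrow> stored ''N'' 0 0 0 (tN n u) n A"
  shows "cmp P (\<lambda>n u \<rho>. real (np n))"
  using cmp_table[where a = "''N''" and g = tN, OF _ cmp_const'(4)[of P 0] cmp_const'(4)[of P 0] cmp_const'(4)[of P 0] assms]
  by (simp add: tN_def)

lemmas rd_A = cmp_table[where a = "''A''" and g = tA and ?e1.0 = 1 and ?e2.0 = wE and ?e3.0 = k]
lemmas rd_F = cmp_table[where a = "''F''" and g = tF and ?e1.0 = 1 and ?e2.0 = wE and ?e3.0 = wE]

lemma cmp_enc: "cmp P (\<lambda>n u \<rho>. real (enc n b))"
  unfolding enc_def by (intro cmp_arith)

lemma cmp_thr: "cmp P (\<lambda>n u \<rho>. thr n)"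
  unfolding thr_def by (intro cmp_arith cmp_lam)

lemma prog5: "prog k I5"
  unfolding I5_def[abs_def]
proof (rule prog_table'[OF prog4])
  let ?P = "entry_known k I4 ''R'' k 0 0 tR"
  have "cmp ?P (\<lambda>n u \<rho>. \<Sum>y<(n + 1) ^ k. if y < \<rho> 2 \<and> validy n y then 1 else 0)"
    by (intro cmp_sum cmp_if cmpb_conj rd_X cmp_arith) (auto simp: I_defs)
  then show "cmp ?P (\<lambda>n u \<rho>. tR n u (\<rho> 2) (\<rho> 1) (\<rho> 0))"
    by (rule cmp_cong) (simp add: tR_def rank_def of_nat_sum if_distrib cong: if_cong)
qed (auto simp: I_defs stored_def)

lemma prog6: "prog k I6"
  unfolding I6_def[abs_def]
proof (rule prog_table'[OF prog5])
  let ?P = "entry_known k I5 ''N'' 0 0 0 tN"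
  have "cmp ?P (\<lambda>n u \<rho>. \<Sum>y<(n + 1) ^ k. if validy n y then 1 else 0)"
    by (intro cmp_sum cmp_if rd_X cmp_arith) (auto simp: I_defs)
  then show "cmp ?P (\<lambda>n u \<rho>. tN n u (\<rho> 2) (\<rho> 1) (\<rho> 0))"
    by (rule cmp_cong) (simp add: tN_def np_def of_nat_sum if_distrib cong: if_cong)
qed (auto simp: I_defs stored_def)

lemma tA_rec: "tA n u m t y = (if m = 0 then (if t = 0 \<and> y = 0 then 1 else 0) else
     \<Sum>c<(n + 1) ^ gE. if V n c \<and> wt n c \<le> t then
       \<Sum>b<k. if enc n b \<le> y then st n c b * tA n u (m - 1) (t - wt n c) (y - enc n b) else 0 else 0)"
  unfolding tA_def by (cases m) (simp_all cong: if_cong)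

lemma prog7: "prog k I7"
  unfolding I7_def[abs_def]
proof (rule prog_table'[OF prog6])
  let ?P = "entry_known k I6 ''A'' 1 wE k tA"
  have "cmp ?P (\<lambda>n u \<rho>. if \<rho> 2 = 0 then (if \<rho> 1 = 0 \<and> \<rho> 0 = 0 then 1 else 0) else
     \<Sum>c<(n + 1) ^ gE. if V n c \<and> wt n c \<le> \<rho> 1 then
       \<Sum>b<k. if enc n b \<le> \<rho> 0 then st n c b * tA n u (\<rho> 2 - 1) (\<rho> 1 - wt n c) (\<rho> 0 - enc n b) else 0 else 0)"
    \<comment> \<open>The layer being filled is \<open>\<rho> 2\<close> outside and
      \<open>\<rho> 3\<close> inside the sum over \<open>c\<close>, whose counter takes index
      0.\<close>
    by (intro cmp_if cmp_sum cmp_fsum cmpb_conj cmp_enc cmp_real_sub rd_V rd_W rd_S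
        cmp_table_rec[where a = "''A''" and g = tA and m = "\<lambda>n u \<rho>. \<rho> 3" and ?e1.0 = 1 and ?e2.0 = wE and ?e3.0 = k]
        cmp_arith)
      (auto simp: I_defs numeral_3_eq_3 numeral_2_eq_2 intro: less_imp_diff_less)
  then show "cmp ?P (\<lambda>n u \<rho>. tA n u (\<rho> 2) (\<rho> 1) (\<rho> 0))"
    by (rule cmp_cong) (rule tA_rec)
qed (auto simp: I_defs stored_def)

text \<open>The payoff list is read only at valid codes, for which the address lies within the list;
  \<open>(n + 1)^(1 + k + k)\<close> is a crude range, obtained from
  \<open>k \<le> (n + 1)^k\<close>.\<close>

lemma cmp_pay:
  assumes f: "cmp P (\<lambda>n u \<rho>. real (fi n u \<rho>))" "cmp P (\<lambda>n u \<rho>. real (fa n u \<rho>))" "cmp P (\<lambda>n u \<rho>. real (fy n u \<rho>))"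
    and P: "\<And>n u A \<rho>. P n u A \<rho> \<Longrightarrow> 1 \<le> n \<and> I6 n u A \<and> fi n u \<rho> < n \<and> fa n u \<rho> < k \<and> fy n u \<rho> < (n + 1) ^ k"
  shows "cmp P (\<lambda>n u \<rho>. pay n u (fi n u \<rho>) (fa n u \<rho>) (fy n u \<rho>))"
proof (rule cmp_cong)
  let ?Q = "\<lambda>n u A \<rho>. validy n (fy n u \<rho>) \<and> P n u A \<rho>"
  let ?j = "\<lambda>n u \<rho>. (fi n u \<rho> * k + fa n u \<rho>) * np n + rank n (fy n u \<rho>)"
  have S: "stored ''X'' k 0 0 (tX n u) n A \<and> stored ''R'' k 0 0 (tR n u) n A \<and> stored ''N'' 0 0 0 (tN n u) n A"
    if "P n u A \<rho>" for n u A \<rho> using P[OF that] by (simp add: I_defs)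
  have fQ: "cmp ?Q (\<lambda>n u \<rho>. real (fi n u \<rho>))" "cmp ?Q (\<lambda>n u \<rho>. real (fa n u \<rho>))" "cmp ?Q (\<lambda>n u \<rho>. real (fy n u \<rho>))"
    using f by (auto elim: cmp_mono)
  have "cmp ?Q (\<lambda>n u \<rho>. payoff_list n k u ! ?j n u \<rho>)"
  proof (rule cmp_read[where a = "''u''" and e = "1 + k + k"])
    show "cmp ?Q (\<lambda>n u \<rho>. real (?j n u \<rho>))"
      by (intro cmp_arith fQ rd_R rd_N) (use P S in auto)
    fix n u A \<rho> assume Q: "?Q n u A \<rho>"
    have n: "n \<ge> 1" using P Q by blast
    have "fi n u \<rho> * k + fa n u \<rho> < n * k" using P Q by (intro mixed_radix_less) blast+
    moreover have "rank n (fy n u \<rho>) < np n" using P Q by (intro rank_less_np) blast+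
    ultimately have "?j n u \<rho> < n * k * np n" by (rule mixed_radix_less)
    then have j: "?j n u \<rho> < length (payoff_list n k u)" by (simp add: length_payoff_list np[OF n] mult.assoc)
    have "np n \<le> (\<Sum>y<(n + 1) ^ k. 1)" unfolding np_def by (intro sum_mono) auto
    then have "np n \<le> (n + 1) ^ k" by simp
    moreover have "k \<le> (n + 1) ^ k"
      using const_less[OF n, of "k - 1"] k by linarith
    ultimately have "n * k * np n \<le> (n + 1) ^ 1 * (n + 1) ^ k * (n + 1) ^ k" by (intro mult_le_mono) auto
    with \<open>?j n u \<rho> < n * k * np n\<close> have "?j n u \<rho> < (n + 1) ^ (1 + k + k)" unfolding power_add by linarith
    moreover have "A ''u'' (?j n u \<rho>) = payoff_list n k u ! ?j n u \<rho>"
      using P Q j unfolding I_defs by blast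
    ultimately show "?j n u \<rho> < (n + 1) ^ (1 + k + k) \<and> A ''u'' (?j n u \<rho>) = payoff_list n k u ! ?j n u \<rho>" ..
  qed simp
  then show "cmp P (\<lambda>n u \<rho>. if validy n (fy n u \<rho>) then payoff_list n k u ! ?j n u \<rho> else 0)"
    by (intro cmp_if rd_X f cmp_const'(1)) (use P S in auto)
  show "pay n u (fi n u \<rho>) (fa n u \<rho>) (fy n u \<rho>) = (if validy n (fy n u \<rho>) then payoff_list n k u ! ?j n u \<rho> else 0)"
    if "P n u A \<rho>" for n u A \<rho>
    using P[OF that] unfolding pay_def by simp
qed

lemma prog8: "prog k I8"
  unfolding I8_def[abs_def]
proof (rule prog_table'[OF prog7])
  let ?P = "entry_known k I7 ''U'' wE 1 k tU"
  have "cmp ?P (\<lambda>n u \<rho>. if \<rho> 1 < n \<and> \<rho> 0 < k then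
      (\<Sum>y<(n + 1) ^ k. tA n u (n - 1) (\<rho> 2) y * pay n u (\<rho> 1) (\<rho> 0) y) / (\<Sum>y<(n + 1) ^ k. tA n u (n - 1) (\<rho> 2) y) else 0)"
    by (intro cmp_if cmpb_conj cmp_divide cmp_sum cmp_mult cmp_pay rd_A cmp_real_sub cmp_arith)
      (auto simp: I_defs numeral_2_eq_2)
  then show "cmp ?P (\<lambda>n u \<rho>. tU n u (\<rho> 2) (\<rho> 1) (\<rho> 0))"
    by (rule cmp_cong) (simp only: tU_def Ux_def tA_def)
qed (auto simp: I_defs stored_def)

lemma rd_U:
  assumes f: "cmp P (\<lambda>n u \<rho>. real (ft n u \<rho>))" "cmp P (\<lambda>n u \<rho>. real (fi n u \<rho>))" and a: "a < k"
    and P: "\<And>n u A \<rho>. P n u A \<rho> \<Longrightarrow> 1 \<le> n \<and> stored ''U'' wE 1 k (tU n u) n A \<and> fi n u \<rho> < n \<and> ft n u \<rho> < (n + 1) ^ wE"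
  shows "cmp P (\<lambda>n u \<rho>. Ux n u (ft n u \<rho>) (fi n u \<rho>) a)"
proof (rule cmp_cong)
  show "cmp P (\<lambda>n u \<rho>. tU n u (ft n u \<rho>) (fi n u \<rho>) a)"
    by (rule cmp_table[where a = "''U''" and ?e1.0 = wE and ?e2.0 = 1 and ?e3.0 = k, OF _ f cmp_const'(4)])
      (use P const_less a in \<open>auto simp: less_Suc_eq\<close>)
qed (use P a in \<open>auto simp: tU_def\<close>)

lemma prog9: "prog k I9"
  unfolding I9_def[abs_def]
proof (rule prog_table'[OF prog8])
  let ?P = "entry_known k I8 ''C'' wE 1 gE tC"
  have "cmp ?P (\<lambda>n u \<rho>. if \<rho> 1 < n \<and> V n (\<rho> 0) \<and> wt n (\<rho> 0) \<le> \<rho> 2 \<and>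
     0 < (\<Sum>y<(n + 1) ^ k. tA n u (n - 1) (\<rho> 2 - wt n (\<rho> 0)) y) \<and>
     (\<forall>a<k. Ux n u (\<rho> 2 - wt n (\<rho> 0)) (\<rho> 1) a \<le> thr n + (\<Sum>b<k. st n (\<rho> 0) b * Ux n u (\<rho> 2 - wt n (\<rho> 0)) (\<rho> 1) b))
     then 1 else 0)"
    by (intro cmp_if cmpb_conj cmpb_ball cmpb_less cmpb_le cmp_fsum cmp_sum cmp_real_sub cmp_thr rd_V rd_W rd_S rd_A rd_U cmp_arith)
      (auto simp: I_defs numeral_2_eq_2 intro: less_imp_diff_less)
  then show "cmp ?P (\<lambda>n u \<rho>. tC n u (\<rho> 2) (\<rho> 1) (\<rho> 0))"
    by (rule cmp_cong) (simp only: tC_def accx_def tA_def)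
qed (auto simp: I_defs stored_def)

lemma rd_C:
  assumes f: "cmp P (\<lambda>n u \<rho>. real (fT n u \<rho>))" "cmp P (\<lambda>n u \<rho>. real (fi n u \<rho>))" "cmp P (\<lambda>n u \<rho>. real (fc n u \<rho>))"
    and P: "\<And>n u A \<rho>. P n u A \<rho> \<Longrightarrow> stored ''C'' wE 1 gE (tC n u) n A \<and> fi n u \<rho> < n \<and> fT n u \<rho> < (n + 1) ^ wE \<and> fc n u \<rho> < (n + 1) ^ gE"
  shows "cmpb P (\<lambda>n u \<rho>. accx n u (fT n u \<rho>) (fi n u \<rho>) (fc n u \<rho>))"
  unfolding cmpb_def
proof (rule cmp_cong)
  show "cmp P (\<lambda>n u \<rho>. tC n u (fT n u \<rho>) (fi n u \<rho>) (fc n u \<rho>))"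
    by (rule cmp_table[where a = "''C''" and ?e1.0 = wE and ?e2.0 = 1 and ?e3.0 = gE, OF _ f])
      (use P in \<open>auto simp: less_Suc_eq\<close>)
qed (use P in \<open>auto simp: tC_def\<close>)

lemma tF_rec: "tF n u m T t = (if m = 0 then (if t = 0 then 1 else 0) else
     \<Sum>c<(n + 1) ^ gE. if accx n u T (m - 1) c \<and> wt n c \<le> t then tF n u (m - 1) T (t - wt n c) else 0)"
  unfolding tF_def by (cases m) (simp_all cong: if_cong)

lemma prog10: "prog k I10"
  unfolding I10_def[abs_def]
proof (rule prog_table'[OF prog9])
  let ?P = "entry_known k I9 ''F'' 1 wE wE tF"
  have "cmp ?P (\<lambda>n u \<rho>. if \<rho> 2 = 0 then (if \<rho> 0 = 0 then 1 else 0) else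
     \<Sum>c<(n + 1) ^ gE. if accx n u (\<rho> 1) (\<rho> 2 - 1) c \<and> wt n c \<le> \<rho> 0 then tF n u (\<rho> 2 - 1) (\<rho> 1) (\<rho> 0 - wt n c) else 0)"
    by (intro cmp_if cmp_sum cmpb_conj cmp_real_sub rd_W rd_C
        cmp_table_rec[where a = "''F''" and g = tF and m = "\<lambda>n u \<rho>. \<rho> 3" and ?e1.0 = 1 and ?e2.0 = wE and ?e3.0 = wE]
        cmp_arith)
      (auto simp: I_defs numeral_3_eq_3 numeral_2_eq_2 intro: less_imp_diff_less)
  then show "cmp ?P (\<lambda>n u \<rho>. tF n u (\<rho> 2) (\<rho> 1) (\<rho> 0))"
    by (rule cmp_cong) (rule tF_rec)
qed (auto simp: I_defs stored_def)

lemma Tx_less: "n \<ge> 1 \<Longrightarrow> anonymous_game n k u \<Longrightarrow> Tx n u < (n + 1) ^ wE"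
  using LeastI_ex[OF search_x(1)[of n u]] by (simp add: Tx_def goodx_def)

lemma prog11: "prog k I11"
  unfolding I11_def[abs_def]
proof (rule prog_table'[OF prog10])
  let ?P = "entry_known k I10 ''T'' 0 0 0 tT"
  have "cmp ?P (\<lambda>n u \<rho>. real (LEAST T. goodx n u T))"
  proof (rule cmp_least[where e = wE])
    show "cmpb (\<lambda>n u A \<rho>. \<rho> 0 < (n + 1) ^ wE \<and> ?P n u A (\<lambda>j. \<rho> (Suc j))) (\<lambda>n u \<rho>. goodx n u (\<rho> 0))"
      unfolding goodx_def tF_def[symmetric]
      by (intro cmpb_conj cmpb_less rd_F cmp_arith) (auto simp: I_defs)
    \<comment> \<open>Here the existence of a grid equilibrium enters the program: the search for a
      total weight succeeds.\<close>
    show "\<exists>T<(n + 1) ^ wE. goodx n u T" if "?P n u A \<rho>" for n u A \<rho>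
      using search_x(1)[of n u] that by (auto simp: goodx_def)
  qed
  then show "cmp ?P (\<lambda>n u \<rho>. tT n u (\<rho> 2) (\<rho> 1) (\<rho> 0))"
    by (rule cmp_cong) (simp only: tT_def Tx_def)
qed (auto simp: I_defs stored_def)

lemma rd_T:
  assumes "\<And>n u A \<rho>. P n u A \<rho> \<Longrightarrow> stored ''T'' 0 0 0 (tT n u) n A"
  shows "cmp P (\<lambda>n u \<rho>. real (Tx n u))"
  using cmp_table[where a = "''T''" and g = tT, OF _ cmp_const'(4)[of P 0] cmp_const'(4)[of P 0] cmp_const'(4)[of P 0] assms]
  by (simp add: tT_def)

abbreviation "pickx n u \<equiv> pick (accx n u (Tx n u)) (wt n) ((n + 1) ^ gE)"
abbreviation "restx n u \<equiv> rest (accx n u (Tx n u)) (wt n) ((n + 1) ^ gE) n (Tx n u)"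

text \<open>\<open>pick\<close> is tabulated for every weight, before it is known which weights
  occur in the reconstruction.\<close>

lemma prog12: "prog k I12"
  unfolding I12_def[abs_def]
proof (rule prog_table'[OF prog11])
  let ?P = "entry_known k I11 ''P'' 1 wE 0 tP"
  let ?b = "\<lambda>n u c \<rho>. c < (n + 1) ^ gE \<and> accx n u (Tx n u) (\<rho> 2) c \<and> wt n c \<le> \<rho> 1 \<and> 0 < tF n u (\<rho> 2) (Tx n u) (\<rho> 1 - wt n c)"
  have "cmp (\<lambda>n u A \<rho>. 0 < tF n u (Suc (\<rho> 2)) (Tx n u) (\<rho> 1) \<and> \<rho> 2 < n \<and> ?P n u A \<rho>) (\<lambda>n u \<rho>. real (LEAST c. ?b n u c \<rho>))"
  proof (rule cmp_least[where e = gE])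
    show "cmpb (\<lambda>n u A \<rho>. \<rho> 0 < (n + 1) ^ gE \<and> 0 < tF n u (Suc (\<rho> (Suc 2))) (Tx n u) (\<rho> (Suc 1)) \<and> \<rho> (Suc 2) < n \<and> ?P n u A (\<lambda>j. \<rho> (Suc j)))
      (\<lambda>n u \<rho>. \<rho> 0 < (n + 1) ^ gE \<and> accx n u (Tx n u) (\<rho> (Suc 2)) (\<rho> 0) \<and> wt n (\<rho> 0) \<le> \<rho> (Suc 1) \<and>
        0 < tF n u (\<rho> (Suc 2)) (Tx n u) (\<rho> (Suc 1) - wt n (\<rho> 0)))"
      by (intro cmpb_conj cmpb_less cmp_real_sub rd_W rd_C rd_F rd_T cmp_arith)
        (auto simp: I_defs Tx_less[unfolded Suc_eq_plus1[symmetric]] intro: less_imp_diff_less)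
    fix n u A \<rho> assume "0 < tF n u (Suc (\<rho> 2)) (Tx n u) (\<rho> 1) \<and> \<rho> 2 < n \<and> ?P n u A \<rho>"
    then show "\<exists>c<(n + 1) ^ gE. ?b n u c \<rho>" using assignments_step unfolding tF_def by blast
  qed
  then have "cmp ?P (\<lambda>n u \<rho>. if \<rho> 2 < n then if 0 < tF n u (Suc (\<rho> 2)) (Tx n u) (\<rho> 1) then real (LEAST c. ?b n u c \<rho>) else 0 else 0)"
    by (intro cmp_if cmpb_less rd_F rd_T cmp_real_Suc cmp_arith) 
      (auto simp: I_defs Tx_less[unfolded Suc_eq_plus1[symmetric]])
  then show "cmp ?P (\<lambda>n u \<rho>. tP n u (\<rho> 2) (\<rho> 1) (\<rho> 0))"
    by (rule cmp_cong) (simp add: tP_def pick_def tF_def)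
qed (auto simp: I_defs stored_def)

lemma pick_less: "pickx n u i t < (n + 1) ^ gE"
  using pick(1)[of "accx n u (Tx n u)" "wt n" "(n + 1) ^ gE" i t] by (cases "0 < assignments (accx n u (Tx n u)) (wt n) ((n + 1) ^ gE) (Suc i) t")
    (auto simp: pick_def)

lemma rest_le: "restx n u j \<le> Tx n u"
  by (induction j) auto

lemma rd_P:
  assumes f: "cmp P (\<lambda>n u \<rho>. real (fi n u \<rho>))" "cmp P (\<lambda>n u \<rho>. real (ft n u \<rho>))"
    and P: "\<And>n u A \<rho>. P n u A \<rho> \<Longrightarrow> stored ''P'' 1 wE 0 (tP n u) n A \<and> fi n u \<rho> < n \<and> ft n u \<rho> < (n + 1) ^ wE"
  shows "cmp P (\<lambda>n u \<rho>. real (pickx n u (fi n u \<rho>) (ft n u \<rho>)))"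
proof (rule cmp_cong)
  show "cmp P (\<lambda>n u \<rho>. tP n u (fi n u \<rho>) (ft n u \<rho>) 0)"
    by (rule cmp_table[where a = "''P''" and ?e1.0 = 1 and ?e2.0 = wE and ?e3.0 = 0, OF _ f cmp_const'(4)])
      (use P in \<open>auto simp: less_Suc_eq\<close>)
qed (use P in \<open>auto simp: tP_def\<close>)

lemma tQ_rec: "tQ n u i j l = (if i = 0 then real (Tx n u) else
     real (restx n u (i - 1) - wt n (pickx n u (n - 1 - (i - 1)) (restx n u (i - 1)))))"
  unfolding tQ_def by (cases i) simp_all

text \<open>The remaining weight is read back from a real array and used in addresses; reading by
  search accepts any term with a natural number as its value. \<open>rest_le\<close> keeps these
  addresses in range.\<close>

lemma prog13: "prog k I13"
  unfolding I13_def[abs_def]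
proof (rule prog_table'[OF prog12])
  let ?P = "entry_known k I12 ''Q'' 1 0 0 tQ"
  have rest: "cmp (\<lambda>n u A \<rho>. \<not> \<rho> 2 = 0 \<and> ?P n u A \<rho>) (\<lambda>n u \<rho>. real (restx n u (\<rho> 2 - 1)))"
  proof -
    have "cmp (\<lambda>n u A \<rho>. \<not> \<rho> 2 = 0 \<and> ?P n u A \<rho>) (\<lambda>n u \<rho>. tQ n u (\<rho> 2 - 1) 0 0)"
      by (intro cmp_table_rec[where a = "''Q''" and g = tQ and m = "\<lambda>n u \<rho>. \<rho> 2" and ?e1.0 = 1 and ?e2.0 = 0 and ?e3.0 = 0]
          cmp_real_sub cmp_arith) auto
    then show ?thesis by (simp add: tQ_def)
  qed
  have less: "restx n u j < (n + 1) ^ wE" if "1 \<le> n" "anonymous_game n k u" for n u j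
    using rest_le[of n u j] Tx_less[OF that] by linarith
  have "cmp ?P (\<lambda>n u \<rho>. if \<rho> 2 = 0 then real (Tx n u) else
     real (restx n u (\<rho> 2 - 1) - wt n (pickx n u (n - 1 - (\<rho> 2 - 1)) (restx n u (\<rho> 2 - 1)))))"
    by (intro cmp_if cmp_real_sub rest rd_T rd_W rd_P cmp_arith)
      (use less pick_less in \<open>auto simp: I_defs\<close>)
  then show "cmp ?P (\<lambda>n u \<rho>. tQ n u (\<rho> 2) (\<rho> 1) (\<rho> 0))"
    by (rule cmp_cong) (rule tQ_rec)
qed (auto simp: I_defs stored_def)

lemma prog14: "prog k I14"
  unfolding I14_def[abs_def]
proof (rule prog_table'[OF prog13])
  let ?P = "entry_known k I13 ''s'' (k + 1) 0 0 tO"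
  let ?R = "\<lambda>n u A \<rho>. \<rho> 0 < n \<and> \<rho> 0 < (n + 1) ^ 1 \<and> ?P n u A (\<lambda>j. \<rho> (Suc j))"
  have less: "restx n u j < (n + 1) ^ wE" if "1 \<le> n" "anonymous_game n k u" for n u j
    using rest_le[of n u j] Tx_less[OF that] by linarith
  have "cmp ?R (\<lambda>n u \<rho>. real (restx n u (n - 1 - \<rho> 0)))"
  proof -
    have "cmp ?R (\<lambda>n u \<rho>. tQ n u (n - 1 - \<rho> 0) 0 0)"
      by (intro cmp_table[where a = "''Q''" and g = tQ and ?e1.0 = 1 and ?e2.0 = 0 and ?e3.0 = 0] cmp_real_sub cmp_arith)
        (auto simp: I_defs)
    then show ?thesis by (simp add: tQ_def)
  qed
  then have ch: "cmp ?R (\<lambda>n u \<rho>. real (ch n u (\<rho> 0)))"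
    unfolding ch_def choice_def by (intro rd_P cmp_arith) (use less in \<open>auto simp: I_defs\<close>)
  have ch_less: "ch n u i < (n + 1) ^ gE" for n u i
    unfolding ch_def choice_def by (rule pick_less)
  have "cmp ?R (\<lambda>n u \<rho>. \<Sum>a<k. if \<rho> (Suc 2) = \<rho> 0 * k + a then st n (ch n u (\<rho> 0)) a else 0)"
  proof (intro cmp_fsum cmp_if cmp_arith)
    fix a assume a: "a < k"
    let ?S = "\<lambda>n u A \<rho>. \<rho> (Suc 2) = \<rho> 0 * k + a \<and> ?R n u A \<rho>"
    have "cmp ?S (\<lambda>n u \<rho>. real (ch n u (\<rho> 0)))" using ch by (rule cmp_mono) blast
    then show "cmp ?S (\<lambda>n u \<rho>. st n (ch n u (\<rho> 0)) a)"
      by (rule rd_S) (use ch_less a in \<open>auto simp: I_defs\<close>)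
  qed
  then show "cmp ?P (\<lambda>n u \<rho>. tO n u (\<rho> 2) (\<rho> 1) (\<rho> 0))"
    unfolding tO_def by (intro cmp_sum cmp_if cmp_arith)
qed (auto simp: I_defs stored_def)

section \<open>The output and the complete algorithm\<close>

lemma tO_at:
  assumes i: "i < n" and a: "a < k"
  shows "tO n u (i * k + a) j l = st n (ch n u i) a"
proof -
  have "(\<Sum>a'<k. if i * k + a = i' * k + a' then st n (ch n u i') a' else 0) = (if i' = i then st n (ch n u i) a else 0)" for i'
  proof -
    have "i * k + a = i' * k + a' \<longleftrightarrow> i' = i \<and> a' = a" if "a' < k" for a'
      using mixed_radix_eq_iff[OF that, of "i * k + a" i'] a by auto
    then have "(\<Sum>a'<k. if i * k + a = i' * k + a' then st n (ch n u i') a' else 0) =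
       (\<Sum>a'<k. if a' = a then (if i' = i then st n (ch n u i) a else 0) else 0)"
      by (intro sum.cong refl) auto
    then show ?thesis using a by simp
  qed
  then have "tO n u (i * k + a) j l = (\<Sum>i'<(n + 1) ^ 1. if i' = i then st n (ch n u i) a else 0)"
    unfolding tO_def using i a by (intro sum.cong refl) auto
  then show ?thesis using i by simp
qed

theorem algorithm_exists:
  "\<exists>(A :: com) (p :: nat poly). \<forall>(n :: nat) (u :: payoffs).
           n \<ge> 1 \<longrightarrow> anonymous_game n k u \<longrightarrow>
           (\<exists>t \<tau> s. exec A (input_state n k u) t \<tau> \<and> t \<le> poly p n \<and>
                    outputs_profile n k \<tau> s \<and>
                    approx_nash n k u (1 / real n powr (1 - \<delta>)) s)"
proof -
  obtain c p where cp: "\<And>n u. 1 \<le> n \<Longrightarrow> anonymous_game n k u \<Longrightarrow>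
     \<exists>t \<tau>. exec c (input_state n k u) t \<tau> \<and> t \<le> poly p n \<and> I14 n u (reals \<tau>)"
    using prog_poly[OF prog14] by blast
  have "\<exists>t \<tau> s. exec c (input_state n k u) t \<tau> \<and> t \<le> poly p n \<and> outputs_profile n k \<tau> s \<and>
      approx_nash n k u (1 / real n powr (1 - \<delta>)) s" if n: "n \<ge> 1" "anonymous_game n k u" for n u
  proof -
    obtain t \<tau> where \<tau>: "exec c (input_state n k u) t \<tau>" "t \<le> poly p n" "I14 n u (reals \<tau>)"
      using cp[OF n] by blast
    obtain s where s: "approx_nash n k u (1 / real n powr (1 - \<delta>)) s"
      "\<And>i a. i < n \<Longrightarrow> a < k \<Longrightarrow> pmf (s i) a = st n (ch n u i) a"
      using search_x(3)[OF n] by blast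
    have "reals \<tau> ''s'' (i * k + a) = pmf (s i) a" if ia: "i < n" "a < k" for i a
    proof -
      have "i * k + a < n * k" by (rule mixed_radix_less[OF ia])
      also have "n * k \<le> (n + 1) * (n + 1) ^ k"
        using const_less[OF n(1), of "k - 1"] k by (intro mult_le_mono) linarith+
      finally have "i * k + a < (n + 1) ^ (k + 1)" by simp
      with storedD[of "''s''" "k + 1" 0 0 "tO n u" n "reals \<tau>" "i * k + a" 0 0] \<tau>(3)
      have "reals \<tau> ''s'' (i * k + a) = tO n u (i * k + a) 0 0" by (simp add: I14_def)
      then show ?thesis using tO_at[OF ia] s(2)[OF ia] by simp
    qed
    then have "outputs_profile n k \<tau> s" by (simp add: outputs_profile_def)
    with \<tau>(1,2) s(1) show ?thesis by blast
  qed
  then show ?thesis by blast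
qed

end

theorem theorem1p1:
  fixes \<delta> :: real and k :: nat
  assumes "\<delta> > 0" and "k \<ge> 1"
  shows "\<exists>(A :: com) (p :: nat poly). \<forall>(n :: nat) (u :: payoffs).
           n \<ge> 1 \<longrightarrow> anonymous_game n k u \<longrightarrow>
           (\<exists>t \<tau> s. exec A (input_state n k u) t \<tau> \<and> t \<le> poly p n \<and>
                    outputs_profile n k \<tau> s \<and>
                    approx_nash n k u (1 / real n powr (1 - \<delta>)) s)"
proof -
  obtain q N0 K h where *: "q \<ge> 1" "N0 \<le> K" "h \<ge> 2" "16 * k ^ 3 \<le> 2 ^ (h - 2)"
    "\<forall>n\<ge>1. lam q N0 n + 3 / (8 * real (n + 1)) \<le> 1 / real n powr (1 - \<delta>)"
    "\<forall>n\<ge>N0. \<exists>r. 0 \<le> r \<and> r \<le> 1 / 2 \<and>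
     real ((n + 1) ^ k) * (2 * exp (- (real (n - 1) * lam q N0 n * r\<^sup>2 / (4 * real k))) + 12 * real (n - 1) * r ^ Suc K)
       \<le> 1 / (16 * real (n + 1))"
    using parameters_exist[OF assms] by blast
  interpret scheme k q N0 K h \<delta>
    by unfold_locales (use assms(2) * in blast)+
  show ?thesis by (rule algorithm_exists)
qed

end
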